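(* Let $E\in\mathbb{C}^{n\times n}$ be Hermitian, $F\in\mathbb{C}^{m\times n}$, $G\in\mathbb{C}^{m\times m}$, $q\in\mathbb{C}^n$, $r\in\mathbb{C}^m$, with $\begin{bmatrix}E&F^*\\ F&G\end{bmatrix}$ nonsingular, let $\alpha_1,\alpha_2,\alpha_3,\beta_1,\beta_2>0$, and let $\widehat{x}=[\widehat u^{T},\widehat p^{T}]^{T}$ with $\widehat u\in\mathbb{C}^n$, $\widehat p\in\mathbb{C}^m$ be a computed (approximate) solution of $\begin{bmatrix}E&F^*\\ F&G\end{bmatrix}\begin{bmatrix}u\\ p\end{bmatrix}=\begin{bmatrix}q\\ r\end{bmatrix}$. Put $Q=q-E\widehat u-F^*\widehat p$, $R=r-F\widehat u-G\widehat p$, $\mathcal{I}_1=[-\beta_1^{-1}I_{2n}\;\;0_{2n\times 2m}]$, $\mathcal{I}_2=[0_{2m\times 2n}\;\;-\beta_2^{-1}I_{2m}]$, $\mathbf{X}_1=[\widehat{\mathbf{X}}_1\;\;0_{2n\times 2m^2}]$, $\mathbf{X}_2=[0_{2m\times n^2}\;\;\widehat{\mathbf{X}}_2]$, where $$\widehat{\mathbf{X}}_1=\begin{bmatrix}\alpha_1^{-1}(\Re(\widehat u)^T\otimes I_n)N_1&-\alpha_1^{-1}(\Im(\widehat u)^T\otimes I_n)N_2&\alpha_2^{-1}(I_n\otimes\Re(\widehat p)^T)\Sigma_F&\alpha_2^{-1}(I_n\otimes\Im(\widehat p)^T)\Sigma_F\\ \alpha_1^{-1}(\Im(\widehat u)^T\otimes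 I_n)N_1&\alpha_1^{-1}(\Re(\widehat u)^T\otimes I_n)N_2&\alpha_2^{-1}(I_n\otimes\Im(\widehat p)^T)\Sigma_F&-\alpha_2^{-1}(I_n\otimes\Re(\widehat p)^T)\Sigma_F\end{bmatrix},$$ $$\widehat{\mathbf{X}}_2=\begin{bmatrix}\alpha_2^{-1}(\Re(\widehat u)^T\otimes I_m)\Sigma_F&-\alpha_2^{-1}(\Im(\widehat u)^T\otimes I_m)\Sigma_F&\alpha_3^{-1}(\Re(\widehat p)^T\otimes I_m)\Sigma_G&-\alpha_3^{-1}(\Im(\widehat p)^T\otimes I_m)\Sigma_G\\ \alpha_2^{-1}(\Im(\widehat u)^T\otimes I_m)\Sigma_F&\alpha_2^{-1}(\Re(\widehat u)^T\otimes I_m)\Sigma_F&\alpha_3^{-1}(\Im(\widehat p)^T\otimes I_m)\Sigma_G&\alpha_3^{-1}(\Re(\widehat p)^T\otimes I_m)\Sigma_G\end{bmatrix}.$$ Let $\mathbf{W}=\begin{bmatrix}\mathbf{X}_1&\mathcal{I}_1\\ \mathbf{X}_2&\mathcal{I}_2\end{bmatrix}$, $\mathbf{s}=n^2+2mn+2m^2$, $\mathbf{l}=\mathbf{s}+2(m+n)$, $\mathbf{n}_1=\frac{n(n+1)}2$, $\mathbf{n}_2=\frac{n(n-1)}2$, and $$w=\mathbf{W}^T(\mathbf{W}\mathbf{W}^T)^{-1}\begin{bmatrix}\Re(Q)\\ \Im(Q)\\ \Re(R)\\ \Im(R)\end{bmatrix}\in\mathbb{R}^{\mathbf{l}}.$$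 Then optimal sparsity-preserving backward perturbations, i.e. perturbations admissible for the minimization defining $\xi^{\mathcal{G}_1}_{\rm sps}(\widehat u,\widehat p)$ at which that minimum is attained, are given by $\Delta E_{\rm opt}=\Re(\Delta E_{\rm opt})+i\,\Im(\Delta E_{\rm opt})$ with $\Re(\Delta E_{\rm opt})$ symmetric and $\Im(\Delta E_{\rm opt})$ skew-symmetric determined by $$\mathrm{vec}_S(\Re(\Delta E_{\rm opt}))=\alpha_1^{-1}\mathfrak{D}_{S,n}^{-1}[\,I_{\mathbf{n}_1}\;\;0_{\mathbf{n}_1\times(\mathbf{l}-\mathbf{n}_1)}]\,w,\qquad \mathrm{vec}_{SK}(\Im(\Delta E_{\rm opt}))=\alpha_1^{-1}\mathfrak{D}_{SK,n}^{-1}[\,0_{\mathbf{n}_2\times\mathbf{n}_1}\;\;I_{\mathbf{n}_2}\;\;0_{\mathbf{n}_2\times(\mathbf{l}-n^2)}]\,w,$$ and $$\mathrm{vec}(\Delta F_{\rm opt})=\alpha_2^{-1}[\,0_{nm\times n^2}\;\;I_{nm}\;\;iI_{nm}\;\;0_{nm\times(\mathbf{l}-n^2-2nm)}]\,w,$$ $$\mathrm{vec}(\Delta G_{\rm opt})=\alpha_3^{-1}[\,0_{m^2\times(n^2+2nm)}\;\;I_{m^2}\;\;iI_{m^2}\;\;0_{m^2\times 2(m+n)}]\,w,$$ $$\Delta q_{\rm opt}=\beta_1^{-1}[\,0_{n\times(\mathbf{l}-2(n+m))}\;\;I_n\;\;iI_n\;\;0_{n\times 2m}]\,w,\qquad \Delta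 r_{\rm opt}=\beta_2^{-1}[\,0_{m\times(\mathbf{l}-2m)}\;\;I_m\;\;iI_m]\,w.$$
   Context: Notation. $\Re,\Im$ are entrywise real and imaginary parts, $T$ is transpose, $*$ is conjugate transpose, $\otimes$ is the Kronecker product, $\odot$ the entrywise product, and $\mathrm{vec}$ stacks columns. For a matrix $X$, $\Theta_X$ is the matrix of the same size with entry $1$ where $X$ has a nonzero entry and $0$ where $X$ has a zero entry; $\Sigma_X=\mathrm{diag}(\mathrm{vec}(\Theta_X))$. For a real symmetric $k\times k$ matrix $Z$, $\mathrm{vec}_S(Z)\in\mathbb{R}^{k(k+1)/2}$ stacks the columns of the lower triangle including the diagonal: $(z_{11},\dots,z_{k1},z_{22},\dots,z_{k2},\dots,z_{kk})^T$. For a real skew-symmetric $Z$, $\mathrm{vec}_{SK}(Z)\in\mathbb{R}^{k(k-1)/2}$ stacks the columns of the strict lower triangle: $(z_{21},\dots,z_{k1},z_{32},\dots,z_{k2},\dots,z_{k(k-1)})^T$. $\mathcal{J}^k_S\in\mathbb{R}^{k^2\times k(k+1)/2}$ and $\mathcal{J}^k_{SK}\in\mathbb{R}^{k^2\times k(k-1)/2}$ are the matrices with $\mathrm{vec}(Z)=\mathcal{J}^k_S\mathrm{vec}_S(Z)$ for all real symmetric $Z$ and $\mathrm{vec}(Z)=\mathcal{J}^k_{SK}\mathrm{vec}_{SK}(Z)$ for all real skew-symmetric $Z$. For Hermitian $X$ of size $k$, $\Phi_X=\mathrm{diag}(\mathrm{vec}_S(\Theta_X))$ and $\Psi_X$ is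 the diagonal matrix whose diagonal is $(\Theta_X(1,2),\dots,\Theta_X(1,k),\Theta_X(2,3),\dots,\Theta_X(2,k),\dots,\Theta_X(k-1,k))$. $\mathfrak{D}_{S,k}$ is the diagonal matrix of size $k(k+1)/2$ with entry $1$ at the positions that $\mathrm{vec}_S$ assigns to diagonal entries, i.e. $j=\frac{(2k-(i-2))(i-1)}{2}+1$, $i=1,\dots,k$, and $\sqrt2$ at all other positions; $\mathfrak{D}_{SK,k}=\sqrt2\,I_{k(k-1)/2}$. Set $N_1=\mathcal{J}^n_S\Phi_E\mathfrak{D}_{S,n}^{-1}$, $N_2=\mathcal{J}^n_{SK}\Psi_E\mathfrak{D}_{SK,n}^{-1}$. Structured backward error. $\mathcal{G}_1$ is the set of tuples $(\Delta E,\Delta F,\Delta G,\Delta q,\Delta r)$ with $\Delta E\in\mathbb{C}^{n\times n}$ Hermitian, $\Delta F\in\mathbb{C}^{m\times n}$, $\Delta G\in\mathbb{C}^{m\times m}$, $\Delta q\in\mathbb{C}^n$, $\Delta r\in\mathbb{C}^m$ such that $$\begin{bmatrix}E+\Delta E&(F+\Delta F)^*\\ F+\Delta F&G+\Delta G\end{bmatrix}\begin{bmatrix}\widehat u\\ \widehat p\end{bmatrix}=\begin{bmatrix}q+\Delta q\\ r+\Delta r\end{bmatrix}.$$ Let $\zeta^{\sigma_1}(\Delta E,\Delta F,\Delta G,\Delta q,\Delta r)=\sqrt{\alpha_1^2\|\Delta E\|_F^2+\alpha_2^2\|\Delta F\|_F^2+\alpha_3^2\|\Delta G\|_F^2+\beta_1^2\|\Delta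 q\|_2^2+\beta_2^2\|\Delta r\|_2^2}$ ($\|\cdot\|_F$ the Frobenius norm). The sparsity-preserving structured backward error $\xi^{\mathcal{G}_1}_{\rm sps}(\widehat u,\widehat p)$ is the minimum of $\zeta^{\sigma_1}(\Delta E\odot\Theta_E,\Delta F\odot\Theta_F,\Delta G\odot\Theta_G,\Delta q,\Delta r)$ over all perturbations with $(\Delta E\odot\Theta_E,\Delta F\odot\Theta_F,\Delta G\odot\Theta_G,\Delta q,\Delta r)\in\mathcal{G}_1$. "Optimal sparsity-preserving backward perturbations" are tuples $(\Delta E,\Delta F,\Delta G,\Delta q,\Delta r)\in\mathcal{G}_1$ with $\Delta E=\Delta E\odot\Theta_E$, $\Delta F=\Delta F\odot\Theta_F$, $\Delta G=\Delta G\odot\Theta_G$ and $\zeta^{\sigma_1}(\Delta E,\Delta F,\Delta G,\Delta q,\Delta r)=\xi^{\mathcal{G}_1}_{\rm sps}(\widehat u,\widehat p)$. *)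

theory Defs
  imports
    "Jordan_Normal_Form.Gauss_Jordan_Elimination"
    "Jordan_Normal_Form.Schur_Decomposition"
begin

section \<open>Matrix operations\<close>

definition append_cols :: "'a :: zero mat \<Rightarrow> 'a mat \<Rightarrow> 'a mat"  (infixr \<open>@\<^sub>c\<close> 65) where
  "A @\<^sub>c B = four_block_mat A B (0\<^sub>m 0 (dim_col A)) (0\<^sub>m 0 (dim_col B))"

definition kronecker_mat :: "'a :: times mat \<Rightarrow> 'a mat \<Rightarrow> 'a mat"  (infixl \<open>\<otimes>\<^sub>K\<close> 75) where
  "A \<otimes>\<^sub>K B = mat (dim_row A * dim_row B) (dim_col A * dim_col B)
     (\<lambda>(i, j). A $$ (i div dim_row B, j div dim_col B) * B $$ (i mod dim_row B, j mod dim_col B))"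

definition hadamard_mat :: "'a :: times mat \<Rightarrow> 'a mat \<Rightarrow> 'a mat"  (infixl \<open>\<odot>\<^sub>m\<close> 75) where
  "A \<odot>\<^sub>m B = mat (dim_row A) (dim_col A) (\<lambda>ij. A $$ ij * B $$ ij)"

text \<open>Only applied to invertible matrices; \<^const>\<open>mat_inverse\<close> is the partial inverse.\<close>

definition mat_inv :: "'a :: field mat \<Rightarrow> 'a mat" where
  "mat_inv A = the (mat_inverse A)"

definition diag_of_vec :: "'a :: zero vec \<Rightarrow> 'a mat" where
  "diag_of_vec v = mat_diag (dim_vec v) (\<lambda>i. v $ i)"

definition frobenius_norm :: "complex mat \<Rightarrow> real" where
  "frobenius_norm A = sqrt (\<Sum>i<dim_row A. \<Sum>j<dim_col A. (cmod (A $$ (i, j)))\<^sup>2)"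

definition two_norm :: "complex vec \<Rightarrow> real" where
  "two_norm v = sqrt (\<Sum>i<dim_vec v. (cmod (v $ i))\<^sup>2)"


section \<open>Vectorizations\<close>

text \<open>Column stacking: entry \<open>(i, j)\<close> sits at position \<open>j * dim_row A + i\<close>.\<close>

definition vec_of_mat :: "'a mat \<Rightarrow> 'a vec" where
  "vec_of_mat A = vec (dim_row A * dim_col A) (\<lambda>l. A $$ (l mod dim_row A, l div dim_row A))"

definition vec_S :: "'a mat \<Rightarrow> 'a vec" where
  "vec_S Z = vec_of_list
     (concat (map (\<lambda>j. map (\<lambda>i. Z $$ (i, j)) [j..<dim_row Z]) [0..<dim_col Z]))"

definition vec_SK :: "'a mat \<Rightarrow> 'a vec" where
  "vec_SK Z = vec_of_list
     (concat (map (\<lambda>j. map (\<lambda>i. Z $$ (i, j)) [Suc j..<dim_row Z]) [0..<dim_col Z]))"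

definition J_S :: "nat \<Rightarrow> real mat" where
  "J_S k = (THE J. J \<in> carrier_mat (k\<^sup>2) (k * (k + 1) div 2) \<and>
     (\<forall>Z \<in> carrier_mat k k. transpose_mat Z = Z \<longrightarrow> vec_of_mat Z = J *\<^sub>v vec_S Z))"

definition J_SK :: "nat \<Rightarrow> real mat" where
  "J_SK k = (THE J. J \<in> carrier_mat (k\<^sup>2) (k * (k - 1) div 2) \<and>
     (\<forall>Z \<in> carrier_mat k k. transpose_mat Z = - Z \<longrightarrow> vec_of_mat Z = J *\<^sub>v vec_SK Z))"

text \<open>
  The condition lists the 1-based positions \<open>(2k - (i - 2))(i - 1)/2 + 1\<close>, \<open>i = 1, \<dots>, k\<close>, with
  \<open>2k - (i - 2)\<close> written as \<open>2k + 2 - i\<close> to avoid truncated subtraction at \<open>i = 1\<close>.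
\<close>

definition D_S :: "nat \<Rightarrow> real mat" where
  "D_S k = mat_diag (k * (k + 1) div 2)
     (\<lambda>p. if \<exists>i \<in> {1..k}. p + 1 = (2 * k + 2 - i) * (i - 1) div 2 + 1 then 1 else sqrt 2)"

definition D_SK :: "nat \<Rightarrow> real mat" where
  "D_SK k = sqrt 2 \<cdot>\<^sub>m 1\<^sub>m (k * (k - 1) div 2)"


section \<open>Sparsity patterns\<close>

definition Theta :: "complex mat \<Rightarrow> 'a :: zero_neq_one mat" where
  "Theta X = map_mat (\<lambda>x. if x \<noteq> 0 then 1 else 0) X"

definition Sigma_mat :: "complex mat \<Rightarrow> real mat" where
  "Sigma_mat X = diag_of_vec (vec_of_mat (Theta X))"

definition Phi_mat :: "complex mat \<Rightarrow> real mat" where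
  "Phi_mat X = diag_of_vec (vec_S (Theta X))"

text \<open>The diagonal lists the strict upper triangle of the pattern row by row.\<close>

definition Psi_mat :: "complex mat \<Rightarrow> real mat" where
  "Psi_mat X = diag_of_vec (vec_of_list
     (concat (map (\<lambda>i. map (\<lambda>j. Theta X $$ (i, j)) [Suc i..<dim_col X]) [0..<dim_row X])))"


section \<open>Structured backward error\<close>

type_synonym perturbation =
  "complex mat \<times> complex mat \<times> complex mat \<times> complex vec \<times> complex vec"

text \<open>The weights \<open>(\<alpha>\<^sub>1, \<alpha>\<^sub>2, \<alpha>\<^sub>3, \<beta>\<^sub>1, \<beta>\<^sub>2)\<close>.\<close>

type_synonym weights = "real \<times> real \<times> real \<times> real \<times> real"

definition G1 ::
  "complex mat \<Rightarrow> complex mat \<Rightarrow> complex mat \<Rightarrow> complex vec \<Rightarrow> complex vec \<Rightarrow>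
   complex vec \<Rightarrow> complex vec \<Rightarrow> perturbation set" where
  "G1 E F G q r u p = (let n = dim_row E; m = dim_row G in
     {(\<Delta>E, \<Delta>F, \<Delta>G, \<Delta>q, \<Delta>r).
        \<Delta>E \<in> carrier_mat n n \<and> mat_adjoint \<Delta>E = \<Delta>E \<and>
        \<Delta>F \<in> carrier_mat m n \<and> \<Delta>G \<in> carrier_mat m m \<and>
        \<Delta>q \<in> carrier_vec n \<and> \<Delta>r \<in> carrier_vec m \<and>
        four_block_mat (E + \<Delta>E) (mat_adjoint (F + \<Delta>F)) (F + \<Delta>F) (G + \<Delta>G) *\<^sub>v (u @\<^sub>v p)
          = (q + \<Delta>q) @\<^sub>v (r + \<Delta>r)})"

fun zeta :: "weights \<Rightarrow> perturbation \<Rightarrow> real" where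
  "zeta (\<alpha>\<^sub>1, \<alpha>\<^sub>2, \<alpha>\<^sub>3, \<beta>\<^sub>1, \<beta>\<^sub>2) (\<Delta>E, \<Delta>F, \<Delta>G, \<Delta>q, \<Delta>r) =
     sqrt (\<alpha>\<^sub>1\<^sup>2 * (frobenius_norm \<Delta>E)\<^sup>2 + \<alpha>\<^sub>2\<^sup>2 * (frobenius_norm \<Delta>F)\<^sup>2
         + \<alpha>\<^sub>3\<^sup>2 * (frobenius_norm \<Delta>G)\<^sup>2
         + \<beta>\<^sub>1\<^sup>2 * (two_norm \<Delta>q)\<^sup>2 + \<beta>\<^sub>2\<^sup>2 * (two_norm \<Delta>r)\<^sup>2)"

fun sparsify ::
  "complex mat \<Rightarrow> complex mat \<Rightarrow> complex mat \<Rightarrow> perturbation \<Rightarrow> perturbation" where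
  "sparsify E F G (\<Delta>E, \<Delta>F, \<Delta>G, \<Delta>q, \<Delta>r) =
     (\<Delta>E \<odot>\<^sub>m Theta E, \<Delta>F \<odot>\<^sub>m Theta F, \<Delta>G \<odot>\<^sub>m Theta G, \<Delta>q, \<Delta>r)"

text \<open>
  The minimum is written as an infimum of nonnegative reals. A tuple satisfying
  \<open>optimal_sps\<close> below is itself a competitor, so for it the infimum is an attained minimum.
\<close>

definition xi_sps ::
  "weights \<Rightarrow> complex mat \<Rightarrow> complex mat \<Rightarrow> complex mat \<Rightarrow> complex vec \<Rightarrow> complex vec \<Rightarrow>
   complex vec \<Rightarrow> complex vec \<Rightarrow> real" where
  "xi_sps \<sigma> E F G q r u p =
     Inf {zeta \<sigma> (sparsify E F G t) | t. sparsify E F G t \<in> G1 E F G q r u p}"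

definition optimal_sps ::
  "weights \<Rightarrow> complex mat \<Rightarrow> complex mat \<Rightarrow> complex mat \<Rightarrow> complex vec \<Rightarrow> complex vec \<Rightarrow>
   complex vec \<Rightarrow> complex vec \<Rightarrow> perturbation \<Rightarrow> bool" where
  "optimal_sps \<sigma> E F G q r u p t \<longleftrightarrow>
     t \<in> G1 E F G q r u p \<and> t = sparsify E F G t \<and> zeta \<sigma> t = xi_sps \<sigma> E F G q r u p"

end

theory Submission
  imports Defs
begin

text \<open>
  Stack the scaled real coordinates of a perturbation into one vector
  \<open>x = (\<alpha>\<^sub>1 D\<^sub>S vec\<^sub>S(Re \<Delta>E), \<alpha>\<^sub>1 D\<^sub>S\<^sub>K vec\<^sub>S\<^sub>K(Im \<Delta>E), \<alpha>\<^sub>2 vec(Re \<Delta>F), \<dots>, \<beta>\<^sub>2 Im \<Delta>r)\<close>.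
  The weights \<open>1\<close> and \<open>sqrt 2\<close> make \<open>\<zeta>\<close> the Euclidean norm of \<open>x\<close>, and \<open>W x\<close> is the real form of the
  residual of the sparsified perturbation, so membership in \<open>G\<^sub>1\<close> becomes \<open>W x = b\<close> with
  \<open>b = (Re Q, Im Q, Re R, Im R)\<close>. The blocks \<open>-\<beta>\<inverse> I\<close> give \<open>W\<close> full row rank, hence
  \<open>w = W\<^sup>T (W W\<^sup>T)\<inverse> b\<close> is the unique solution of least norm. Sparsifying the perturbation with
  coordinates \<open>w\<close> does not change \<open>W x\<close> and does not increase the norm, so by
  uniqueness that perturbation is already sparse, and it is optimal.
\<close>

section \<open>Triangular coordinates of symmetric and skew-symmetric matrices\<close>

text \<open>What shapes the proof is that \<open>J_S\<close> and \<open>J_SK\<close> are definite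
  descriptions and \<open>mat_inv\<close> unwraps a partial inverse, so \<open>W\<close> is awkward
  to read entry by entry. It is only ever evaluated on vectors of the form \<open>coords\<close>,
  where every factor acts by a simple rule: the inverse weight matrix cancels the weights, the
  diagonal pattern matrix masks entries, \<open>J\<close> expands a triangle to the full matrix, and
  the Kronecker factor multiplies by a vector. This is enough because \<open>coords\<close> is a
  bijection from the tuples of the right shape with Hermitian first entry onto the whole coordinate
  space.

  The competitors in the minimum need care: the constraint is imposed on \<open>sparsify t\<close>
  alone, and \<open>t\<close> itself may fail to be Hermitian. Coordinates are therefore taken of
  the sparsified tuple, and idempotence of masking shows that these coordinates solve the same
  system.

  The formulas of the theorem are treated as an equivalence, being satisfied exactly by the tuple
  with coordinates \<open>w\<close>. This gives existence and uniqueness of the tuple they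
  determine, next to its optimality.\<close>

text \<open>
  The shift \<open>d\<close> treats both triangles at once: \<open>d = 0\<close> includes the diagonal and goes with
  symmetric matrices, \<open>d = 1\<close> excludes it and goes with skew-symmetric ones.
\<close>

definition lower_positions :: "nat \<Rightarrow> nat \<Rightarrow> (nat \<times> nat) list" where
  "lower_positions d k = concat (map (\<lambda>j. map (\<lambda>i. (i, j)) [j + d..<k]) [0..<k])"

definition lower_vec :: "nat \<Rightarrow> 'a mat \<Rightarrow> 'a vec" where
  "lower_vec d Z = vec_of_list (map (($$) Z) (lower_positions d (dim_row Z)))"

text \<open>The exponent ties the symmetry type to the shift: for \<open>d = 1\<close> the relation
  forces a zero diagonal, which is why a triangle without the diagonal still determines the
  matrix.\<close>

definition parity_sym :: "nat \<Rightarrow> nat \<Rightarrow> real mat \<Rightarrow> bool" where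
  "parity_sym d k Z \<longleftrightarrow> Z \<in> carrier_mat k k \<and>
     (\<forall>i < k. \<forall>j < k. Z $$ (j, i) = (-1) ^ d * Z $$ (i, j))"

text \<open>Explicit candidate for the definite descriptions \<open>J_S\<close> and
  \<open>J_SK\<close>. Row \<open>a\<close> belongs to the entry \<open>(a mod k, a div k)\<close>
  of the column stacking; it is read from the triangle directly, or from its mirror image with the
  sign \<open>(-1) ^ d\<close>. For \<open>d = 1\<close> the diagonal rows are zero.\<close>

definition expansion_mat :: "nat \<Rightarrow> nat \<Rightarrow> real mat" where
  "expansion_mat d k = mat (k\<^sup>2) (length (lower_positions d k))
     (\<lambda>(a, b). if lower_positions d k ! b = (a mod k, a div k) then 1
               else if lower_positions d k ! b = (a div k, a mod k) then (-1) ^ d else 0)"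

text \<open>Common form of \<open>D_S\<close> and \<open>D_SK\<close>. A position off the diagonal
  stands for two entries of the full matrix, hence the weight \<open>sqrt 2\<close>.\<close>

definition weight_mat :: "nat \<Rightarrow> nat \<Rightarrow> real mat" where
  "weight_mat d k = mat_diag (length (lower_positions d k))
     (\<lambda>b. if fst (lower_positions d k ! b) = snd (lower_positions d k ! b) then 1 else sqrt 2)"

definition pattern_mat :: "nat \<Rightarrow> complex mat \<Rightarrow> real mat" where
  "pattern_mat d X = diag_of_vec (lower_vec d (Theta X))"

section \<open>Enumeration of the triangular positions\<close>

lemma set_lower_positions: "set (lower_positions d k) = {(i, j). j + d \<le> i \<and> i < k}"
  by (auto simp: lower_positions_def image_iff)

lemma distinct_lower_positions: "distinct (lower_positions d k)"
proof -
  have "distinct (concat (map (\<lambda>j. map (\<lambda>i. (i, j)) [j + d..<k]) [0..<b]))" for b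
    by (induction b) (auto simp: distinct_map inj_on_def)
  then show ?thesis by (simp add: lower_positions_def)
qed

text \<open>Column \<open>j\<close> contributes \<open>k - j - d\<close> entries. The factor 2 is
  kept and the subtracted terms stand on the left, so that neither division nor truncated
  subtraction occurs. Counting the first \<open>b\<close> columns instead of all \<open>k\<close> is
  what later locates the diagonal entries.\<close>

lemma length_lower_columns:
  assumes "d \<le> 1" "b \<le> k"
  shows "2 * length (concat (map (\<lambda>j. map (\<lambda>i. (i, j)) [j + d..<k]) [0..<b])) + b * b + 2 * d * b
    = b * (2 * k + 1)"
  using assms(2)
proof (induction b)
  case (Suc b)
  \<comment> \<open>This keeps the length of column \<open>b\<close> free of truncation, and it is
    where \<open>d \<le> 1\<close> enters.\<close>
  then have "b + d \<le> k" using assms(1) by simp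
  then obtain c where "k = b + d + c" by (auto simp: le_iff_add)
  with Suc show ?case by (simp add: algebra_simps)
qed simp

lemma length_lower_positions_0: "length (lower_positions 0 k) = k * (k + 1) div 2"
proof -
  have "2 * length (lower_positions 0 k) + k * k = k * (2 * k + 1)"
    using length_lower_columns[of 0 k k] by (simp add: lower_positions_def)
  then have "2 * length (lower_positions 0 k) = k * (k + 1)" by (simp add: algebra_simps)
  then show ?thesis by simp
qed

lemma length_lower_positions_1: "length (lower_positions 1 k) = k * (k - 1) div 2"
proof -
  have "2 * length (lower_positions 1 k) + k * k + 2 * k = k * (2 * k + 1)"
    using length_lower_columns[of 1 k k] by (simp add: lower_positions_def)
  then have "2 * length (lower_positions 1 k) = k * (k - 1)"
    by (cases k) (simp_all add: algebra_simps)
  then show ?thesis by simp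
qed

text \<open>Distinctness turns a sum over list positions into a sum over the triangle as a set;
  afterwards the order of stacking no longer matters.\<close>

lemma sum_lower_positions:
  "(\<Sum>b < length (lower_positions d k). f (lower_positions d k ! b))
    = (\<Sum>x | snd x + d \<le> fst x \<and> fst x < k. f x)"
proof -
  have "(\<Sum>b < length (lower_positions d k). f (lower_positions d k ! b))
      = sum_list (map f (lower_positions d k))"
    by (simp add: sum_list_sum_nth atLeast0LessThan)
  also have "\<dots> = sum f (set (lower_positions d k))"
    by (simp add: sum.distinct_set_conv_list distinct_lower_positions)
  also have "set (lower_positions d k) = {x. snd x + d \<le> fst x \<and> fst x < k}"
    by (auto simp: set_lower_positions)
  finally show ?thesis .
qed

lemma lower_positions_nthD:
  assumes "b < length (lower_positions d k)" "lower_positions d k ! b = (i, j)"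
  shows "j + d \<le> i" "i < k" "j < k"
  using nth_mem[OF assms(1)] unfolding assms(2) set_lower_positions by auto

lemma dim_lower_vec: "Z \<in> carrier_mat k k \<Longrightarrow> dim_vec (lower_vec d Z) = length (lower_positions d k)"
  by (simp add: lower_vec_def)

lemma lower_vec_carrier: "Z \<in> carrier_mat k k \<Longrightarrow> lower_vec d Z \<in> carrier_vec (length (lower_positions d k))"
  by (rule carrier_vecI) (rule dim_lower_vec)

lemma lower_vec_index:
  "Z \<in> carrier_mat k k \<Longrightarrow> b < length (lower_positions d k) \<Longrightarrow>
    lower_vec d Z $ b = Z $$ (lower_positions d k ! b)"
  by (simp add: lower_vec_def vec_of_list_index del: vec_of_list_map)

lemma vec_S_eq_lower_vec: "Z \<in> carrier_mat k k \<Longrightarrow> vec_S Z = lower_vec 0 Z"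
  unfolding vec_S_def lower_vec_def lower_positions_def map_concat map_map o_def
  by (simp del: vec_of_list_map)

lemma vec_SK_eq_lower_vec: "Z \<in> carrier_mat k k \<Longrightarrow> vec_SK Z = lower_vec 1 Z"
  unfolding vec_SK_def lower_vec_def lower_positions_def map_concat map_map o_def
  by (simp del: vec_of_list_map)

section \<open>Expansion of a triangle to the full matrix\<close>

lemma vec_of_mat_index:
  "Z \<in> carrier_mat m n \<Longrightarrow> a < m * n \<Longrightarrow> vec_of_mat Z $ a = Z $$ (a mod m, a div m)"
  by (auto simp: vec_of_mat_def)

lemma vec_of_mat_carrier: "Z \<in> carrier_mat m n \<Longrightarrow> vec_of_mat Z \<in> carrier_vec (n * m)"
  by (rule carrier_vecI) (simp add: vec_of_mat_def)

text \<open>In each row of \<open>expansion_mat\<close> at most one position of the triangle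
  contributes: the entry itself or its mirror image. Neither lies in the triangle only for a
  diagonal entry with \<open>d = 1\<close>, and that entry is zero by skew-symmetry.\<close>

lemma vec_of_mat_expansion:
  assumes Z: "parity_sym d k Z" and d: "d \<le> 1"
  shows "vec_of_mat Z = expansion_mat d k *\<^sub>v lower_vec d Z"
proof (rule eq_vecI)
  have Zc: "Z \<in> carrier_mat k k" and sym: "\<And>i j. i < k \<Longrightarrow> j < k \<Longrightarrow> Z $$ (j, i) = (-1) ^ d * Z $$ (i, j)"
    using Z unfolding parity_sym_def by blast+
  show "dim_vec (vec_of_mat Z) = dim_vec (expansion_mat d k *\<^sub>v lower_vec d Z)"
    using Zc by (simp add: vec_of_mat_def expansion_mat_def power2_eq_square)
  fix a assume "a < dim_vec (expansion_mat d k *\<^sub>v lower_vec d Z)"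
  then have a: "a < k * k" by (simp add: expansion_mat_def power2_eq_square)
  then have "k > 0" by (cases k) auto
  define i j where "i = a mod k" and "j = a div k"
  have ij: "i < k" "j < k" using a \<open>k > 0\<close> by (auto simp: i_def j_def less_mult_imp_div_less)
  \<comment> \<open>Row \<open>a\<close> as a function of the position instead of the list index,
    the form in which \<open>sum_lower_positions\<close> applies.\<close>
  define c :: "nat \<times> nat \<Rightarrow> real" where "c x = (if x = (i, j) then 1 else if x = (j, i) then (-1) ^ d else 0)" for x
  let ?P = "{x. snd x + d \<le> fst x \<and> fst x < k}"
  have fin: "finite ?P" by (rule finite_subset[of _ "{..<k} \<times> {..<k}"]) auto
  have J: "expansion_mat d k $$ (a, b) = c (lower_positions d k ! b)" if "b < length (lower_positions d k)" for b
    using a that unfolding expansion_mat_def c_def i_def j_def by (subst index_mat) (auto simp: power2_eq_square)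
  have "(expansion_mat d k *\<^sub>v lower_vec d Z) $ a = row (expansion_mat d k) a \<bullet> lower_vec d Z"
    using a by (intro index_mult_mat_vec) (simp add: expansion_mat_def power2_eq_square)
  also have "\<dots> = (\<Sum>b < length (lower_positions d k). row (expansion_mat d k) a $ b * lower_vec d Z $ b)"
    unfolding scalar_prod_def dim_lower_vec[OF Zc] atLeast0LessThan ..
  also have "\<dots> = (\<Sum>b < length (lower_positions d k). c (lower_positions d k ! b) * Z $$ (lower_positions d k ! b))"
  proof (rule sum.cong[OF refl])
    fix b assume "b \<in> {..<length (lower_positions d k)}"
    then have b: "b < length (lower_positions d k)" by simp
    have "row (expansion_mat d k) a $ b = expansion_mat d k $$ (a, b)"
      using a b by (intro index_row) (simp_all add: expansion_mat_def power2_eq_square)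
    then show "row (expansion_mat d k) a $ b * lower_vec d Z $ b
      = c (lower_positions d k ! b) * Z $$ (lower_positions d k ! b)"
      unfolding J[OF b] lower_vec_index[OF Zc b] by simp
  qed
  also have "\<dots> = (\<Sum>x\<in>?P. c x * Z $$ x)" by (rule sum_lower_positions)
  also have "\<dots> = Z $$ (i, j)"
  proof (cases "j + d \<le> i")
    case True
    have "(\<Sum>x\<in>?P. c x * Z $$ x) = (\<Sum>x\<in>?P. if x = (i, j) then Z $$ x else 0)"
      using True by (intro sum.cong) (auto simp: c_def)
    also have "\<dots> = Z $$ (i, j)" using fin True ij by simp
    finally show ?thesis .
  next
    case False
    show ?thesis
    proof (cases "i + d \<le> j")
      case True
      have "(\<Sum>x\<in>?P. c x * Z $$ x) = (\<Sum>x\<in>?P. if x = (j, i) then (-1) ^ d * Z $$ x else 0)"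
      proof (rule sum.cong[OF refl])
        fix x assume "x \<in> ?P"
        with False have "x \<noteq> (i, j)" by auto
        then show "c x * Z $$ x = (if x = (j, i) then (-1) ^ d * Z $$ x else 0)" unfolding c_def by simp
      qed
      also have "\<dots> = (-1) ^ d * Z $$ (j, i)"
        unfolding sum.delta[OF fin] using True ij by simp
      also have "\<dots> = Z $$ (i, j)" by (rule sym[OF ij(2,1), symmetric])
      finally show ?thesis .
    next
      case F2: False
      then have "d = 1" "i = j" using False d by auto
      have "Z $$ (i, i) = - Z $$ (i, i)"
        using sym[OF ij(1) ij(1)] unfolding \<open>d = 1\<close> power_one_right mult_minus1 .
      then have "Z $$ (i, j) = 0" unfolding \<open>i = j\<close>[symmetric] by linarith
      moreover have "(\<Sum>x\<in>?P. c x * Z $$ x) = 0"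
        using False F2 by (intro sum.neutral) (auto simp: c_def)
      ultimately show ?thesis by simp
    qed
  qed
  finally show "vec_of_mat Z $ a = (expansion_mat d k *\<^sub>v lower_vec d Z) $ a"
    using a Zc by (simp add: vec_of_mat_index i_def j_def)
qed

lemma parity_sym_lower_vec_inj:
  assumes "parity_sym d k Z" "parity_sym d k Y" "d \<le> 1" "lower_vec d Z = lower_vec d Y"
  shows "Z = Y"
proof (rule eq_matI)
  have Z: "Z \<in> carrier_mat k k" and Y: "Y \<in> carrier_mat k k"
    using assms unfolding parity_sym_def by blast+
  show "dim_row Z = dim_row Y" "dim_col Z = dim_col Y" using Z Y by auto
  have eq: "vec_of_mat Z = vec_of_mat Y"
    using assms by (simp add: vec_of_mat_expansion)
  fix i j assume "i < dim_row Y" "j < dim_col Y"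
  then have ij: "i < k" "j < k" using Y by auto
  then have "i + k * j < k * Suc j" by simp
  also have "\<dots> \<le> k * k" using ij by (intro mult_le_mono2) simp
  finally have "i + k * j < k * k" .
  then show "Z $$ (i, j) = Y $$ (i, j)"
    using arg_cong[OF eq, of "\<lambda>v. v $ (i + k * j)"] Z Y ij by (simp add: vec_of_mat_index)
qed

text \<open>The matrix is rebuilt by placing each coordinate at its position and, with the right
  sign, at the mirror image. Surjectivity is what makes \<open>J\<close> unique, and later it yields
  perturbations with prescribed coordinates.\<close>

lemma parity_sym_lower_vec_surj:
  assumes v: "v \<in> carrier_vec (length (lower_positions d k))" and d: "d \<le> 1"
  shows "\<exists>Z. parity_sym d k Z \<and> lower_vec d Z = v"
proof -
  let ?L = "lower_positions d k"
  \<comment> \<open>Inverse of the enumeration; the description is meaningful on the triangle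
    because the positions are distinct.\<close>
  define idx where "idx x = (THE b. b < length ?L \<and> ?L ! b = x)" for x
  have idx: "idx (?L ! b) = b" if "b < length ?L" for b
    unfolding idx_def using that distinct_lower_positions[of d k]
    by (auto simp: nth_eq_iff_index_eq intro!: the_equality)
  define Z where "Z = mat k k (\<lambda>(i, j). if j + d \<le> i then v $ idx (i, j)
    else if i + d \<le> j then (-1) ^ d * v $ idx (j, i) else 0)"
  have Zc: "Z \<in> carrier_mat k k" by (simp add: Z_def)
  have "parity_sym d k Z"
  proof -
    have "d = 0 \<or> d = 1" using d by auto
    then show ?thesis by (auto simp: parity_sym_def Z_def)
  qed
  moreover have "lower_vec d Z = v"
  proof (rule eq_vecI)
    show "dim_vec (lower_vec d Z) = dim_vec v" using v Zc by (simp add: dim_lower_vec)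
    fix b assume "b < dim_vec v"
    then have b: "b < length ?L" using v by simp
    obtain i j where ij: "?L ! b = (i, j)" by force
    then have "j + d \<le> i" "i < k" "j < k" using lower_positions_nthD[OF b] by auto
    then have "Z $$ (?L ! b) = v $ idx (i, j)" by (simp add: ij Z_def)
    also have "idx (i, j) = b" using idx[OF b] by (simp add: ij)
    finally show "lower_vec d Z $ b = v $ b" using b Zc by (simp add: lower_vec_index)
  qed
  ultimately show ?thesis by blast
qed

lemma mat_eqI_mult_vec:
  fixes A B :: "real mat"
  assumes A: "A \<in> carrier_mat nr nc" and B: "B \<in> carrier_mat nr nc"
    and eq: "\<And>v. v \<in> carrier_vec nc \<Longrightarrow> A *\<^sub>v v = B *\<^sub>v v"
  shows "A = B"
proof (rule eq_matI)
  fix i j assume "i < dim_row B" "j < dim_col B"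
  then have ij: "i < nr" "j < nc" using B by auto
  have "(A *\<^sub>v unit_vec nc j) $ i = (B *\<^sub>v unit_vec nc j) $ i" by (simp add: eq)
  then show "A $$ (i, j) = B $$ (i, j)" using ij A B by simp
qed (use A B in auto)

text \<open>Two candidates agree on the triangle vectors, and these exhaust the space by
  \<open>parity_sym_lower_vec_surj\<close>, so the candidates agree as matrices.\<close>

lemma expansion_mat_unique:
  assumes d: "d \<le> 1"
  shows "(THE J. J \<in> carrier_mat (k\<^sup>2) (length (lower_positions d k)) \<and>
     (\<forall>Z. parity_sym d k Z \<longrightarrow> vec_of_mat Z = J *\<^sub>v lower_vec d Z)) = expansion_mat d k"
proof (rule the_equality)
  show *: "expansion_mat d k \<in> carrier_mat (k\<^sup>2) (length (lower_positions d k)) \<and>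
     (\<forall>Z. parity_sym d k Z \<longrightarrow> vec_of_mat Z = expansion_mat d k *\<^sub>v lower_vec d Z)"
    using vec_of_mat_expansion d by (intro conjI allI impI) (simp_all add: expansion_mat_def)
  fix J assume J: "J \<in> carrier_mat (k\<^sup>2) (length (lower_positions d k)) \<and>
     (\<forall>Z. parity_sym d k Z \<longrightarrow> vec_of_mat Z = J *\<^sub>v lower_vec d Z)"
  show "J = expansion_mat d k"
  proof (rule mat_eqI_mult_vec)
    fix v :: "real vec" assume "v \<in> carrier_vec (length (lower_positions d k))"
    then obtain Z where "parity_sym d k Z" "lower_vec d Z = v"
      using parity_sym_lower_vec_surj d by blast
    with J * show "J *\<^sub>v v = expansion_mat d k *\<^sub>v v" by metis
  qed (use J * in auto)
qed

lemma parity_sym_iff_transpose: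
  "parity_sym d k Z \<longleftrightarrow> Z \<in> carrier_mat k k \<and> transpose_mat Z = (-1) ^ d \<cdot>\<^sub>m Z"
proof
  assume Z: "parity_sym d k Z"
  then have Zc: "Z \<in> carrier_mat k k" unfolding parity_sym_def by blast
  moreover have "transpose_mat Z = (-1) ^ d \<cdot>\<^sub>m Z"
  proof (rule eq_matI)
    fix i j assume "i < dim_row ((-1) ^ d \<cdot>\<^sub>m Z)" "j < dim_col ((-1) ^ d \<cdot>\<^sub>m Z)"
    then have ij: "i < k" "j < k" using Zc by simp_all
    then have "Z $$ (j, i) = (-1) ^ d * Z $$ (i, j)" using Z unfolding parity_sym_def by blast
    then show "transpose_mat Z $$ (i, j) = ((-1) ^ d \<cdot>\<^sub>m Z) $$ (i, j)" using ij Zc by simp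
  qed (use Zc in simp_all)
  ultimately show "Z \<in> carrier_mat k k \<and> transpose_mat Z = (-1) ^ d \<cdot>\<^sub>m Z" ..
next
  assume "Z \<in> carrier_mat k k \<and> transpose_mat Z = (-1) ^ d \<cdot>\<^sub>m Z"
  then have Zc: "Z \<in> carrier_mat k k" and eq: "transpose_mat Z = (-1) ^ d \<cdot>\<^sub>m Z" by blast+
  have "Z $$ (j, i) = (-1) ^ d * Z $$ (i, j)" if "i < k" "j < k" for i j
    using arg_cong[OF eq, of "\<lambda>A. A $$ (i, j)"] that Zc by simp
  with Zc show "parity_sym d k Z" unfolding parity_sym_def by blast
qed

lemma parity_sym_0_iff: "parity_sym 0 k Z \<longleftrightarrow> Z \<in> carrier_mat k k \<and> transpose_mat Z = Z"
proof -
  have "1 \<cdot>\<^sub>m Z = Z" by (rule eq_matI) simp_all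
  then show ?thesis unfolding parity_sym_iff_transpose power_0 by simp
qed

lemma parity_sym_1_iff: "parity_sym 1 k Z \<longleftrightarrow> Z \<in> carrier_mat k k \<and> transpose_mat Z = - Z"
proof -
  have "(-1) \<cdot>\<^sub>m Z = - Z" by (rule eq_matI) simp_all
  then show ?thesis unfolding parity_sym_iff_transpose power_one_right by simp
qed

section \<open>Identification with the matrices J, D, Phi and Psi of the statement\<close>

lemma J_S_eq: "J_S k = expansion_mat 0 k"
proof -
  have "(J \<in> carrier_mat (k\<^sup>2) (k * (k + 1) div 2) \<and>
      (\<forall>Z\<in>carrier_mat k k. transpose_mat Z = Z \<longrightarrow> vec_of_mat Z = J *\<^sub>v vec_S Z)) \<longleftrightarrow>
    (J \<in> carrier_mat (k\<^sup>2) (length (lower_positions 0 k)) \<and>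
      (\<forall>Z. parity_sym 0 k Z \<longrightarrow> vec_of_mat Z = J *\<^sub>v lower_vec 0 Z))" for J
    unfolding length_lower_positions_0 parity_sym_0_iff by (auto simp: vec_S_eq_lower_vec)
  then show ?thesis unfolding J_S_def using expansion_mat_unique[of 0 k] by simp
qed

lemma J_SK_eq: "J_SK k = expansion_mat 1 k"
proof -
  have "(J \<in> carrier_mat (k\<^sup>2) (k * (k - 1) div 2) \<and>
      (\<forall>Z\<in>carrier_mat k k. transpose_mat Z = - Z \<longrightarrow> vec_of_mat Z = J *\<^sub>v vec_SK Z)) \<longleftrightarrow>
    (J \<in> carrier_mat (k\<^sup>2) (length (lower_positions 1 k)) \<and>
      (\<forall>Z. parity_sym 1 k Z \<longrightarrow> vec_of_mat Z = J *\<^sub>v lower_vec 1 Z))" for J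
    unfolding length_lower_positions_1 parity_sym_1_iff by (auto simp: vec_SK_eq_lower_vec)
  then show ?thesis unfolding J_SK_def using expansion_mat_unique[of 1 k] by simp
qed

text \<open>A position strictly below the diagonal never has equal indices, so every weight is
  \<open>sqrt 2\<close>.\<close>

lemma D_SK_eq: "D_SK k = weight_mat 1 k"
proof (rule eq_matI)
  fix i j assume "i < dim_row (weight_mat 1 k)" "j < dim_col (weight_mat 1 k)"
  then have ij: "i < length (lower_positions 1 k)" "j < length (lower_positions 1 k)"
    by (auto simp: weight_mat_def mat_diag_def)
  obtain x y where "lower_positions 1 k ! j = (x, y)" by force
  with lower_positions_nthD[OF ij(2) this]
  show "D_SK k $$ (i, j) = weight_mat 1 k $$ (i, j)"
    using ij unfolding D_SK_def weight_mat_def mat_diag_def length_lower_positions_1[symmetric]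
    by simp
qed (simp_all only: D_SK_def weight_mat_def mat_diag_def length_lower_positions_1[symmetric]
    dim_row_mat dim_col_mat index_smult_mat index_one_mat)

text \<open>Column \<open>j\<close>, counted from 0, begins with its diagonal entry, so the position
  of \<open>(j, j)\<close> is the number of entries in the columns before it. This is the formula in
  \<open>D_S\<close> for \<open>i = j + 1\<close>.\<close>

lemma lower_positions_diag_nth:
  assumes "j < k"
  shows "(2 * k + 1 - j) * j div 2 < length (lower_positions 0 k)"
    "lower_positions 0 k ! ((2 * k + 1 - j) * j div 2) = (j, j)"
proof -
  let ?f = "\<lambda>j. map (\<lambda>i. (i, j)) [j + 0..<k]"
  let ?A = "concat (map ?f [0..<j])"
  have "[0..<k] = [0..<j] @ [j..<k]" using assms upt_add_eq_append[of 0 j "k - j"] by simp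
  also have "[j..<k] = j # [Suc j..<k]" using assms by (rule upt_conv_Cons)
  finally have L: "lower_positions 0 k = ?A @ ?f j @ concat (map ?f [Suc j..<k])"
    by (simp add: lower_positions_def)
  have "2 * length ?A + j * j = j * (2 * k + 1)"
    using length_lower_columns[of 0 j k] assms by simp
  then have "2 * length ?A = (2 * k + 1 - j) * j"
    by (simp add: diff_mult_distrib algebra_simps)
  then have len: "(2 * k + 1 - j) * j div 2 = length ?A" by simp
  have f: "?f j = (j, j) # map (\<lambda>i. (i, j)) [Suc j..<k]" using assms by (simp add: upt_conv_Cons)
  show "(2 * k + 1 - j) * j div 2 < length (lower_positions 0 k)"
    "lower_positions 0 k ! ((2 * k + 1 - j) * j div 2) = (j, j)"
    unfolding len unfolding L f by (simp_all only: nth_append_length length_append append_Cons, simp_all)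
qed

lemma D_S_eq: "D_S k = weight_mat 0 k"
proof -
  let ?L = "lower_positions 0 k"
  have "(\<exists>i\<in>{1..k}. b + 1 = (2 * k + 2 - i) * (i - 1) div 2 + 1) \<longleftrightarrow> fst (?L ! b) = snd (?L ! b)"
    if b: "b < length ?L" for b
  proof
    assume "\<exists>i\<in>{1..k}. b + 1 = (2 * k + 2 - i) * (i - 1) div 2 + 1"
    then obtain i where i: "i \<in> {1..k}" "b = (2 * k + 2 - i) * (i - 1) div 2" by auto
    \<comment> \<open>The formula in \<open>D_S\<close> counts columns from 1, the enumeration from
      0.\<close>
    then obtain j where j: "i = Suc j" by (cases i) auto
    with i show "fst (?L ! b) = snd (?L ! b)" using lower_positions_diag_nth[of j k] by simp
  next
    assume "fst (?L ! b) = snd (?L ! b)"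
    then obtain j where j: "?L ! b = (j, j)" by (cases "?L ! b") auto
    then have "j < k" using lower_positions_nthD[OF b] by blast
    note * = lower_positions_diag_nth[OF this]
    \<comment> \<open>By distinctness \<open>(j, j)\<close> occurs at one position only.\<close>
    have "b = (2 * k + 1 - j) * j div 2"
      using distinct_lower_positions[of 0 k] b * j by (simp add: nth_eq_iff_index_eq[symmetric])
    then show "\<exists>i\<in>{1..k}. b + 1 = (2 * k + 2 - i) * (i - 1) div 2 + 1"
      using \<open>j < k\<close> by (intro bexI[of _ "Suc j"]) auto
  qed
  then show ?thesis
    unfolding D_S_def weight_mat_def length_lower_positions_0[symmetric] mat_diag_def
    by (intro cong_mat) (auto simp del: One_nat_def)
qed

lemma Phi_mat_eq: "X \<in> carrier_mat k k \<Longrightarrow> Phi_mat X = pattern_mat 0 X"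
  unfolding Phi_mat_def pattern_mat_def by (subst vec_S_eq_lower_vec[of _ k]) (auto simp: Theta_def)

lemma Theta_carrier: "X \<in> carrier_mat m n \<Longrightarrow> Theta X \<in> carrier_mat m n"
  by (simp add: Theta_def)

text \<open>\<open>Psi_mat\<close> lists the strict upper triangle by rows. Reflection turns this
  into the strict lower triangle by columns, in the same order, so the two agree when the pattern is
  symmetric.\<close>

lemma Psi_mat_eq:
  assumes X: "X \<in> carrier_mat k k"
    and sym: "\<And>i j. i < k \<Longrightarrow> j < k \<Longrightarrow> (Theta X :: real mat) $$ (j, i) = Theta X $$ (i, j)"
  shows "Psi_mat X = pattern_mat 1 X"
proof -
  have "concat (map (\<lambda>i. map (\<lambda>j. (Theta X :: real mat) $$ (i, j)) [Suc i..<dim_col X]) [0..<dim_row X])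
     = concat (map (\<lambda>i. map (\<lambda>j. Theta X $$ (j, i)) [Suc i..<dim_col X]) [0..<dim_row X])"
    using X by (auto simp: sym intro!: arg_cong[where f = concat])
  also have "\<dots> = map (($$) (Theta X)) (lower_positions 1 k)"
    using X by (simp add: lower_positions_def map_concat o_def)
  finally show ?thesis using X
    by (simp add: Psi_mat_def pattern_mat_def lower_vec_def Theta_def del: vec_of_list_map)
qed

section \<open>Least-norm solutions and Kronecker products\<close>

lemma append_vec_dim_0: "dim_vec w = 0 \<Longrightarrow> v @\<^sub>v w = v"
  by (rule eq_vecI) auto

lemma append_cols_carrier:
  "A \<in> carrier_mat nr n \<Longrightarrow> B \<in> carrier_mat nr m \<Longrightarrow> A @\<^sub>c B \<in> carrier_mat nr (n + m)"
  unfolding append_cols_def carrier_mat_def by simp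

text \<open>The lower blocks of \<open>append_cols\<close> have no rows, so the lower half of the
  block product is a vector of dimension 0 and disappears.\<close>

lemma append_cols_mult_vec:
  fixes A B :: "'a :: semiring_0 mat"
  assumes A: "A \<in> carrier_mat nr n" and B: "B \<in> carrier_mat nr m"
    and a: "a \<in> carrier_vec n" and b: "b \<in> carrier_vec m"
  shows "(A @\<^sub>c B) *\<^sub>v (a @\<^sub>v b) = A *\<^sub>v a + B *\<^sub>v b"
  unfolding append_cols_def using A B
  by (subst four_block_mat_mult_vec[OF A B _ _ a b]) (auto intro!: append_vec_dim_0)

lemma mat_inv_det:
  fixes A :: "'a :: field mat"
  assumes A: "A \<in> carrier_mat n n" and det: "det A \<noteq> 0"
  shows "mat_inv A \<in> carrier_mat n n" "A * mat_inv A = 1\<^sub>m n" "mat_inv A * A = 1\<^sub>m n"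
proof -
  \<comment> \<open>Both facts concern units of the matrix ring; the instantiation
    \<open>b = ()\<close> makes it the same ring in each.\<close>
  obtain B where "mat_inverse A = Some B"
    using mat_inverse(1)[OF A, where b = "()"] det_non_zero_imp_unit[OF A det, where b = "()"] by (cases "mat_inverse A") auto
  with mat_inverse(2)[OF A this]
  show "mat_inv A \<in> carrier_mat n n" "A * mat_inv A = 1\<^sub>m n" "mat_inv A * A = 1\<^sub>m n"
    by (simp_all add: mat_inv_def)
qed

lemma scalar_prod_self_sum:
  fixes v :: "real vec"
  shows "v \<bullet> v = (\<Sum>i<dim_vec v. (v $ i)\<^sup>2)"
  by (simp add: scalar_prod_def power2_eq_square atLeast0LessThan)

lemma scalar_prod_self_eq_0:
  fixes v :: "real vec"
  assumes "v \<in> carrier_vec n" "v \<bullet> v = 0"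
  shows "v = 0\<^sub>v n"
proof (rule eq_vecI)
  fix i assume "i < dim_vec (0\<^sub>v n)"
  with assms show "v $ i = 0\<^sub>v n $ i"
    by (auto simp: scalar_prod_self_sum sum_nonneg_eq_0_iff)
qed (use assms in auto)

lemma scalar_prod_self_ge_0: "(v :: real vec) \<bullet> v \<ge> 0"
  by (simp add: scalar_prod_self_sum sum_nonneg)

text \<open>The vector \<open>w\<close> lies in the range of the transpose, hence is orthogonal to
  the kernel of \<open>W\<close>, and two solutions differ by a kernel element; so the last claim is
  Pythagoras. It is kept as an identity, because it then also shows that a solution of no larger
  norm equals \<open>w\<close>.\<close>

lemma least_norm_solution:
  fixes W :: "real mat"
  assumes W: "W \<in> carrier_mat k l" and b: "b \<in> carrier_vec k"
    and surj: "\<forall>z \<in> carrier_vec k. \<exists>x \<in> carrier_vec l. W *\<^sub>v x = z"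
    and w: "w = (transpose_mat W * mat_inv (W * transpose_mat W)) *\<^sub>v b"
  shows "w \<in> carrier_vec l" "W *\<^sub>v w = b"
    "x \<in> carrier_vec l \<Longrightarrow> W *\<^sub>v x = b \<Longrightarrow> x \<bullet> x = w \<bullet> w + (x - w) \<bullet> (x - w)"
proof -
  let ?T = "transpose_mat W" and ?A = "W * transpose_mat W"
  have T: "?T \<in> carrier_mat l k" and A: "?A \<in> carrier_mat k k" using W by simp_all
  have adj: "(?T *\<^sub>v y) \<bullet> v = y \<bullet> (W *\<^sub>v v)" if "y \<in> carrier_vec k" "v \<in> carrier_vec l" for y v
    using transpose_vec_mult_scalar[OF W that(2,1)] .
  \<comment> \<open>Trivial kernel of the Gram matrix: for \<open>y\<close> in it the transpose
    image has norm zero, and writing \<open>y\<close> as an image under \<open>W\<close> then gives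
    \<open>y \<bullet> y = 0\<close>.\<close>
  have "y = 0\<^sub>v k" if y: "y \<in> carrier_vec k" and ker: "?A *\<^sub>v y = 0\<^sub>v k" for y
  proof -
    have Ty: "?T *\<^sub>v y \<in> carrier_vec l" using T y by simp
    have "(?T *\<^sub>v y) \<bullet> (?T *\<^sub>v y) = y \<bullet> (W *\<^sub>v (?T *\<^sub>v y))" by (rule adj[OF y Ty])
    also have "W *\<^sub>v (?T *\<^sub>v y) = 0\<^sub>v k" using ker assoc_mult_mat_vec[OF W T y] by simp
    finally have "?T *\<^sub>v y = 0\<^sub>v l" using y Ty by (intro scalar_prod_self_eq_0) simp_all
    moreover obtain v where "v \<in> carrier_vec l" "W *\<^sub>v v = y" using surj y by blast
    ultimately have "y \<bullet> y = 0" using adj[OF y, of v] by simp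
    with y show ?thesis by (rule scalar_prod_self_eq_0)
  qed
  then have "det ?A \<noteq> 0" using det_0_iff_vec_prod_zero[OF A] by blast
  note inv = mat_inv_det[OF A this]
  define y where "y = mat_inv ?A *\<^sub>v b"
  have y: "y \<in> carrier_vec k" unfolding y_def using inv(1) b by simp
  have w': "w = ?T *\<^sub>v y" unfolding w y_def by (rule assoc_mult_mat_vec[OF T inv(1) b])
  show wc: "w \<in> carrier_vec l" unfolding w' using T y by simp
  have "W *\<^sub>v w = ?A *\<^sub>v y" unfolding w' using assoc_mult_mat_vec[OF W T y] by simp
  also have "\<dots> = (?A * mat_inv ?A) *\<^sub>v b" unfolding y_def using assoc_mult_mat_vec[OF A inv(1) b] by simp
  finally show Ww: "W *\<^sub>v w = b" using inv(2) b by simp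
  assume x: "x \<in> carrier_vec l" and Wx: "W *\<^sub>v x = b"
  define z where "z = x - w"
  have z: "z \<in> carrier_vec l" unfolding z_def using x wc by simp
  have "W *\<^sub>v z = 0\<^sub>v k" unfolding z_def mult_minus_distrib_mat_vec[OF W x wc] Wx Ww using b by simp
  then have wz: "w \<bullet> z = 0" using adj[OF y z] y unfolding w' by simp
  then have zw: "z \<bullet> w = 0" using comm_scalar_prod[OF z wc] by simp
  have "x = w + z" unfolding z_def using x wc by auto
  then have "x \<bullet> x = (w + z) \<bullet> (w + z)" by simp
  also have "\<dots> = w \<bullet> w + z \<bullet> z"
    using wc z wz zw by (simp add: add_scalar_prod_distrib[of _ l] scalar_prod_add_distrib[of _ l])
  finally show "x \<bullet> x = w \<bullet> w + (x - w) \<bullet> (x - w)" unfolding z_def .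
qed

section \<open>Kronecker products with a row, acting on stacked columns\<close>

lemma sum_blocks: "(\<Sum>a<n * m. f a) = (\<Sum>j<n. \<Sum>i<m. f (j * m + i :: nat))"
proof -
  have "sum f {j * m..<j * m + m} = (\<Sum>i<m. f (j * m + i))" for j
    using sum.shift_bounds_nat_ivl[of f 0 "j * m" m] by (simp add: add.commute atLeast0LessThan)
  then show ?thesis by (simp add: sum.nat_group[symmetric])
qed

lemma mult_mat_vec_sum:
  assumes "A \<in> carrier_mat nr nc" "v \<in> carrier_vec nc" "i < nr"
  shows "(A *\<^sub>v v) $ i = (\<Sum>j<nc. A $$ (i, j) * v $ j)"
  using assms by (auto simp: scalar_prod_def atLeast0LessThan intro!: sum.cong)

lemma block_index_less:
  fixes i j m n :: nat
  assumes "i < m" "j < n"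
  shows "j * m + i < n * m"
proof -
  have "j * m + i < Suc j * m" using assms by simp
  also have "\<dots> \<le> n * m" using assms by (intro mult_le_mono1) simp
  finally show ?thesis .
qed

lemma kronecker_mat_carrier:
  "A \<in> carrier_mat a b \<Longrightarrow> B \<in> carrier_mat c d \<Longrightarrow> A \<otimes>\<^sub>K B \<in> carrier_mat (a * c) (b * d)"
  by (intro carrier_matI) (auto simp: kronecker_mat_def)

lemma vec_of_mat_block_index:
  assumes "Z \<in> carrier_mat m n" "i < m" "j < n"
  shows "vec_of_mat Z $ (j * m + i) = Z $$ (i, j)"
proof -
  have "j * m + i < m * n" using block_index_less[of i m j n] assms by (simp add: mult.commute)
  then show ?thesis using assms by (simp add: vec_of_mat_index)
qed

text \<open>The rule vec(A Z B) = (B^T kron A) vec(Z) with A the identity and B the column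
  \<open>r\<close>.\<close>

lemma kronecker_row_one_mult_vec_of_mat:
  fixes Z :: "real mat"
  assumes r: "r \<in> carrier_vec n" and Z: "Z \<in> carrier_mat m n"
  shows "(mat_of_row r \<otimes>\<^sub>K 1\<^sub>m m) *\<^sub>v vec_of_mat Z = Z *\<^sub>v r"
proof (rule eq_vecI)
  have K: "mat_of_row r \<otimes>\<^sub>K 1\<^sub>m m \<in> carrier_mat m (n * m)"
    using kronecker_mat_carrier[of "mat_of_row r" 1 n "1\<^sub>m m" m m] r by simp
  show "dim_vec ((mat_of_row r \<otimes>\<^sub>K 1\<^sub>m m) *\<^sub>v vec_of_mat Z) = dim_vec (Z *\<^sub>v r)"
    using K Z by simp
  fix i assume "i < dim_vec (Z *\<^sub>v r)"
  then have i: "i < m" using Z by simp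
  have entry: "(mat_of_row r \<otimes>\<^sub>K 1\<^sub>m m) $$ (i, j * m + i') = (if i' = i then r $ j else 0)"
    if "i' < m" "j < n" for i' j
    using r i that block_index_less[of i' m j n] by (simp add: kronecker_mat_def mat_of_row_def)
  have "((mat_of_row r \<otimes>\<^sub>K 1\<^sub>m m) *\<^sub>v vec_of_mat Z) $ i
      = (\<Sum>a<n * m. (mat_of_row r \<otimes>\<^sub>K 1\<^sub>m m) $$ (i, a) * vec_of_mat Z $ a)"
    by (rule mult_mat_vec_sum[OF K vec_of_mat_carrier[OF Z] i])
  also have "\<dots> = (\<Sum>j<n. \<Sum>i'<m. if i' = i then Z $$ (i, j) * r $ j else 0)"
    unfolding sum_blocks
    by (intro sum.cong) (auto simp: entry vec_of_mat_block_index[OF Z])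
  also have "\<dots> = (\<Sum>j<n. Z $$ (i, j) * r $ j)" using i by simp
  also have "\<dots> = (Z *\<^sub>v r) $ i" by (rule mult_mat_vec_sum[OF Z r i, symmetric])
  finally show "((mat_of_row r \<otimes>\<^sub>K 1\<^sub>m m) *\<^sub>v vec_of_mat Z) $ i = (Z *\<^sub>v r) $ i" .
qed

text \<open>The same rule with A the row \<open>p\<close> and B the identity; stacking the row A Z
  gives the column on the right.\<close>

lemma kronecker_one_row_mult_vec_of_mat:
  fixes Z :: "real mat"
  assumes p: "p \<in> carrier_vec m" and Z: "Z \<in> carrier_mat m n"
  shows "(1\<^sub>m n \<otimes>\<^sub>K mat_of_row p) *\<^sub>v vec_of_mat Z = transpose_mat Z *\<^sub>v p"
proof (rule eq_vecI)
  have K: "1\<^sub>m n \<otimes>\<^sub>K mat_of_row p \<in> carrier_mat n (n * m)"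
    using kronecker_mat_carrier[of "1\<^sub>m n" n n "mat_of_row p" 1 m] p by simp
  have T: "transpose_mat Z \<in> carrier_mat n m" using Z by simp
  show "dim_vec ((1\<^sub>m n \<otimes>\<^sub>K mat_of_row p) *\<^sub>v vec_of_mat Z) = dim_vec (transpose_mat Z *\<^sub>v p)"
    using K Z by simp
  fix i assume "i < dim_vec (transpose_mat Z *\<^sub>v p)"
  then have i: "i < n" using Z by simp
  have entry: "(1\<^sub>m n \<otimes>\<^sub>K mat_of_row p) $$ (i, j * m + i') = (if j = i then p $ i' else 0)"
    if "i' < m" "j < n" for i' j
    using p i that block_index_less[of i' m j n] by (simp add: kronecker_mat_def mat_of_row_def)
  have "((1\<^sub>m n \<otimes>\<^sub>K mat_of_row p) *\<^sub>v vec_of_mat Z) $ i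
      = (\<Sum>a<n * m. (1\<^sub>m n \<otimes>\<^sub>K mat_of_row p) $$ (i, a) * vec_of_mat Z $ a)"
    by (rule mult_mat_vec_sum[OF K vec_of_mat_carrier[OF Z] i])
  also have "\<dots> = (\<Sum>j<n. \<Sum>i'<m. if j = i then Z $$ (i', i) * p $ i' else 0)"
    unfolding sum_blocks
    by (intro sum.cong) (auto simp: entry vec_of_mat_block_index[OF Z])
  also have "\<dots> = (\<Sum>j<n. if j = i then \<Sum>i'<m. Z $$ (i', i) * p $ i' else 0)"
    by (intro sum.cong) auto
  also have "\<dots> = (\<Sum>i'<m. Z $$ (i', i) * p $ i')" using i by simp
  also have "\<dots> = (\<Sum>i'<m. transpose_mat Z $$ (i, i') * p $ i')"
    using i Z by (intro sum.cong) auto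
  also have "\<dots> = (transpose_mat Z *\<^sub>v p) $ i" by (rule mult_mat_vec_sum[OF T p i, symmetric])
  finally show "((1\<^sub>m n \<otimes>\<^sub>K mat_of_row p) *\<^sub>v vec_of_mat Z) $ i = (transpose_mat Z *\<^sub>v p) $ i" .
qed

section \<open>Diagonal matrices, sparsity masks and weights\<close>

lemma mat_diag_mult_vec:
  fixes f :: "nat \<Rightarrow> 'a :: comm_semiring_0"
  assumes "v \<in> carrier_vec n" "i < n"
  shows "(mat_diag n f *\<^sub>v v) $ i = f i * v $ i"
proof -
  have "(mat_diag n f *\<^sub>v v) $ i = (\<Sum>j<n. mat_diag n f $$ (i, j) * v $ j)"
    using assms by (intro mult_mat_vec_sum) auto
  also have "\<dots> = (\<Sum>j<n. if j = i then f i * v $ i else 0)"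
    using assms by (intro sum.cong) (auto simp: mat_diag_def)
  finally show ?thesis using assms by simp
qed

lemma diag_of_vec_mult_vec:
  fixes d :: "'a :: comm_semiring_0 vec"
  assumes "d \<in> carrier_vec n" "v \<in> carrier_vec n"
  shows "diag_of_vec d *\<^sub>v v = vec n (\<lambda>i. d $ i * v $ i)"
  using assms mat_diag_mult_vec[OF assms(2)]
  by (intro eq_vecI) (auto simp: diag_of_vec_def mat_diag_def)

lemma diag_of_vec_carrier: "d \<in> carrier_vec n \<Longrightarrow> diag_of_vec d \<in> carrier_mat n n"
  by (auto simp: diag_of_vec_def)

lemma hadamard_mat_carrier: "A \<in> carrier_mat m n \<Longrightarrow> A \<odot>\<^sub>m B \<in> carrier_mat m n"
  by (intro carrier_matI) (auto simp: hadamard_mat_def)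

lemma Sigma_mat_carrier: "F \<in> carrier_mat m n \<Longrightarrow> Sigma_mat F \<in> carrier_mat (n * m) (n * m)"
  unfolding Sigma_mat_def by (intro diag_of_vec_carrier vec_of_mat_carrier Theta_carrier)

lemma Sigma_mat_mult_vec_of_mat:
  assumes F: "F \<in> carrier_mat m n" and Z: "Z \<in> carrier_mat m n"
  shows "Sigma_mat F *\<^sub>v vec_of_mat Z = vec_of_mat (Z \<odot>\<^sub>m Theta F)"
proof -
  note c = vec_of_mat_carrier[OF Theta_carrier[OF F]] vec_of_mat_carrier[OF Z]
  show ?thesis unfolding Sigma_mat_def diag_of_vec_mult_vec[OF c]
  proof (rule eq_vecI)
    show "dim_vec (vec (n * m) (\<lambda>i. vec_of_mat (Theta F) $ i * vec_of_mat Z $ i)) = dim_vec (vec_of_mat (Z \<odot>\<^sub>m Theta F))"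
      using vec_of_mat_carrier[OF hadamard_mat_carrier[OF Z, of "Theta F"]] by simp
    fix a assume "a < dim_vec (vec_of_mat (Z \<odot>\<^sub>m Theta F))"
    then have a: "a < m * n" using vec_of_mat_carrier[OF hadamard_mat_carrier[OF Z, of "Theta F"]]
      by (simp add: mult.commute)
    then have "m > 0" by (cases m) auto
    then have "a mod m < m" "a div m < n" using a by (auto simp: less_mult_imp_div_less mult.commute)
    then show "vec (n * m) (\<lambda>i. vec_of_mat (Theta F) $ i * vec_of_mat Z $ i) $ a = vec_of_mat (Z \<odot>\<^sub>m Theta F) $ a"
      using a F Z by (simp add: mult.commute vec_of_mat_index[OF Z] vec_of_mat_index[OF Theta_carrier[OF F]]
        vec_of_mat_index[OF hadamard_mat_carrier[OF Z, of "Theta F"]]) (simp add: hadamard_mat_def)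
  qed
qed

lemma weight_mat_carrier:
  "weight_mat d k \<in> carrier_mat (length (lower_positions d k)) (length (lower_positions d k))"
  by (simp add: weight_mat_def)

lemma expansion_mat_carrier:
  "expansion_mat d k \<in> carrier_mat (k * k) (length (lower_positions d k))"
  by (simp add: expansion_mat_def power2_eq_square)

lemma pattern_mat_carrier:
  assumes "X \<in> carrier_mat k k"
  shows "pattern_mat d X \<in> carrier_mat (length (lower_positions d k)) (length (lower_positions d k))"
  unfolding pattern_mat_def by (intro diag_of_vec_carrier lower_vec_carrier Theta_carrier assms)

text \<open>The diagonal of reciprocals is a right inverse, so the determinant is nonzero. Later
  steps rely on the two product laws and never on entries of \<open>mat_inv\<close>.\<close>

lemma weight_mat_inv:
  shows "mat_inv (weight_mat d k) \<in> carrier_mat (length (lower_positions d k)) (length (lower_positions d k))"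
    "weight_mat d k * mat_inv (weight_mat d k) = 1\<^sub>m (length (lower_positions d k))"
    "mat_inv (weight_mat d k) * weight_mat d k = 1\<^sub>m (length (lower_positions d k))"
proof -
  let ?l = "length (lower_positions d k)"
  define f where "f b = (if fst (lower_positions d k ! b) = snd (lower_positions d k ! b) then 1 else sqrt 2)" for b
  have "f b * inverse (f b) = 1" for b by (simp add: f_def)
  then have "weight_mat d k * mat_diag ?l (\<lambda>b. inverse (f b)) = 1\<^sub>m ?l"
    unfolding weight_mat_def f_def[symmetric] by simp
  then have "det (weight_mat d k * mat_diag ?l (\<lambda>b. inverse (f b))) = 1" by simp
  then have "det (weight_mat d k) \<noteq> 0"
    by (auto simp: det_mult[OF weight_mat_carrier mat_diag_dim])
  from mat_inv_det[OF weight_mat_carrier this]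
  show "mat_inv (weight_mat d k) \<in> carrier_mat ?l ?l"
    "weight_mat d k * mat_inv (weight_mat d k) = 1\<^sub>m ?l"
    "mat_inv (weight_mat d k) * weight_mat d k = 1\<^sub>m ?l" .
qed

lemma pattern_mat_mult_lower_vec:
  assumes X: "X \<in> carrier_mat k k" and Z: "Z \<in> carrier_mat k k"
  shows "pattern_mat d X *\<^sub>v lower_vec d Z = lower_vec d (Z \<odot>\<^sub>m Theta X)"
  unfolding pattern_mat_def
    diag_of_vec_mult_vec[OF lower_vec_carrier[OF Theta_carrier[OF X]] lower_vec_carrier[OF Z]]
proof (rule eq_vecI)
  note H = hadamard_mat_carrier[OF Z, of "Theta X"]
  show "dim_vec (vec (length (lower_positions d k)) (\<lambda>i. lower_vec d (Theta X) $ i * lower_vec d Z $ i))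
    = dim_vec (lower_vec d (Z \<odot>\<^sub>m Theta X))" by (simp add: dim_lower_vec[OF H])
  fix b assume "b < dim_vec (lower_vec d (Z \<odot>\<^sub>m Theta X))"
  then have b: "b < length (lower_positions d k)" by (simp add: dim_lower_vec[OF H])
  obtain i j where ij: "lower_positions d k ! b = (i, j)" by force
  note lower_positions_nthD(2,3)[OF b ij]
  then show "vec (length (lower_positions d k)) (\<lambda>i. lower_vec d (Theta X) $ i * lower_vec d Z $ i) $ b
    = lower_vec d (Z \<odot>\<^sub>m Theta X) $ b"
    using b Z by (simp add: lower_vec_index[OF H b] lower_vec_index[OF Z b]
      lower_vec_index[OF Theta_carrier[OF X] b] ij) (simp add: hadamard_mat_def)
qed

lemma parity_symD:
  "parity_sym d k Z \<Longrightarrow> i < k \<Longrightarrow> j < k \<Longrightarrow> Z $$ (j, i) = (-1) ^ d * Z $$ (i, j)"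
  unfolding parity_sym_def by blast

lemma parity_sym_carrier: "parity_sym d k Z \<Longrightarrow> Z \<in> carrier_mat k k"
  unfolding parity_sym_def by blast

lemma parity_sym_hadamard:
  assumes Z: "parity_sym d k Z"
    and sym: "\<And>i j. i < k \<Longrightarrow> j < k \<Longrightarrow> B $$ (j, i) = B $$ (i, j)"
  shows "parity_sym d k (Z \<odot>\<^sub>m B)"
  unfolding parity_sym_def
proof (intro conjI allI impI)
  note Zc = parity_sym_carrier[OF Z]
  show "Z \<odot>\<^sub>m B \<in> carrier_mat k k" by (rule hadamard_mat_carrier[OF Zc])
  fix i j assume "i < k" "j < k"
  then show "(Z \<odot>\<^sub>m B) $$ (j, i) = (- 1) ^ d * (Z \<odot>\<^sub>m B) $$ (i, j)"
    using Zc parity_symD[OF Z, of i j] sym[of i j] by (simp add: hadamard_mat_def)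
qed

text \<open>The weights cancel against their inverse, and the pattern matrix masks the triangle.
  Expanding the masked triangle gives back the masked matrix because a symmetric pattern preserves
  the symmetry type of \<open>Z\<close>.\<close>

lemma structured_block_mult:
  assumes Z: "parity_sym d k Z" and d: "d \<le> 1" and X: "X \<in> carrier_mat k k"
    and sym: "\<And>i j. i < k \<Longrightarrow> j < k \<Longrightarrow> (Theta X :: real mat) $$ (j, i) = Theta X $$ (i, j)"
  shows "(expansion_mat d k * pattern_mat d X * mat_inv (weight_mat d k))
      *\<^sub>v (\<alpha> \<cdot>\<^sub>v (weight_mat d k *\<^sub>v lower_vec d Z)) = \<alpha> \<cdot>\<^sub>v vec_of_mat (Z \<odot>\<^sub>m Theta X)"
proof -
  note Zc = parity_sym_carrier[OF Z]
  note L = lower_vec_carrier[OF Zc, of d] and E = expansion_mat_carrier[of d k]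
    and P = pattern_mat_carrier[OF X, of d] and D = weight_mat_carrier[of d k]
    and I = weight_mat_inv(1)[of d k]
  have EP: "expansion_mat d k * pattern_mat d X \<in> carrier_mat (k * k) (length (lower_positions d k))"
    using E P by simp
  have N: "expansion_mat d k * pattern_mat d X * mat_inv (weight_mat d k)
      \<in> carrier_mat (k * k) (length (lower_positions d k))" using EP I by simp
  have DL: "weight_mat d k *\<^sub>v lower_vec d Z \<in> carrier_vec (length (lower_positions d k))" using D L by simp
  have "mat_inv (weight_mat d k) *\<^sub>v (weight_mat d k *\<^sub>v lower_vec d Z) = lower_vec d Z"
    using assoc_mult_mat_vec[OF I D L] weight_mat_inv(3)[of d k] L by simp
  then have "(expansion_mat d k * pattern_mat d X * mat_inv (weight_mat d k))
      *\<^sub>v (weight_mat d k *\<^sub>v lower_vec d Z) = (expansion_mat d k * pattern_mat d X) *\<^sub>v lower_vec d Z"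
    using assoc_mult_mat_vec[OF EP I DL] by simp
  also have "\<dots> = expansion_mat d k *\<^sub>v (pattern_mat d X *\<^sub>v lower_vec d Z)"
    by (rule assoc_mult_mat_vec[OF E P L])
  also have "\<dots> = vec_of_mat (Z \<odot>\<^sub>m Theta X)"
    unfolding pattern_mat_mult_lower_vec[OF X Zc]
    by (rule vec_of_mat_expansion[symmetric, OF parity_sym_hadamard[OF Z sym] d])
  finally show ?thesis using mult_mat_vec[OF N DL] by simp
qed

text \<open>An entry off the diagonal occurs, up to sign, twice in the full matrix, and its squared
  weight 2 counts it twice in the triangle.\<close>

lemma norm_weight_lower_vec:
  assumes Z: "parity_sym d k Z" and d: "d \<le> 1"
  shows "(\<alpha> \<cdot>\<^sub>v (weight_mat d k *\<^sub>v lower_vec d Z)) \<bullet> (\<alpha> \<cdot>\<^sub>v (weight_mat d k *\<^sub>v lower_vec d Z))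
    = \<alpha>\<^sup>2 * (\<Sum>i<k. \<Sum>j<k. (Z $$ (i, j))\<^sup>2)"
proof -
  note Zc = parity_sym_carrier[OF Z]
  let ?L = "lower_positions d k"
  let ?x = "weight_mat d k *\<^sub>v lower_vec d Z"
  let ?P = "{x. snd x + d \<le> fst x \<and> fst x < k}"
  have dim: "dim_vec ?x = length ?L" using weight_mat_carrier[of d k] by simp
  define g where "g x = (if fst x = snd x then 1 else 2) * (Z $$ x)\<^sup>2" for x
  have x: "(?x $ b)\<^sup>2 = g (?L ! b)" if b: "b < length ?L" for b
    unfolding weight_mat_def mat_diag_mult_vec[OF lower_vec_carrier[OF Zc] b] lower_vec_index[OF Zc b] g_def
    by (simp add: power_mult_distrib)
  have fin: "finite ?P" by (rule finite_subset[of _ "{..<k} \<times> {..<k}"]) auto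
  have sq: "(Z $$ (j, i))\<^sup>2 = (Z $$ (i, j))\<^sup>2" if "i < k" "j < k" for i j
    unfolding parity_symD[OF Z that] by (simp add: power_mult_distrib power_mult[symmetric])
  have diag: "Z $$ (i, i) = 0" if "i < k" "d \<noteq> 0" for i
  proof -
    have "d = 1" using that d by simp
    have "Z $$ (i, i) = - Z $$ (i, i)"
      using parity_symD[OF Z that(1) that(1)] unfolding \<open>d = 1\<close> power_one_right mult_minus1 .
    then show ?thesis by linarith
  qed
  have "?x \<bullet> ?x = (\<Sum>b<length ?L. g (?L ! b))"
    unfolding scalar_prod_self_sum dim by (intro sum.cong) (simp_all add: x)
  also have "\<dots> = (\<Sum>x\<in>?P. g x)" by (rule sum_lower_positions)
  \<comment> \<open>Including the diagonal changes nothing: for \<open>d = 0\<close> it is already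
    there, for \<open>d = 1\<close> its entries vanish.\<close>
  also have "\<dots> = (\<Sum>x\<in>{x. snd x \<le> fst x \<and> fst x < k}. g x)"
  proof (rule sum.mono_neutral_left)
    show "finite {x. snd x \<le> fst x \<and> fst x < k}"
      by (rule finite_subset[of _ "{..<k} \<times> {..<k}"]) auto
    show "?P \<subseteq> {x. snd x \<le> fst x \<and> fst x < k}" by auto
    show "\<forall>x\<in>{x. snd x \<le> fst x \<and> fst x < k} - ?P. g x = 0"
    proof
      fix x assume x: "x \<in> {x. snd x \<le> fst x \<and> fst x < k} - ?P"
      obtain a b where ab: "x = (a, b)" by (cases x)
      from x have "a = b" "d \<noteq> 0" "a < k" using d unfolding ab by auto
      then show "g x = 0" unfolding g_def ab by (simp add: diag)
    qed
  qed
  also have "\<dots> = (\<Sum>i<k. \<Sum>j<k. (Z $$ (i, j))\<^sup>2)"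
  proof -
    let ?D = "{x. fst x = snd x \<and> fst x < k}" and ?S = "{x. snd x < fst x \<and> fst x < k}"
      and ?U = "{x. fst x < snd x \<and> snd x < k}"
    define h where "h x = (Z $$ x)\<^sup>2" for x
    have finD: "finite ?D" and finS: "finite ?S" and finU: "finite ?U"
      by (rule finite_subset[of _ "{..<k} \<times> {..<k}"]; auto)+
    have "{x. snd x \<le> fst x \<and> fst x < k} = ?D \<union> ?S" by auto
    then have "(\<Sum>x\<in>{x. snd x \<le> fst x \<and> fst x < k}. g x) = sum g ?D + sum g ?S"
      using finD finS by (simp only:) (rule sum.union_disjoint, auto)
    also have "sum g ?D = sum h ?D" by (intro sum.cong) (auto simp: g_def h_def)
    \<comment> \<open>Of the two copies due to the weight, one stays below the diagonal and the
      other is reflected above it.\<close>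
    also have "sum g ?S = sum h ?S + sum h ?S"
      unfolding sum.distrib[symmetric] by (intro sum.cong) (auto simp: g_def h_def)
    also have "sum h ?D + (sum h ?S + sum h ?S) = sum h ?D + (sum h ?S + sum h ?U)"
    proof -
      have "sum h ?S = sum h ?U"
        by (rule sum.reindex_bij_witness[of _ prod.swap prod.swap]) (auto simp: h_def sq)
      then show ?thesis by simp
    qed
    also have "sum h ?S + sum h ?U = sum h (?S \<union> ?U)"
      using finS finU by (intro sum.union_disjoint[symmetric]) auto
    also have "sum h ?D + sum h (?S \<union> ?U) = sum h (?D \<union> (?S \<union> ?U))"
      using finD finS finU by (intro sum.union_disjoint[symmetric]) auto
    also have "?D \<union> (?S \<union> ?U) = {..<k} \<times> {..<k}" by auto
    finally show ?thesis by (simp add: sum.cartesian_product h_def split_def)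
  qed
  finally have "?x \<bullet> ?x = (\<Sum>i<k. \<Sum>j<k. (Z $$ (i, j))\<^sup>2)" .
  moreover have "(\<alpha> \<cdot>\<^sub>v ?x) \<bullet> (\<alpha> \<cdot>\<^sub>v ?x) = \<alpha>\<^sup>2 * (?x \<bullet> ?x)"
    by (simp add: scalar_prod_self_sum power_mult_distrib sum_distrib_left)
  ultimately show ?thesis by simp
qed

section \<open>Block vectors and complex matrices\<close>

lemma append_vec_assoc: "(a @\<^sub>v b) @\<^sub>v c = a @\<^sub>v (b @\<^sub>v c)"
  by (rule eq_vecI) (auto simp: add.assoc)

lemma map_vec_append: "map_vec f (a @\<^sub>v b) = map_vec f a @\<^sub>v map_vec f b"
  by (rule eq_vecI) auto

lemma append_vec_split:
  assumes "v \<in> carrier_vec (a + b)"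
  obtains x y where "x \<in> carrier_vec a" "y \<in> carrier_vec b" "v = x @\<^sub>v y"
  using assms vec_first_last_append[of v a b] vec_first_carrier vec_last_carrier by metis

lemma scalar_prod_self_append:
  fixes v w :: "real vec"
  shows "(v @\<^sub>v w) \<bullet> (v @\<^sub>v w) = v \<bullet> v + w \<bullet> w"
  by (rule scalar_prod_append[of _ "dim_vec v" _ "dim_vec w"]) auto

lemma smult_mat_mult_vec:
  fixes A :: "'a :: comm_ring_1 mat"
  assumes A: "A \<in> carrier_mat nr nc" and v: "v \<in> carrier_vec nc"
  shows "(c \<cdot>\<^sub>m A) *\<^sub>v v = c \<cdot>\<^sub>v (A *\<^sub>v v)"
proof (rule eq_vecI)
  fix i assume "i < dim_vec (c \<cdot>\<^sub>v (A *\<^sub>v v))"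
  then have i: "i < nr" using A by simp
  have cA: "c \<cdot>\<^sub>m A \<in> carrier_mat nr nc" using A by simp
  have "((c \<cdot>\<^sub>m A) *\<^sub>v v) $ i = (\<Sum>j<nc. (c \<cdot>\<^sub>m A) $$ (i, j) * v $ j)"
    by (rule mult_mat_vec_sum[OF cA v i])
  also have "\<dots> = c * (\<Sum>j<nc. A $$ (i, j) * v $ j)"
    unfolding sum_distrib_left using A i by (intro sum.cong) (auto simp: mult.assoc)
  also have "\<dots> = c * (A *\<^sub>v v) $ i" by (simp only: mult_mat_vec_sum[OF A v i])
  also have "\<dots> = (c \<cdot>\<^sub>v (A *\<^sub>v v)) $ i" using A i by simp
  finally show "((c \<cdot>\<^sub>m A) *\<^sub>v v) $ i = (c \<cdot>\<^sub>v (A *\<^sub>v v)) $ i" .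
qed (use A in simp)

lemma zero_mat_mult_vec: "v \<in> carrier_vec nc \<Longrightarrow> 0\<^sub>m nr nc *\<^sub>v v = (0\<^sub>v nr :: 'a :: semiring_0 vec)"
  by (rule eq_vecI) auto

text \<open>Shape shared by the blocks of the two X matrices. In use, \<open>c\<close> is up to sign
  the inverse of the weight \<open>\<alpha>\<close> carried by the coordinates, so that
  \<open>c * \<alpha>\<close> becomes 1 or -1.\<close>

lemma scaled_product_mult_vec:
  fixes K M :: "real mat"
  assumes K: "K \<in> carrier_mat r s" and M: "M \<in> carrier_mat s t" and x: "x \<in> carrier_vec t"
    and y: "y \<in> carrier_vec s" and eq: "M *\<^sub>v x = \<alpha> \<cdot>\<^sub>v y"
  shows "(c \<cdot>\<^sub>m (K * M)) *\<^sub>v x = (c * \<alpha>) \<cdot>\<^sub>v (K *\<^sub>v y)"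
proof -
  have "(c \<cdot>\<^sub>m (K * M)) *\<^sub>v x = c \<cdot>\<^sub>v ((K * M) *\<^sub>v x)"
    using K M x by (intro smult_mat_mult_vec[of _ r t]) simp_all
  also have "(K * M) *\<^sub>v x = \<alpha> \<cdot>\<^sub>v (K *\<^sub>v y)"
    using assoc_mult_mat_vec[OF K M x] mult_mat_vec[OF K y] eq by simp
  finally show ?thesis by (simp add: smult_smult_assoc)
qed

lemma append_cols4_carrier:
  assumes "A \<in> carrier_mat nr a" "B \<in> carrier_mat nr b" "C \<in> carrier_mat nr c" "D \<in> carrier_mat nr d"
  shows "A @\<^sub>c B @\<^sub>c C @\<^sub>c D \<in> carrier_mat nr (a + (b + (c + d)))"
  by (intro append_cols_carrier assms)

lemma append_cols4_mult_vec:
  fixes A :: "'a :: semiring_0 mat"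
  assumes "A \<in> carrier_mat nr a" "B \<in> carrier_mat nr b" "C \<in> carrier_mat nr c" "D \<in> carrier_mat nr d"
    "w \<in> carrier_vec a" "x \<in> carrier_vec b" "y \<in> carrier_vec c" "z \<in> carrier_vec d"
  shows "(A @\<^sub>c B @\<^sub>c C @\<^sub>c D) *\<^sub>v (w @\<^sub>v x @\<^sub>v y @\<^sub>v z) = A *\<^sub>v w + (B *\<^sub>v x + (C *\<^sub>v y + D *\<^sub>v z))"
proof -
  note CD = append_cols_carrier[OF assms(3,4)]
  note BCD = append_cols_carrier[OF assms(2) CD]
  have yz: "y @\<^sub>v z \<in> carrier_vec (c + d)" using assms by simp
  have xyz: "x @\<^sub>v y @\<^sub>v z \<in> carrier_vec (b + (c + d))" using assms by simp
  show ?thesis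
    unfolding append_cols_mult_vec[OF assms(1) BCD assms(5) xyz]
      append_cols_mult_vec[OF assms(2) CD assms(6) yz]
      append_cols_mult_vec[OF assms(3,4,7,8)] ..
qed

lemma vec_of_mat_inj:
  assumes Z: "Z \<in> carrier_mat m n" and Y: "Y \<in> carrier_mat m n" and eq: "vec_of_mat Z = vec_of_mat Y"
  shows "Z = Y"
proof (rule eq_matI)
  fix i j assume "i < dim_row Y" "j < dim_col Y"
  then have "i < m" "j < n" using Y by auto
  then show "Z $$ (i, j) = Y $$ (i, j)"
    using vec_of_mat_block_index[OF Z, of i j] vec_of_mat_block_index[OF Y, of i j] eq by simp
qed (use Z Y in auto)

lemma vec_of_mat_surj:
  assumes v: "v \<in> carrier_vec (n * m)"
  shows "\<exists>Z \<in> carrier_mat m n. vec_of_mat Z = v"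
proof
  let ?Z = "mat m n (\<lambda>(i, j). v $ (j * m + i))"
  show Z: "?Z \<in> carrier_mat m n" by simp
  show "vec_of_mat ?Z = v"
  proof (rule eq_vecI)
    show "dim_vec (vec_of_mat ?Z) = dim_vec v" using vec_of_mat_carrier[OF Z] v by simp
    fix a assume "a < dim_vec v"
    then have a: "a < m * n" using v by (simp add: mult.commute)
    then have "m > 0" by (cases m) auto
    then have "a mod m < m" "a div m < n" using a by (auto simp: less_mult_imp_div_less mult.commute)
    then show "vec_of_mat ?Z $ a = v $ a" unfolding vec_of_mat_index[OF Z a] by simp
  qed
qed

lemma norm_smult_vec_of_mat:
  fixes Z :: "real mat"
  assumes Z: "Z \<in> carrier_mat m n"
  shows "(\<alpha> \<cdot>\<^sub>v vec_of_mat Z) \<bullet> (\<alpha> \<cdot>\<^sub>v vec_of_mat Z) = \<alpha>\<^sup>2 * (\<Sum>i<m. \<Sum>j<n. (Z $$ (i, j))\<^sup>2)"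
proof -
  have "dim_vec (vec_of_mat Z) = n * m" using vec_of_mat_carrier[OF Z] by simp
  then have "(\<alpha> \<cdot>\<^sub>v vec_of_mat Z) \<bullet> (\<alpha> \<cdot>\<^sub>v vec_of_mat Z) = \<alpha>\<^sup>2 * (\<Sum>a<n * m. (vec_of_mat Z $ a)\<^sup>2)"
    by (simp add: scalar_prod_self_sum power_mult_distrib sum_distrib_left)
  also have "(\<Sum>a<n * m. (vec_of_mat Z $ a)\<^sup>2) = (\<Sum>j<n. \<Sum>i<m. (Z $$ (i, j))\<^sup>2)"
    unfolding sum_blocks by (intro sum.cong refl) (simp add: vec_of_mat_block_index[OF Z])
  also have "\<dots> = (\<Sum>i<m. \<Sum>j<n. (Z $$ (i, j))\<^sup>2)" by (rule sum.swap)
  finally show ?thesis .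
qed

section \<open>Real and imaginary parts, adjoints and norms of complex matrices\<close>

lemma Re_mult_mat_vec:
  assumes A: "A \<in> carrier_mat nr nc" and v: "v \<in> carrier_vec nc"
  shows "map_vec Re (A *\<^sub>v v) = map_mat Re A *\<^sub>v map_vec Re v - map_mat Im A *\<^sub>v map_vec Im v"
proof (rule eq_vecI)
  fix i assume "i < dim_vec (map_mat Re A *\<^sub>v map_vec Re v - map_mat Im A *\<^sub>v map_vec Im v)"
  then have i: "i < nr" using A by simp
  have c: "map_mat Re A \<in> carrier_mat nr nc" "map_mat Im A \<in> carrier_mat nr nc"
    "map_vec Re v \<in> carrier_vec nc" "map_vec Im v \<in> carrier_vec nc" using A v by simp_all
  have "map_vec Re (A *\<^sub>v v) $ i = Re ((A *\<^sub>v v) $ i)" using A i by simp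
  also have "\<dots> = (\<Sum>j<nc. Re (A $$ (i, j)) * Re (v $ j)) - (\<Sum>j<nc. Im (A $$ (i, j)) * Im (v $ j))"
    unfolding mult_mat_vec_sum[OF A v i] by (simp add: sum_subtractf)
  also have "\<dots> = (map_mat Re A *\<^sub>v map_vec Re v) $ i - (map_mat Im A *\<^sub>v map_vec Im v) $ i"
    unfolding mult_mat_vec_sum[OF c(1,3) i] mult_mat_vec_sum[OF c(2,4) i]
    using A v i by (intro arg_cong2[where f = minus] sum.cong) auto
  also have "\<dots> = (map_mat Re A *\<^sub>v map_vec Re v - map_mat Im A *\<^sub>v map_vec Im v) $ i"
    using A i by simp
  finally show "map_vec Re (A *\<^sub>v v) $ i = \<dots>" .
qed (use A in simp)

lemma Im_mult_mat_vec:
  assumes A: "A \<in> carrier_mat nr nc" and v: "v \<in> carrier_vec nc"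
  shows "map_vec Im (A *\<^sub>v v) = map_mat Re A *\<^sub>v map_vec Im v + map_mat Im A *\<^sub>v map_vec Re v"
proof (rule eq_vecI)
  fix i assume "i < dim_vec (map_mat Re A *\<^sub>v map_vec Im v + map_mat Im A *\<^sub>v map_vec Re v)"
  then have i: "i < nr" using A by simp
  have c: "map_mat Re A \<in> carrier_mat nr nc" "map_mat Im A \<in> carrier_mat nr nc"
    "map_vec Re v \<in> carrier_vec nc" "map_vec Im v \<in> carrier_vec nc" using A v by simp_all
  have "map_vec Im (A *\<^sub>v v) $ i = Im ((A *\<^sub>v v) $ i)" using A i by simp
  also have "\<dots> = (\<Sum>j<nc. Re (A $$ (i, j)) * Im (v $ j)) + (\<Sum>j<nc. Im (A $$ (i, j)) * Re (v $ j))"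
    unfolding mult_mat_vec_sum[OF A v i] by (simp add: sum.distrib)
  also have "\<dots> = (map_mat Re A *\<^sub>v map_vec Im v) $ i + (map_mat Im A *\<^sub>v map_vec Re v) $ i"
    unfolding mult_mat_vec_sum[OF c(1,4) i] mult_mat_vec_sum[OF c(2,3) i]
    using A v i by (intro arg_cong2[where f = plus] sum.cong) auto
  also have "\<dots> = (map_mat Re A *\<^sub>v map_vec Im v + map_mat Im A *\<^sub>v map_vec Re v) $ i"
    using A i by simp
  finally show "map_vec Im (A *\<^sub>v v) $ i = \<dots>" .
qed (use A in simp)

lemma mat_adjoint_carrier: "A \<in> carrier_mat m n \<Longrightarrow> mat_adjoint A \<in> carrier_mat n m"
  by (intro carrier_matI) (auto simp: mat_adjoint_def)

lemma mat_adjoint_index: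
  assumes "(A :: complex mat) \<in> carrier_mat m n" "i < n" "j < m"
  shows "mat_adjoint A $$ (i, j) = cnj (A $$ (j, i))"
  using assms by (auto simp: mat_adjoint_def mat_of_rows_index)

lemma map_mat_adjoint:
  assumes A: "A \<in> carrier_mat m n"
  shows "map_mat Re (mat_adjoint A) = transpose_mat (map_mat Re A)"
    "map_mat Im (mat_adjoint A) = - transpose_mat (map_mat Im A)"
  using A mat_adjoint_carrier[OF A] by (auto intro!: eq_matI simp: mat_adjoint_index[OF A])

lemma hermitian_iff_parity_sym:
  assumes A: "A \<in> carrier_mat n n"
  shows "mat_adjoint A = A \<longleftrightarrow> parity_sym 0 n (map_mat Re A) \<and> parity_sym 1 n (map_mat Im A)"
proof
  assume eq: "mat_adjoint A = A"
  show "parity_sym 0 n (map_mat Re A) \<and> parity_sym 1 n (map_mat Im A)"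
  proof -
    \<comment> \<open>The adjoint rule yields the imaginary part as minus its own transpose; double
      negation solves this for the transpose, as \<open>parity_sym_1_iff\<close> asks.\<close>
    have "transpose_mat (map_mat Im A) = - (- transpose_mat (map_mat Im A))"
      by (rule eq_matI) simp_all
    then show ?thesis
      unfolding parity_sym_0_iff parity_sym_1_iff
      using map_mat_adjoint[OF A] unfolding eq using A by simp
  qed
next
  assume "parity_sym 0 n (map_mat Re A) \<and> parity_sym 1 n (map_mat Im A)"
  then have *: "transpose_mat (map_mat Re A) = map_mat Re A"
    "transpose_mat (map_mat Im A) = - map_mat Im A"
    unfolding parity_sym_0_iff parity_sym_1_iff by blast+
  show "mat_adjoint A = A"
  proof (rule eq_matI)
    fix i j assume "i < dim_row A" "j < dim_col A"
    then have ij: "i < n" "j < n" using A by auto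
    then show "mat_adjoint A $$ (i, j) = A $$ (i, j)"
      using arg_cong[OF *(1), of "\<lambda>B. B $$ (i, j)"] arg_cong[OF *(2), of "\<lambda>B. B $$ (i, j)"] A
      by (simp add: mat_adjoint_index[OF A] complex_eq_iff)
  qed (use A mat_adjoint_carrier[OF A] in auto)
qed

text \<open>Conjugate numbers vanish together, so a Hermitian matrix has a symmetric
  pattern.\<close>

lemma Theta_symmetric:
  assumes E: "E \<in> carrier_mat n n" "mat_adjoint E = E" and ij: "i < n" "j < n"
  shows "Theta E $$ (j, i) = Theta E $$ (i, j)"
  using mat_adjoint_index[OF E(1) ij] ij E(1) unfolding E(2) by (simp add: Theta_def)

lemma map_mat_hadamard_Theta:
  assumes "Z \<in> carrier_mat m n" "X \<in> carrier_mat m n"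
  shows "map_mat Re (Z \<odot>\<^sub>m Theta X) = map_mat Re Z \<odot>\<^sub>m Theta X"
    "map_mat Im (Z \<odot>\<^sub>m Theta X) = map_mat Im Z \<odot>\<^sub>m Theta X"
  using assms by (auto intro!: eq_matI simp: hadamard_mat_def Theta_def)

lemma hadamard_Theta_idem:
  fixes Z :: "complex mat"
  assumes "Z \<in> carrier_mat m n" "X \<in> carrier_mat m n"
  shows "(Z \<odot>\<^sub>m Theta X) \<odot>\<^sub>m Theta X = Z \<odot>\<^sub>m Theta X"
  using assms by (auto intro!: eq_matI simp: hadamard_mat_def Theta_def)

lemma norm_hadamard_Theta_le:
  assumes "Z \<in> carrier_mat m n" "X \<in> carrier_mat m n"
  shows "(frobenius_norm (Z \<odot>\<^sub>m Theta X))\<^sup>2 \<le> (frobenius_norm Z)\<^sup>2"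
proof -
  have "(\<Sum>i<m. \<Sum>j<n. (cmod ((Z \<odot>\<^sub>m Theta X) $$ (i, j)))\<^sup>2) \<le> (\<Sum>i<m. \<Sum>j<n. (cmod (Z $$ (i, j)))\<^sup>2)"
    using assms by (intro sum_mono) (auto simp: hadamard_mat_def Theta_def)
  then show ?thesis using assms
    by (simp add: frobenius_norm_def sum_nonneg) (simp add: hadamard_mat_def)
qed

lemma frobenius_norm_sq:
  assumes "Z \<in> carrier_mat m n"
  shows "(frobenius_norm Z)\<^sup>2 = (\<Sum>i<m. \<Sum>j<n. (map_mat Re Z $$ (i, j))\<^sup>2)
    + (\<Sum>i<m. \<Sum>j<n. (map_mat Im Z $$ (i, j))\<^sup>2)"
proof -
  have "(frobenius_norm Z)\<^sup>2 = (\<Sum>i<m. \<Sum>j<n. (cmod (Z $$ (i, j)))\<^sup>2)"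
    using assms by (simp add: frobenius_norm_def sum_nonneg)
  also have "\<dots> = (\<Sum>i<m. \<Sum>j<n. (map_mat Re Z $$ (i, j))\<^sup>2 + (map_mat Im Z $$ (i, j))\<^sup>2)"
    using assms by (intro sum.cong refl) (simp add: cmod_power2)
  finally show ?thesis by (simp add: sum.distrib)
qed

lemma two_norm_sq:
  "(\<beta> \<cdot>\<^sub>v map_vec Re v) \<bullet> (\<beta> \<cdot>\<^sub>v map_vec Re v) + (\<beta> \<cdot>\<^sub>v map_vec Im v) \<bullet> (\<beta> \<cdot>\<^sub>v map_vec Im v)
    = \<beta>\<^sup>2 * (two_norm v)\<^sup>2"
  by (simp add: two_norm_def scalar_prod_self_sum sum_nonneg power_mult_distrib cmod_power2
      sum_distrib_left sum.distrib distrib_left)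

text \<open>Bridge between two descriptions of a complex unknown: the formulas of the theorem give
  \<open>z\<close> at once, the coordinate vector holds its scaled real and imaginary parts.\<close>

lemma complex_vec_eq_iff:
  assumes z: "z \<in> carrier_vec k" and c: "c \<in> carrier_vec k" and d: "d \<in> carrier_vec k" and \<alpha>: "\<alpha> \<noteq> 0"
  shows "z = complex_of_real (inverse \<alpha>) \<cdot>\<^sub>v (map_vec complex_of_real c + \<i> \<cdot>\<^sub>v map_vec complex_of_real d)
    \<longleftrightarrow> \<alpha> \<cdot>\<^sub>v map_vec Re z = c \<and> \<alpha> \<cdot>\<^sub>v map_vec Im z = d"
proof
  assume eq: "z = complex_of_real (inverse \<alpha>) \<cdot>\<^sub>v (map_vec complex_of_real c + \<i> \<cdot>\<^sub>v map_vec complex_of_real d)"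
  show "\<alpha> \<cdot>\<^sub>v map_vec Re z = c \<and> \<alpha> \<cdot>\<^sub>v map_vec Im z = d"
    unfolding eq using c d \<alpha> by (auto intro!: eq_vecI simp: power2_eq_square)
next
  assume *: "\<alpha> \<cdot>\<^sub>v map_vec Re z = c \<and> \<alpha> \<cdot>\<^sub>v map_vec Im z = d"
  show "z = complex_of_real (inverse \<alpha>) \<cdot>\<^sub>v (map_vec complex_of_real c + \<i> \<cdot>\<^sub>v map_vec complex_of_real d)"
    unfolding conjunct1[OF *, symmetric] conjunct2[OF *, symmetric]
    using z \<alpha> by (auto intro!: eq_vecI simp: complex_eq_iff power2_eq_square)
qed

section \<open>Selection matrices and solving for weighted coordinates\<close>

lemma selection_complex_mult_vec:
  assumes "x \<in> carrier_vec a" "c \<in> carrier_vec k" "d \<in> carrier_vec k" "y \<in> carrier_vec b"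
  shows "(0\<^sub>m k a @\<^sub>c 1\<^sub>m k @\<^sub>c \<i> \<cdot>\<^sub>m 1\<^sub>m k @\<^sub>c 0\<^sub>m k b) *\<^sub>v (x @\<^sub>v c @\<^sub>v d @\<^sub>v y) = c + \<i> \<cdot>\<^sub>v d"
proof -
  have "(0\<^sub>m k a @\<^sub>c 1\<^sub>m k @\<^sub>c \<i> \<cdot>\<^sub>m 1\<^sub>m k @\<^sub>c 0\<^sub>m k b) *\<^sub>v (x @\<^sub>v c @\<^sub>v d @\<^sub>v y)
    = 0\<^sub>m k a *\<^sub>v x + (1\<^sub>m k *\<^sub>v c + ((\<i> \<cdot>\<^sub>m 1\<^sub>m k) *\<^sub>v d + 0\<^sub>m k b *\<^sub>v y))"
    using assms by (intro append_cols4_mult_vec) auto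
  also have "(\<i> \<cdot>\<^sub>m 1\<^sub>m k) *\<^sub>v d = \<i> \<cdot>\<^sub>v d" using assms by (simp add: smult_mat_mult_vec[of _ k k])
  finally show ?thesis using assms by (simp add: zero_mat_mult_vec)
qed

lemma weight_mat_eq_iff:
  assumes v: "v \<in> carrier_vec (length (lower_positions d k))"
    and a: "a \<in> carrier_vec (length (lower_positions d k))" and \<alpha>: "\<alpha> \<noteq> 0"
  shows "v = inverse \<alpha> \<cdot>\<^sub>v (mat_inv (weight_mat d k) *\<^sub>v a) \<longleftrightarrow> \<alpha> \<cdot>\<^sub>v (weight_mat d k *\<^sub>v v) = a"
proof -
  note D = weight_mat_carrier[of d k] and I = weight_mat_inv(1)[of d k]
  have Ia: "mat_inv (weight_mat d k) *\<^sub>v a \<in> carrier_vec (length (lower_positions d k))" using I a by simp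
  have Dv: "weight_mat d k *\<^sub>v v \<in> carrier_vec (length (lower_positions d k))" using D v by simp
  show ?thesis
  proof
    assume eq: "v = inverse \<alpha> \<cdot>\<^sub>v (mat_inv (weight_mat d k) *\<^sub>v a)"
    have "weight_mat d k *\<^sub>v v = inverse \<alpha> \<cdot>\<^sub>v (weight_mat d k *\<^sub>v (mat_inv (weight_mat d k) *\<^sub>v a))"
      unfolding eq by (rule mult_mat_vec[OF D Ia])
    also have "weight_mat d k *\<^sub>v (mat_inv (weight_mat d k) *\<^sub>v a) = a"
      using assoc_mult_mat_vec[OF D I a] weight_mat_inv(2)[of d k] a by simp
    finally show "\<alpha> \<cdot>\<^sub>v (weight_mat d k *\<^sub>v v) = a" using \<alpha> by (simp add: smult_smult_assoc)
  next
    assume eq: "\<alpha> \<cdot>\<^sub>v (weight_mat d k *\<^sub>v v) = a"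
    have "mat_inv (weight_mat d k) *\<^sub>v a = \<alpha> \<cdot>\<^sub>v (mat_inv (weight_mat d k) *\<^sub>v (weight_mat d k *\<^sub>v v))"
      unfolding eq[symmetric] by (rule mult_mat_vec[OF I Dv])
    also have "mat_inv (weight_mat d k) *\<^sub>v (weight_mat d k *\<^sub>v v) = v"
      using assoc_mult_mat_vec[OF I D v] weight_mat_inv(3)[of d k] v by simp
    finally show "v = inverse \<alpha> \<cdot>\<^sub>v (mat_inv (weight_mat d k) *\<^sub>v a)" using \<alpha> by (simp add: smult_smult_assoc)
  qed
qed

lemma length_lower_positions_add:
  "length (lower_positions 0 n) + length (lower_positions 1 n) = n\<^sup>2"
proof -
  have "2 * length (lower_positions 0 n) + n * n = n * (2 * n + 1)"
    using length_lower_columns[of 0 n n] by (simp add: lower_positions_def)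
  moreover have "2 * length (lower_positions 1 n) + n * n + 2 * n = n * (2 * n + 1)"
    using length_lower_columns[of 1 n n] by (simp add: lower_positions_def)
  ultimately show ?thesis by (simp add: algebra_simps power2_eq_square)
qed

lemma mat_adjoint_add:
  assumes "(A :: complex mat) \<in> carrier_mat m n" "B \<in> carrier_mat m n"
  shows "mat_adjoint (A + B) = mat_adjoint A + mat_adjoint B"
proof (rule eq_matI)
  have AB: "A + B \<in> carrier_mat m n" using assms by simp
  note c = mat_adjoint_carrier[OF assms(1)] mat_adjoint_carrier[OF assms(2)] mat_adjoint_carrier[OF AB]
  show "dim_row (mat_adjoint (A + B)) = dim_row (mat_adjoint A + mat_adjoint B)"
    "dim_col (mat_adjoint (A + B)) = dim_col (mat_adjoint A + mat_adjoint B)"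
    using c by auto
  fix i j assume "i < dim_row (mat_adjoint A + mat_adjoint B)" "j < dim_col (mat_adjoint A + mat_adjoint B)"
  then have "i < n" "j < m" using c by auto
  then show "mat_adjoint (A + B) $$ (i, j) = (mat_adjoint A + mat_adjoint B) $$ (i, j)"
    using c assms by (simp add: mat_adjoint_index[OF AB] mat_adjoint_index[OF assms(1)] mat_adjoint_index[OF assms(2)])
qed

lemma residual_eq_iff:
  fixes x y dx dy q dq :: "complex vec"
  assumes "x \<in> carrier_vec n" "y \<in> carrier_vec n" "dx \<in> carrier_vec n" "dy \<in> carrier_vec n"
    "q \<in> carrier_vec n" "dq \<in> carrier_vec n"
  shows "(x + dx) + (y + dy) = q + dq \<longleftrightarrow> dx + dy - dq = q - x - y"
proof -
  have "x $ i + (dx $ i + (y $ i + dy $ i)) = q $ i + dq $ i \<longleftrightarrow> dx $ i + dy $ i - dq $ i = q $ i - x $ i - y $ i" for i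
    by (auto simp: algebra_simps)
  then show ?thesis using assms by (simp add: vec_eq_iff)
qed

lemma complex_vec_eqI:
  assumes "map_vec Re x = map_vec Re y" "map_vec Im x = map_vec Im y"
  shows "x = y"
proof (rule eq_vecI)
  show "dim_vec x = dim_vec y" using arg_cong[OF assms(1), of dim_vec] by simp
  then show "x $ i = y $ i" if "i < dim_vec y" for i
    using that arg_cong[OF assms(1), of "\<lambda>v. v $ i"] arg_cong[OF assms(2), of "\<lambda>v. v $ i"]
    by (simp add: complex_eq_iff)
qed

lemma complex_mat_eqI:
  assumes "map_mat Re x = map_mat Re y" "map_mat Im x = map_mat Im y"
  shows "x = y"
proof (rule eq_matI)
  show d: "dim_row x = dim_row y" "dim_col x = dim_col y"
    using arg_cong[OF assms(1), of dim_row] arg_cong[OF assms(1), of dim_col] by simp_all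
  show "x $$ (i, j) = y $$ (i, j)" if "i < dim_row y" "j < dim_col y" for i j
    using that d arg_cong[OF assms(1), of "\<lambda>v. v $$ (i, j)"] arg_cong[OF assms(2), of "\<lambda>v. v $$ (i, j)"]
    by (simp add: complex_eq_iff)
qed

lemma smult_vec_cancel:
  fixes x y :: "real vec"
  assumes "c \<noteq> 0" "c \<cdot>\<^sub>v x = c \<cdot>\<^sub>v y"
  shows "x = y"
proof -
  have "inverse c \<cdot>\<^sub>v (c \<cdot>\<^sub>v x) = inverse c \<cdot>\<^sub>v (c \<cdot>\<^sub>v y)" using assms(2) by simp
  then show ?thesis using assms(1) by (simp add: smult_smult_assoc)
qed

lemma map_vec_Re_Im_append_inj:
  assumes "dim_vec x = dim_vec x'" "dim_vec y = dim_vec y'"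
    and eq: "map_vec Re x @\<^sub>v map_vec Im x @\<^sub>v map_vec Re y @\<^sub>v map_vec Im y
      = map_vec Re x' @\<^sub>v map_vec Im x' @\<^sub>v map_vec Re y' @\<^sub>v map_vec Im y'"
  shows "x = x'" "y = y'"
proof -
  define k where "k = dim_vec x"
  define l where "l = dim_vec y"
  have c: "map_vec Re x \<in> carrier_vec k" "map_vec Re x' \<in> carrier_vec k" "map_vec Im x \<in> carrier_vec k"
    "map_vec Im x' \<in> carrier_vec k" "map_vec Re y \<in> carrier_vec l" "map_vec Re y' \<in> carrier_vec l"
    using assms by (auto simp: k_def l_def intro!: carrier_vecI)
  have "map_vec Re x = map_vec Re x'" "map_vec Im x = map_vec Im x'"
    "map_vec Re y = map_vec Re y'" "map_vec Im y = map_vec Im y'"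
    using eq unfolding append_vec_eq[OF c(1,2)] append_vec_eq[OF c(3,4)] append_vec_eq[OF c(5,6)] by blast+
  then show "x = x'" "y = y'" by (auto intro: complex_vec_eqI)
qed

lemma map_vec_vec_of_mat: "map_vec f (vec_of_mat Z) = vec_of_mat (map_mat f Z)"
proof (rule eq_vecI)
  fix a assume "a < dim_vec (vec_of_mat (map_mat f Z))"
  then have a: "a < dim_row Z * dim_col Z" by (simp add: vec_of_mat_def)
  then have "dim_row Z > 0" by (cases "dim_row Z") auto
  then have "a mod dim_row Z < dim_row Z" "a div dim_row Z < dim_col Z"
    using a by (auto simp: less_mult_imp_div_less mult.commute)
  then show "map_vec f (vec_of_mat Z) $ a = vec_of_mat (map_mat f Z) $ a"
    using a by (simp add: vec_of_mat_def)
qed (simp add: vec_of_mat_def)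

lemma selection_complex_last_mult_vec:
  assumes "x \<in> carrier_vec a" "c \<in> carrier_vec k" "d \<in> carrier_vec k"
  shows "(0\<^sub>m k a @\<^sub>c 1\<^sub>m k @\<^sub>c \<i> \<cdot>\<^sub>m 1\<^sub>m k) *\<^sub>v (x @\<^sub>v c @\<^sub>v d) = c + \<i> \<cdot>\<^sub>v d"
proof -
  have I: "\<i> \<cdot>\<^sub>m 1\<^sub>m k \<in> carrier_mat k k" by simp
  have cd: "c @\<^sub>v d \<in> carrier_vec (k + k)" using assms by simp
  have "(0\<^sub>m k a @\<^sub>c 1\<^sub>m k @\<^sub>c \<i> \<cdot>\<^sub>m 1\<^sub>m k) *\<^sub>v (x @\<^sub>v c @\<^sub>v d)
    = 0\<^sub>m k a *\<^sub>v x + (1\<^sub>m k *\<^sub>v c + (\<i> \<cdot>\<^sub>m 1\<^sub>m k) *\<^sub>v d)"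
    unfolding append_cols_mult_vec[OF zero_carrier_mat append_cols_carrier[OF one_carrier_mat I] assms(1) cd]
      append_cols_mult_vec[OF one_carrier_mat I assms(2,3)] ..
  also have "(\<i> \<cdot>\<^sub>m 1\<^sub>m k) *\<^sub>v d = \<i> \<cdot>\<^sub>v d" using assms by (simp add: smult_mat_mult_vec[of _ k k])
  finally show ?thesis using assms by (simp add: zero_mat_mult_vec)
qed

lemma selection_first_mult_vec:
  assumes "x \<in> carrier_vec k" "y \<in> carrier_vec b"
  shows "(1\<^sub>m k @\<^sub>c 0\<^sub>m k b) *\<^sub>v (x @\<^sub>v y) = (x :: real vec)"
  unfolding append_cols_mult_vec[OF one_carrier_mat zero_carrier_mat assms]
  using assms by (simp add: zero_mat_mult_vec)

lemma selection_middle_mult_vec: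
  assumes x: "x \<in> carrier_vec a" and y: "y \<in> carrier_vec k" and z: "z \<in> carrier_vec b"
  shows "(0\<^sub>m k a @\<^sub>c 1\<^sub>m k @\<^sub>c 0\<^sub>m k b) *\<^sub>v (x @\<^sub>v y @\<^sub>v z) = (y :: real vec)"
proof -
  have yz: "y @\<^sub>v z \<in> carrier_vec (k + b)" using y z by simp
  show ?thesis
    unfolding append_cols_mult_vec[OF zero_carrier_mat append_cols_carrier[OF one_carrier_mat zero_carrier_mat] x yz]
      selection_first_mult_vec[OF y z]
    using x y by (simp add: zero_mat_mult_vec)
qed

section \<open>Single blocks acting on scaled coordinates\<close>

lemma row_one_carrier:
  "v \<in> carrier_vec k \<Longrightarrow> mat_of_row v \<otimes>\<^sub>K 1\<^sub>m j \<in> carrier_mat j (k * j)"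
  using kronecker_mat_carrier[of "mat_of_row v" 1 k "1\<^sub>m j" j j] by simp

lemma one_row_carrier:
  "v \<in> carrier_vec k \<Longrightarrow> 1\<^sub>m j \<otimes>\<^sub>K mat_of_row v \<in> carrier_mat j (j * k)"
  using kronecker_mat_carrier[of "1\<^sub>m j" j j "mat_of_row v" 1 k] by simp

lemma Sigma_row_one_carrier:
  "v \<in> carrier_vec k \<Longrightarrow> X \<in> carrier_mat j k \<Longrightarrow>
    c \<cdot>\<^sub>m ((mat_of_row v \<otimes>\<^sub>K 1\<^sub>m j) * Sigma_mat X) \<in> carrier_mat j (k * j)"
  using row_one_carrier[of v k j] Sigma_mat_carrier[of X j k] by (intro smult_carrier_mat mult_carrier_mat)

lemma Sigma_one_row_carrier:
  "v \<in> carrier_vec j \<Longrightarrow> X \<in> carrier_mat j k \<Longrightarrow>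
    c \<cdot>\<^sub>m ((1\<^sub>m k \<otimes>\<^sub>K mat_of_row v) * Sigma_mat X) \<in> carrier_mat k (k * j)"
  using one_row_carrier[of v j k] Sigma_mat_carrier[of X j k] by (intro smult_carrier_mat mult_carrier_mat)

lemma Sigma_row_one_term:
  assumes v: "v \<in> carrier_vec k" and X: "X \<in> carrier_mat j k" and Z: "Z \<in> carrier_mat j k"
  shows "(c \<cdot>\<^sub>m ((mat_of_row v \<otimes>\<^sub>K 1\<^sub>m j) * Sigma_mat X)) *\<^sub>v (\<alpha> \<cdot>\<^sub>v vec_of_mat Z)
    = (c * \<alpha>) \<cdot>\<^sub>v ((Z \<odot>\<^sub>m Theta X) *\<^sub>v v)"
proof -
  note H = hadamard_mat_carrier[OF Z, of "Theta X"] and Zv = vec_of_mat_carrier[OF Z]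
  have eq: "Sigma_mat X *\<^sub>v (\<alpha> \<cdot>\<^sub>v vec_of_mat Z) = \<alpha> \<cdot>\<^sub>v vec_of_mat (Z \<odot>\<^sub>m Theta X)"
    unfolding mult_mat_vec[OF Sigma_mat_carrier[OF X] Zv] Sigma_mat_mult_vec_of_mat[OF X Z] ..
  have \<alpha>Z: "\<alpha> \<cdot>\<^sub>v vec_of_mat Z \<in> carrier_vec (k * j)" using Zv by simp
  show ?thesis
    unfolding scaled_product_mult_vec[OF row_one_carrier[OF v] Sigma_mat_carrier[OF X] \<alpha>Z vec_of_mat_carrier[OF H] eq]
      kronecker_row_one_mult_vec_of_mat[OF v H] ..
qed

lemma Sigma_one_row_term:
  assumes v: "v \<in> carrier_vec j" and X: "X \<in> carrier_mat j k" and Z: "Z \<in> carrier_mat j k"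
  shows "(c \<cdot>\<^sub>m ((1\<^sub>m k \<otimes>\<^sub>K mat_of_row v) * Sigma_mat X)) *\<^sub>v (\<alpha> \<cdot>\<^sub>v vec_of_mat Z)
    = (c * \<alpha>) \<cdot>\<^sub>v (transpose_mat (Z \<odot>\<^sub>m Theta X) *\<^sub>v v)"
proof -
  note H = hadamard_mat_carrier[OF Z, of "Theta X"] and Zv = vec_of_mat_carrier[OF Z]
  have eq: "Sigma_mat X *\<^sub>v (\<alpha> \<cdot>\<^sub>v vec_of_mat Z) = \<alpha> \<cdot>\<^sub>v vec_of_mat (Z \<odot>\<^sub>m Theta X)"
    unfolding mult_mat_vec[OF Sigma_mat_carrier[OF X] Zv] Sigma_mat_mult_vec_of_mat[OF X Z] ..
  have \<alpha>Z: "\<alpha> \<cdot>\<^sub>v vec_of_mat Z \<in> carrier_vec (k * j)" using Zv by simp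
  show ?thesis
    unfolding scaled_product_mult_vec[OF one_row_carrier[OF v] Sigma_mat_carrier[OF X] \<alpha>Z vec_of_mat_carrier[OF H] eq]
      kronecker_one_row_mult_vec_of_mat[OF v H] ..
qed

lemma scaled_vec_of_mat_surj:
  assumes c: "c \<in> carrier_vec (k * j)" and \<gamma>: "\<gamma> \<noteq> 0"
  shows "\<exists>Z \<in> carrier_mat j k. \<gamma> \<cdot>\<^sub>v vec_of_mat Z = (c :: real vec)"
proof -
  have "inverse \<gamma> \<cdot>\<^sub>v c \<in> carrier_vec (k * j)" using c by simp
  from vec_of_mat_surj[OF this] obtain Z where "Z \<in> carrier_mat j k" "vec_of_mat Z = inverse \<gamma> \<cdot>\<^sub>v c" by blast
  with \<gamma> show ?thesis by (intro bexI[of _ Z]) (simp_all add: smult_smult_assoc)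
qed

lemma complex_mat_of_parts:
  assumes "X \<in> carrier_mat j k" "Y \<in> carrier_mat j k"
  shows "\<exists>Z \<in> carrier_mat j k. map_mat Re Z = X \<and> map_mat Im Z = Y"
  using assms
  by (intro bexI[of _ "mat j k (\<lambda>ij. Complex (X $$ ij) (Y $$ ij))"]) (auto intro!: eq_matI)

lemma complex_vec_of_scaled_parts:
  assumes "x \<in> carrier_vec k" "y \<in> carrier_vec k" "\<gamma> \<noteq> 0"
  shows "\<exists>z \<in> carrier_vec k. \<gamma> \<cdot>\<^sub>v map_vec Re z = x \<and> \<gamma> \<cdot>\<^sub>v map_vec Im z = y"
  using assms
  by (intro bexI[of _ "vec k (\<lambda>i. Complex (x $ i / \<gamma>) (y $ i / \<gamma>))"]) (auto intro!: eq_vecI)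

section \<open>The linear system for the perturbation\<close>

text \<open>Fixes the data on which the coefficient matrix and the coordinates depend;
  \<open>q\<close> and \<open>r\<close> enter later, through the right-hand side of the linear
  system.\<close>

locale saddle_point =
  fixes n m :: nat and E F G :: "complex mat" and u p :: "complex vec"
    and \<alpha>\<^sub>1 \<alpha>\<^sub>2 \<alpha>\<^sub>3 \<beta>\<^sub>1 \<beta>\<^sub>2 :: real
  assumes E: "E \<in> carrier_mat n n" "mat_adjoint E = E"
    and F: "F \<in> carrier_mat m n"
    and G: "G \<in> carrier_mat m m"
    and u: "u \<in> carrier_vec n" and p: "p \<in> carrier_vec m"
    and pos: "\<alpha>\<^sub>1 > 0" "\<alpha>\<^sub>2 > 0" "\<alpha>\<^sub>3 > 0" "\<beta>\<^sub>1 > 0" "\<beta>\<^sub>2 > 0"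
begin

abbreviation ru where "ru \<equiv> map_vec Re u"
abbreviation iu where "iu \<equiv> map_vec Im u"
abbreviation rp where "rp \<equiv> map_vec Re p"
abbreviation ip where "ip \<equiv> map_vec Im p"

abbreviation len0 where "len0 \<equiv> length (lower_positions 0 n)"
abbreviation len1 where "len1 \<equiv> length (lower_positions 1 n)"

text \<open>The matrices \<open>N\<^sub>1\<close> (for \<open>d = 0\<close>) and
  \<open>N\<^sub>2\<close> (for \<open>d = 1\<close>) of the statement, in terms of the explicit
  factors.\<close>

definition sym_factor :: "nat \<Rightarrow> real mat" where
  "sym_factor d = expansion_mat d n * pattern_mat d E * mat_inv (weight_mat d n)"

text \<open>\<open>upper_block\<close>, \<open>lower_block\<close> and \<open>system_mat\<close> are
  \<open>Xh\<^sub>1\<close>, \<open>Xh\<^sub>2\<close> and \<open>W\<close> of the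
  statement.\<close>

definition upper_block :: "real mat" where
  "upper_block =
    (inverse \<alpha>\<^sub>1 \<cdot>\<^sub>m ((mat_of_row ru \<otimes>\<^sub>K 1\<^sub>m n) * sym_factor 0) @\<^sub>c
     (- inverse \<alpha>\<^sub>1) \<cdot>\<^sub>m ((mat_of_row iu \<otimes>\<^sub>K 1\<^sub>m n) * sym_factor 1) @\<^sub>c
     inverse \<alpha>\<^sub>2 \<cdot>\<^sub>m ((1\<^sub>m n \<otimes>\<^sub>K mat_of_row rp) * Sigma_mat F) @\<^sub>c
     inverse \<alpha>\<^sub>2 \<cdot>\<^sub>m ((1\<^sub>m n \<otimes>\<^sub>K mat_of_row ip) * Sigma_mat F))
    @\<^sub>r
    (inverse \<alpha>\<^sub>1 \<cdot>\<^sub>m ((mat_of_row iu \<otimes>\<^sub>K 1\<^sub>m n) * sym_factor 0) @\<^sub>c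
     inverse \<alpha>\<^sub>1 \<cdot>\<^sub>m ((mat_of_row ru \<otimes>\<^sub>K 1\<^sub>m n) * sym_factor 1) @\<^sub>c
     inverse \<alpha>\<^sub>2 \<cdot>\<^sub>m ((1\<^sub>m n \<otimes>\<^sub>K mat_of_row ip) * Sigma_mat F) @\<^sub>c
     (- inverse \<alpha>\<^sub>2) \<cdot>\<^sub>m ((1\<^sub>m n \<otimes>\<^sub>K mat_of_row rp) * Sigma_mat F))"

definition lower_block :: "real mat" where
  "lower_block =
    (inverse \<alpha>\<^sub>2 \<cdot>\<^sub>m ((mat_of_row ru \<otimes>\<^sub>K 1\<^sub>m m) * Sigma_mat F) @\<^sub>c
     (- inverse \<alpha>\<^sub>2) \<cdot>\<^sub>m ((mat_of_row iu \<otimes>\<^sub>K 1\<^sub>m m) * Sigma_mat F) @\<^sub>c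
     inverse \<alpha>\<^sub>3 \<cdot>\<^sub>m ((mat_of_row rp \<otimes>\<^sub>K 1\<^sub>m m) * Sigma_mat G) @\<^sub>c
     (- inverse \<alpha>\<^sub>3) \<cdot>\<^sub>m ((mat_of_row ip \<otimes>\<^sub>K 1\<^sub>m m) * Sigma_mat G))
    @\<^sub>r
    (inverse \<alpha>\<^sub>2 \<cdot>\<^sub>m ((mat_of_row iu \<otimes>\<^sub>K 1\<^sub>m m) * Sigma_mat F) @\<^sub>c
     inverse \<alpha>\<^sub>2 \<cdot>\<^sub>m ((mat_of_row ru \<otimes>\<^sub>K 1\<^sub>m m) * Sigma_mat F) @\<^sub>c
     inverse \<alpha>\<^sub>3 \<cdot>\<^sub>m ((mat_of_row ip \<otimes>\<^sub>K 1\<^sub>m m) * Sigma_mat G) @\<^sub>c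
     inverse \<alpha>\<^sub>3 \<cdot>\<^sub>m ((mat_of_row rp \<otimes>\<^sub>K 1\<^sub>m m) * Sigma_mat G))"

definition system_mat :: "real mat" where
  "system_mat = four_block_mat
     (upper_block @\<^sub>c 0\<^sub>m (2 * n) (2 * m\<^sup>2))
     ((- inverse \<beta>\<^sub>1) \<cdot>\<^sub>m 1\<^sub>m (2 * n) @\<^sub>c 0\<^sub>m (2 * n) (2 * m))
     (0\<^sub>m (2 * m) (n\<^sup>2) @\<^sub>c lower_block)
     (0\<^sub>m (2 * m) (2 * n) @\<^sub>c (- inverse \<beta>\<^sub>2) \<cdot>\<^sub>m 1\<^sub>m (2 * m))"

definition sym_coords :: "nat \<Rightarrow> real mat \<Rightarrow> real vec" where
  "sym_coords d Z = \<alpha>\<^sub>1 \<cdot>\<^sub>v (weight_mat d n *\<^sub>v lower_vec d Z)"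

definition coords :: "complex mat \<Rightarrow> complex mat \<Rightarrow> complex mat \<Rightarrow> complex vec \<Rightarrow> complex vec \<Rightarrow> real vec" where
  "coords \<Delta>E \<Delta>F \<Delta>G \<Delta>q \<Delta>r =
    sym_coords 0 (map_mat Re \<Delta>E) @\<^sub>v sym_coords 1 (map_mat Im \<Delta>E) @\<^sub>v
    \<alpha>\<^sub>2 \<cdot>\<^sub>v vec_of_mat (map_mat Re \<Delta>F) @\<^sub>v \<alpha>\<^sub>2 \<cdot>\<^sub>v vec_of_mat (map_mat Im \<Delta>F) @\<^sub>v
    \<alpha>\<^sub>3 \<cdot>\<^sub>v vec_of_mat (map_mat Re \<Delta>G) @\<^sub>v \<alpha>\<^sub>3 \<cdot>\<^sub>v vec_of_mat (map_mat Im \<Delta>G) @\<^sub>v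
    \<beta>\<^sub>1 \<cdot>\<^sub>v map_vec Re \<Delta>q @\<^sub>v \<beta>\<^sub>1 \<cdot>\<^sub>v map_vec Im \<Delta>q @\<^sub>v
    \<beta>\<^sub>2 \<cdot>\<^sub>v map_vec Re \<Delta>r @\<^sub>v \<beta>\<^sub>2 \<cdot>\<^sub>v map_vec Im \<Delta>r"

text \<open>\<open>G1\<close> without its linear equation, that is, the real vector space on which
  \<open>coords\<close> is a bijection onto the vectors of dimension
  \<open>coords_dim\<close>.\<close>

definition admissible :: "perturbation set" where
  "admissible = {(\<Delta>E, \<Delta>F, \<Delta>G, \<Delta>q, \<Delta>r). \<Delta>E \<in> carrier_mat n n \<and> mat_adjoint \<Delta>E = \<Delta>E \<and>
     \<Delta>F \<in> carrier_mat m n \<and> \<Delta>G \<in> carrier_mat m m \<and> \<Delta>q \<in> carrier_vec n \<and> \<Delta>r \<in> carrier_vec m}"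

section \<open>The coefficient matrix acting on coordinates\<close>

lemma real_parts_carrier:
  "ru \<in> carrier_vec n" "iu \<in> carrier_vec n" "rp \<in> carrier_vec m" "ip \<in> carrier_vec m"
  using u p by simp_all

lemma sym_factor_carrier: "sym_factor d \<in> carrier_mat (n * n) (length (lower_positions d n))"
  unfolding sym_factor_def
  using expansion_mat_carrier[of d n] pattern_mat_carrier[OF E(1), of d] weight_mat_inv(1)[of d n]
  by (intro mult_carrier_mat)

lemma sym_term_carrier:
  "v \<in> carrier_vec n \<Longrightarrow>
    c \<cdot>\<^sub>m ((mat_of_row v \<otimes>\<^sub>K 1\<^sub>m n) * sym_factor d) \<in> carrier_mat n (length (lower_positions d n))"
  using row_one_carrier[of v n n] sym_factor_carrier by (intro smult_carrier_mat mult_carrier_mat)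

lemma sym_coords_carrier:
  "Z \<in> carrier_mat n n \<Longrightarrow> sym_coords d Z \<in> carrier_vec (length (lower_positions d n))"
  unfolding sym_coords_def using weight_mat_carrier[of d n] lower_vec_carrier[of Z n d] by simp

lemma sym_term:
  assumes v: "v \<in> carrier_vec n" and Z: "parity_sym d n Z" and d: "d \<le> 1"
  shows "(c \<cdot>\<^sub>m ((mat_of_row v \<otimes>\<^sub>K 1\<^sub>m n) * sym_factor d)) *\<^sub>v sym_coords d Z
    = (c * \<alpha>\<^sub>1) \<cdot>\<^sub>v ((Z \<odot>\<^sub>m Theta E) *\<^sub>v v)"
proof -
  note Zc = parity_sym_carrier[OF Z]
  note H = hadamard_mat_carrier[OF Zc, of "Theta E"]
  have eq: "sym_factor d *\<^sub>v sym_coords d Z = \<alpha>\<^sub>1 \<cdot>\<^sub>v vec_of_mat (Z \<odot>\<^sub>m Theta E)"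
    unfolding sym_factor_def sym_coords_def
    by (rule structured_block_mult[OF Z d E(1) Theta_symmetric[OF E]])
  show ?thesis
    unfolding scaled_product_mult_vec[OF row_one_carrier[OF v] sym_factor_carrier sym_coords_carrier[OF Zc]
        vec_of_mat_carrier[OF H] eq]
      kronecker_row_one_mult_vec_of_mat[OF v H] ..
qed

lemma upper_block_carrier: "upper_block \<in> carrier_mat (2 * n) (n\<^sup>2 + 2 * m * n)"
proof -
  have "upper_block \<in> carrier_mat (n + n) (len0 + (len1 + (n * m + n * m)))"
    unfolding upper_block_def
    by (intro carrier_append_rows append_cols4_carrier sym_term_carrier Sigma_one_row_carrier F real_parts_carrier)
  moreover have "n + n = 2 * n" "len0 + (len1 + (n * m + n * m)) = n\<^sup>2 + 2 * m * n"
    using length_lower_positions_add[of n] by simp_all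
  ultimately show ?thesis by (simp only:)
qed

lemma lower_block_carrier: "lower_block \<in> carrier_mat (2 * m) (2 * m * n + 2 * m\<^sup>2)"
proof -
  have "lower_block \<in> carrier_mat (m + m) (n * m + (n * m + (m * m + m * m)))"
    unfolding lower_block_def
    by (intro carrier_append_rows append_cols4_carrier Sigma_row_one_carrier F G real_parts_carrier)
  moreover have "m + m = 2 * m" "n * m + (n * m + (m * m + m * m)) = 2 * m * n + 2 * m\<^sup>2"
    by (simp_all add: power2_eq_square)
  ultimately show ?thesis by (simp only:)
qed

text \<open>The two block rows are the real and imaginary parts of a complex product. For
  \<open>F\<close> the adjoint transposes and negates the imaginary part, which explains why the
  signs in the two \<open>F\<close> columns differ from those in the two \<open>E\<close>
  columns.\<close>

lemma upper_block_mult_vec: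
  assumes \<Delta>E: "\<Delta>E \<in> carrier_mat n n" "mat_adjoint \<Delta>E = \<Delta>E" and \<Delta>F: "\<Delta>F \<in> carrier_mat m n"
  defines "v \<equiv> (\<Delta>E \<odot>\<^sub>m Theta E) *\<^sub>v u + mat_adjoint (\<Delta>F \<odot>\<^sub>m Theta F) *\<^sub>v p"
  shows "upper_block *\<^sub>v (sym_coords 0 (map_mat Re \<Delta>E) @\<^sub>v sym_coords 1 (map_mat Im \<Delta>E) @\<^sub>v
      \<alpha>\<^sub>2 \<cdot>\<^sub>v vec_of_mat (map_mat Re \<Delta>F) @\<^sub>v \<alpha>\<^sub>2 \<cdot>\<^sub>v vec_of_mat (map_mat Im \<Delta>F))
    = map_vec Re v @\<^sub>v map_vec Im v"
proof -
  have sym: "parity_sym 0 n (map_mat Re \<Delta>E)" "parity_sym 1 n (map_mat Im \<Delta>E)"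
    using hermitian_iff_parity_sym[OF \<Delta>E(1)] \<Delta>E(2) by blast+
  have Fc: "map_mat Re \<Delta>F \<in> carrier_mat m n" "map_mat Im \<Delta>F \<in> carrier_mat m n" using \<Delta>F by simp_all
  note HE = hadamard_mat_carrier[OF \<Delta>E(1), of "Theta E"]
  note HF = hadamard_mat_carrier[OF \<Delta>F, of "Theta F"]
  note AF = mat_adjoint_carrier[OF HF]
  let ?ER = "map_mat Re \<Delta>E \<odot>\<^sub>m Theta E" and ?EI = "map_mat Im \<Delta>E \<odot>\<^sub>m Theta E"
  let ?FR = "map_mat Re \<Delta>F \<odot>\<^sub>m Theta F" and ?FI = "map_mat Im \<Delta>F \<odot>\<^sub>m Theta F"
  have Hc: "?ER \<in> carrier_mat n n" "?EI \<in> carrier_mat n n" "?FR \<in> carrier_mat m n" "?FI \<in> carrier_mat m n"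
    by (intro hadamard_mat_carrier parity_sym_carrier[OF sym(1)] parity_sym_carrier[OF sym(2)] Fc)+
  have vc: "sym_coords 0 (map_mat Re \<Delta>E) \<in> carrier_vec len0" "sym_coords 1 (map_mat Im \<Delta>E) \<in> carrier_vec len1"
    "\<alpha>\<^sub>2 \<cdot>\<^sub>v vec_of_mat (map_mat Re \<Delta>F) \<in> carrier_vec (n * m)"
    "\<alpha>\<^sub>2 \<cdot>\<^sub>v vec_of_mat (map_mat Im \<Delta>F) \<in> carrier_vec (n * m)"
    by (intro sym_coords_carrier parity_sym_carrier[OF sym(1)] parity_sym_carrier[OF sym(2)]
      smult_carrier_vec[THEN iffD2] vec_of_mat_carrier Fc)+
  have vdim: "dim_vec ((\<Delta>E \<odot>\<^sub>m Theta E) *\<^sub>v u) = n" "dim_vec (mat_adjoint (\<Delta>F \<odot>\<^sub>m Theta F) *\<^sub>v p) = n"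
    using HE AF by simp_all
  \<comment> \<open>Block weights and coordinate weights cancel, so each coefficient becomes
    literally 1 or -1; \<open>top\<close> and \<open>bot\<close> keep these factors in order to
    match the rewritten goal.\<close>
  have inv: "inverse \<alpha>\<^sub>1 * \<alpha>\<^sub>1 = 1" "(- inverse \<alpha>\<^sub>1) * \<alpha>\<^sub>1 = -1" "inverse \<alpha>\<^sub>2 * \<alpha>\<^sub>2 = 1" "(- inverse \<alpha>\<^sub>2) * \<alpha>\<^sub>2 = -1"
    using pos by simp_all
  note col4 = append_cols4_mult_vec[OF sym_term_carrier sym_term_carrier Sigma_one_row_carrier[OF _ F] Sigma_one_row_carrier[OF _ F] vc]
  note r = real_parts_carrier
  have ReS: "map_vec Re v = map_vec Re ((\<Delta>E \<odot>\<^sub>m Theta E) *\<^sub>v u) + map_vec Re (mat_adjoint (\<Delta>F \<odot>\<^sub>m Theta F) *\<^sub>v p)"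
    and ImS: "map_vec Im v = map_vec Im ((\<Delta>E \<odot>\<^sub>m Theta E) *\<^sub>v u) + map_vec Im (mat_adjoint (\<Delta>F \<odot>\<^sub>m Theta F) *\<^sub>v p)"
    unfolding v_def using vdim by (auto intro!: eq_vecI)
  have top: "1 \<cdot>\<^sub>v (?ER *\<^sub>v ru) + ((-1) \<cdot>\<^sub>v (?EI *\<^sub>v iu) +
      (1 \<cdot>\<^sub>v (transpose_mat ?FR *\<^sub>v rp) + 1 \<cdot>\<^sub>v (transpose_mat ?FI *\<^sub>v ip))) = map_vec Re v"
    unfolding ReS Re_mult_mat_vec[OF HE u] Re_mult_mat_vec[OF AF p] map_mat_adjoint[OF HF]
      map_mat_hadamard_Theta[OF \<Delta>E(1) E(1)] map_mat_hadamard_Theta[OF \<Delta>F F]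
    using carrier_vecD[OF r(4)] carrier_matD[OF Hc(1)] carrier_matD[OF Hc(2)] carrier_matD[OF Hc(3)] carrier_matD[OF Hc(4)]
    by (intro eq_vecI) simp_all
  have bot: "1 \<cdot>\<^sub>v (?ER *\<^sub>v iu) + (1 \<cdot>\<^sub>v (?EI *\<^sub>v ru) +
      (1 \<cdot>\<^sub>v (transpose_mat ?FR *\<^sub>v ip) + (-1) \<cdot>\<^sub>v (transpose_mat ?FI *\<^sub>v rp))) = map_vec Im v"
    unfolding ImS Im_mult_mat_vec[OF HE u] Im_mult_mat_vec[OF AF p] map_mat_adjoint[OF HF]
      map_mat_hadamard_Theta[OF \<Delta>E(1) E(1)] map_mat_hadamard_Theta[OF \<Delta>F F]
    using carrier_vecD[OF r(3)] carrier_matD[OF Hc(1)] carrier_matD[OF Hc(2)] carrier_matD[OF Hc(3)] carrier_matD[OF Hc(4)]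
    by (intro eq_vecI) simp_all
  note blk = append_cols4_carrier[OF sym_term_carrier sym_term_carrier Sigma_one_row_carrier[OF _ F] Sigma_one_row_carrier[OF _ F]]
  have xc: "sym_coords 0 (map_mat Re \<Delta>E) @\<^sub>v sym_coords 1 (map_mat Im \<Delta>E) @\<^sub>v
      \<alpha>\<^sub>2 \<cdot>\<^sub>v vec_of_mat (map_mat Re \<Delta>F) @\<^sub>v \<alpha>\<^sub>2 \<cdot>\<^sub>v vec_of_mat (map_mat Im \<Delta>F)
      \<in> carrier_vec (len0 + (len1 + (n * m + n * m)))"
    by (intro append_carrier_vec vc)
  show ?thesis
    unfolding upper_block_def mat_mult_append[OF blk[OF r(1) r(2) r(3) r(4)] blk[OF r(2) r(1) r(4) r(3)] xc]
      col4[OF r(1) r(2) r(3) r(4)] col4[OF r(2) r(1) r(4) r(3)]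
      sym_term[OF r(1) sym(1) zero_le_one] sym_term[OF r(2) sym(1) zero_le_one]
      sym_term[OF r(1) sym(2) le_refl] sym_term[OF r(2) sym(2) le_refl]
      Sigma_one_row_term[OF r(3) F Fc(1)] Sigma_one_row_term[OF r(4) F Fc(1)]
      Sigma_one_row_term[OF r(3) F Fc(2)] Sigma_one_row_term[OF r(4) F Fc(2)]
      inv top bot ..
qed

text \<open>Here \<open>F\<close> enters without adjoint, so both products follow the plain rule for
  (A + iB)(x + iy), and \<open>F\<close> and \<open>G\<close> show the same signs.\<close>

lemma lower_block_mult_vec:
  assumes \<Delta>F: "\<Delta>F \<in> carrier_mat m n" and \<Delta>G: "\<Delta>G \<in> carrier_mat m m"
  defines "v \<equiv> (\<Delta>F \<odot>\<^sub>m Theta F) *\<^sub>v u + (\<Delta>G \<odot>\<^sub>m Theta G) *\<^sub>v p"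
  shows "lower_block *\<^sub>v (\<alpha>\<^sub>2 \<cdot>\<^sub>v vec_of_mat (map_mat Re \<Delta>F) @\<^sub>v \<alpha>\<^sub>2 \<cdot>\<^sub>v vec_of_mat (map_mat Im \<Delta>F) @\<^sub>v
      \<alpha>\<^sub>3 \<cdot>\<^sub>v vec_of_mat (map_mat Re \<Delta>G) @\<^sub>v \<alpha>\<^sub>3 \<cdot>\<^sub>v vec_of_mat (map_mat Im \<Delta>G))
    = map_vec Re v @\<^sub>v map_vec Im v"
proof -
  have Fc: "map_mat Re \<Delta>F \<in> carrier_mat m n" "map_mat Im \<Delta>F \<in> carrier_mat m n" using \<Delta>F by simp_all
  have Gc: "map_mat Re \<Delta>G \<in> carrier_mat m m" "map_mat Im \<Delta>G \<in> carrier_mat m m" using \<Delta>G by simp_all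
  note HF = hadamard_mat_carrier[OF \<Delta>F, of "Theta F"]
  note HG = hadamard_mat_carrier[OF \<Delta>G, of "Theta G"]
  let ?FR = "map_mat Re \<Delta>F \<odot>\<^sub>m Theta F" and ?FI = "map_mat Im \<Delta>F \<odot>\<^sub>m Theta F"
  let ?GR = "map_mat Re \<Delta>G \<odot>\<^sub>m Theta G" and ?GI = "map_mat Im \<Delta>G \<odot>\<^sub>m Theta G"
  have Hc: "?FR \<in> carrier_mat m n" "?FI \<in> carrier_mat m n" "?GR \<in> carrier_mat m m" "?GI \<in> carrier_mat m m"
    by (intro hadamard_mat_carrier Fc Gc)+
  have vc: "\<alpha>\<^sub>2 \<cdot>\<^sub>v vec_of_mat (map_mat Re \<Delta>F) \<in> carrier_vec (n * m)"
    "\<alpha>\<^sub>2 \<cdot>\<^sub>v vec_of_mat (map_mat Im \<Delta>F) \<in> carrier_vec (n * m)"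
    "\<alpha>\<^sub>3 \<cdot>\<^sub>v vec_of_mat (map_mat Re \<Delta>G) \<in> carrier_vec (m * m)"
    "\<alpha>\<^sub>3 \<cdot>\<^sub>v vec_of_mat (map_mat Im \<Delta>G) \<in> carrier_vec (m * m)"
    by (intro smult_carrier_vec[THEN iffD2] vec_of_mat_carrier Fc Gc)+
  have vdim: "dim_vec ((\<Delta>F \<odot>\<^sub>m Theta F) *\<^sub>v u) = m" "dim_vec ((\<Delta>G \<odot>\<^sub>m Theta G) *\<^sub>v p) = m"
    using HF HG by simp_all
  have inv: "inverse \<alpha>\<^sub>2 * \<alpha>\<^sub>2 = 1" "(- inverse \<alpha>\<^sub>2) * \<alpha>\<^sub>2 = -1" "inverse \<alpha>\<^sub>3 * \<alpha>\<^sub>3 = 1" "(- inverse \<alpha>\<^sub>3) * \<alpha>\<^sub>3 = -1"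
    using pos by simp_all
  note S = Sigma_row_one_carrier[OF _ F] Sigma_row_one_carrier[OF _ G]
  note col4 = append_cols4_mult_vec[OF S(1) S(1) S(2) S(2) vc]
  note blk = append_cols4_carrier[OF S(1) S(1) S(2) S(2)]
  note r = real_parts_carrier
  have ReS: "map_vec Re v = map_vec Re ((\<Delta>F \<odot>\<^sub>m Theta F) *\<^sub>v u) + map_vec Re ((\<Delta>G \<odot>\<^sub>m Theta G) *\<^sub>v p)"
    and ImS: "map_vec Im v = map_vec Im ((\<Delta>F \<odot>\<^sub>m Theta F) *\<^sub>v u) + map_vec Im ((\<Delta>G \<odot>\<^sub>m Theta G) *\<^sub>v p)"
    unfolding v_def using vdim by (auto intro!: eq_vecI)
  have top: "1 \<cdot>\<^sub>v (?FR *\<^sub>v ru) + ((-1) \<cdot>\<^sub>v (?FI *\<^sub>v iu) +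
      (1 \<cdot>\<^sub>v (?GR *\<^sub>v rp) + (-1) \<cdot>\<^sub>v (?GI *\<^sub>v ip))) = map_vec Re v"
    unfolding ReS Re_mult_mat_vec[OF HF u] Re_mult_mat_vec[OF HG p]
      map_mat_hadamard_Theta[OF \<Delta>F F] map_mat_hadamard_Theta[OF \<Delta>G G]
    using carrier_matD[OF Hc(1)] carrier_matD[OF Hc(2)] carrier_matD[OF Hc(3)] carrier_matD[OF Hc(4)]
    by (intro eq_vecI) simp_all
  have bot: "1 \<cdot>\<^sub>v (?FR *\<^sub>v iu) + (1 \<cdot>\<^sub>v (?FI *\<^sub>v ru) +
      (1 \<cdot>\<^sub>v (?GR *\<^sub>v ip) + 1 \<cdot>\<^sub>v (?GI *\<^sub>v rp))) = map_vec Im v"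
    unfolding ImS Im_mult_mat_vec[OF HF u] Im_mult_mat_vec[OF HG p]
      map_mat_hadamard_Theta[OF \<Delta>F F] map_mat_hadamard_Theta[OF \<Delta>G G]
    using carrier_matD[OF Hc(1)] carrier_matD[OF Hc(2)] carrier_matD[OF Hc(3)] carrier_matD[OF Hc(4)]
    by (intro eq_vecI) simp_all
  have xc: "\<alpha>\<^sub>2 \<cdot>\<^sub>v vec_of_mat (map_mat Re \<Delta>F) @\<^sub>v \<alpha>\<^sub>2 \<cdot>\<^sub>v vec_of_mat (map_mat Im \<Delta>F) @\<^sub>v
      \<alpha>\<^sub>3 \<cdot>\<^sub>v vec_of_mat (map_mat Re \<Delta>G) @\<^sub>v \<alpha>\<^sub>3 \<cdot>\<^sub>v vec_of_mat (map_mat Im \<Delta>G)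
      \<in> carrier_vec (n * m + (n * m + (m * m + m * m)))"
    by (intro append_carrier_vec vc)
  show ?thesis
    unfolding lower_block_def mat_mult_append[OF blk[OF r(1) r(2) r(3) r(4)] blk[OF r(2) r(1) r(4) r(3)] xc]
      col4[OF r(1) r(2) r(3) r(4)] col4[OF r(2) r(1) r(4) r(3)]
      Sigma_row_one_term[OF r(1) F Fc(1)] Sigma_row_one_term[OF r(2) F Fc(1)]
      Sigma_row_one_term[OF r(1) F Fc(2)] Sigma_row_one_term[OF r(2) F Fc(2)]
      Sigma_row_one_term[OF r(3) G Gc(1)] Sigma_row_one_term[OF r(4) G Gc(1)]
      Sigma_row_one_term[OF r(3) G Gc(2)] Sigma_row_one_term[OF r(4) G Gc(2)]
      inv top bot ..
qed

lemma coords_blocks_carrier: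
  assumes "\<Delta>E \<in> carrier_mat n n" "\<Delta>F \<in> carrier_mat m n" "\<Delta>G \<in> carrier_mat m m"
    "\<Delta>q \<in> carrier_vec n" "\<Delta>r \<in> carrier_vec m"
  shows "sym_coords 0 (map_mat Re \<Delta>E) \<in> carrier_vec len0" "sym_coords 1 (map_mat Im \<Delta>E) \<in> carrier_vec len1"
    "\<alpha>\<^sub>2 \<cdot>\<^sub>v vec_of_mat (map_mat Re \<Delta>F) \<in> carrier_vec (n * m)"
    "\<alpha>\<^sub>2 \<cdot>\<^sub>v vec_of_mat (map_mat Im \<Delta>F) \<in> carrier_vec (n * m)"
    "\<alpha>\<^sub>3 \<cdot>\<^sub>v vec_of_mat (map_mat Re \<Delta>G) \<in> carrier_vec (m * m)"
    "\<alpha>\<^sub>3 \<cdot>\<^sub>v vec_of_mat (map_mat Im \<Delta>G) \<in> carrier_vec (m * m)"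
    "\<beta>\<^sub>1 \<cdot>\<^sub>v map_vec Re \<Delta>q \<in> carrier_vec n" "\<beta>\<^sub>1 \<cdot>\<^sub>v map_vec Im \<Delta>q \<in> carrier_vec n"
    "\<beta>\<^sub>2 \<cdot>\<^sub>v map_vec Re \<Delta>r \<in> carrier_vec m" "\<beta>\<^sub>2 \<cdot>\<^sub>v map_vec Im \<Delta>r \<in> carrier_vec m"
  by (intro sym_coords_carrier smult_carrier_vec[THEN iffD2] vec_of_mat_carrier map_carrier_vec[THEN iffD2]
      map_carrier_mat[THEN iffD2] assms)+

text \<open>Bracketed as the width of the left block column of \<open>system_mat\<close> plus that
  of the right one, the form in which the block matrix rules produce it.\<close>

abbreviation coords_dim where
  "coords_dim \<equiv> n\<^sup>2 + 2 * m * n + 2 * m\<^sup>2 + (2 * n + 2 * m)"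

lemma coords_dim_eq:
  "len0 + (len1 + (n * m + (n * m + (m * m + (m * m + (n + (n + (m + m)))))))) = coords_dim"
  using length_lower_positions_add[of n] by (simp add: power2_eq_square)

lemma coords_carrier:
  assumes "\<Delta>E \<in> carrier_mat n n" "\<Delta>F \<in> carrier_mat m n" "\<Delta>G \<in> carrier_mat m m"
    "\<Delta>q \<in> carrier_vec n" "\<Delta>r \<in> carrier_vec m"
  shows "coords \<Delta>E \<Delta>F \<Delta>G \<Delta>q \<Delta>r \<in> carrier_vec coords_dim"
  unfolding coords_def coords_dim_eq[symmetric]
  by (intro append_carrier_vec coords_blocks_carrier[OF assms])

lemma system_mat_blocks_carrier:
  "upper_block @\<^sub>c 0\<^sub>m (2 * n) (2 * m\<^sup>2) \<in> carrier_mat (2 * n) (n\<^sup>2 + 2 * m * n + 2 * m\<^sup>2)"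
  "(- inverse \<beta>\<^sub>1) \<cdot>\<^sub>m 1\<^sub>m (2 * n) @\<^sub>c 0\<^sub>m (2 * n) (2 * m) \<in> carrier_mat (2 * n) (2 * n + 2 * m)"
  "0\<^sub>m (2 * m) (n\<^sup>2) @\<^sub>c lower_block \<in> carrier_mat (2 * m) (n\<^sup>2 + 2 * m * n + 2 * m\<^sup>2)"
  "0\<^sub>m (2 * m) (2 * n) @\<^sub>c (- inverse \<beta>\<^sub>2) \<cdot>\<^sub>m 1\<^sub>m (2 * m) \<in> carrier_mat (2 * m) (2 * n + 2 * m)"
     apply (intro append_cols_carrier upper_block_carrier zero_carrier_mat)
    apply (intro append_cols_carrier smult_carrier_mat one_carrier_mat zero_carrier_mat)
   apply (unfold add.assoc, intro append_cols_carrier lower_block_carrier zero_carrier_mat)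
  apply (intro append_cols_carrier smult_carrier_mat one_carrier_mat zero_carrier_mat)
  done

lemma system_mat_carrier: "system_mat \<in> carrier_mat (2 * n + 2 * m) coords_dim"
  unfolding system_mat_def
  by (rule four_block_carrier_mat[OF system_mat_blocks_carrier(1,4)])

text \<open>The masks sit inside the matrix, so the residual of the sparsified perturbation appears
  although the coordinates are those of the original one.\<close>

lemma system_mat_mult_vec:
  assumes \<Delta>E: "\<Delta>E \<in> carrier_mat n n" "mat_adjoint \<Delta>E = \<Delta>E" and \<Delta>F: "\<Delta>F \<in> carrier_mat m n"
    and \<Delta>G: "\<Delta>G \<in> carrier_mat m m" and \<Delta>q: "\<Delta>q \<in> carrier_vec n" and \<Delta>r: "\<Delta>r \<in> carrier_vec m"
  defines "v \<equiv> (\<Delta>E \<odot>\<^sub>m Theta E) *\<^sub>v u + mat_adjoint (\<Delta>F \<odot>\<^sub>m Theta F) *\<^sub>v p - \<Delta>q"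
    and "v' \<equiv> (\<Delta>F \<odot>\<^sub>m Theta F) *\<^sub>v u + (\<Delta>G \<odot>\<^sub>m Theta G) *\<^sub>v p - \<Delta>r"
  shows "system_mat *\<^sub>v coords \<Delta>E \<Delta>F \<Delta>G \<Delta>q \<Delta>r
    = map_vec Re v @\<^sub>v map_vec Im v @\<^sub>v map_vec Re v' @\<^sub>v map_vec Im v'"
proof -
  note bc = coords_blocks_carrier[OF \<Delta>E(1) \<Delta>F \<Delta>G \<Delta>q \<Delta>r]
  define a where "a = sym_coords 0 (map_mat Re \<Delta>E)"
  define b where "b = sym_coords 1 (map_mat Im \<Delta>E)"
  define c where "c = \<alpha>\<^sub>2 \<cdot>\<^sub>v vec_of_mat (map_mat Re \<Delta>F)"
  define d where "d = \<alpha>\<^sub>2 \<cdot>\<^sub>v vec_of_mat (map_mat Im \<Delta>F)"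
  define e where "e = \<alpha>\<^sub>3 \<cdot>\<^sub>v vec_of_mat (map_mat Re \<Delta>G)"
  define f where "f = \<alpha>\<^sub>3 \<cdot>\<^sub>v vec_of_mat (map_mat Im \<Delta>G)"
  define g where "g = \<beta>\<^sub>1 \<cdot>\<^sub>v map_vec Re \<Delta>q"
  define h where "h = \<beta>\<^sub>1 \<cdot>\<^sub>v map_vec Im \<Delta>q"
  define i where "i = \<beta>\<^sub>2 \<cdot>\<^sub>v map_vec Re \<Delta>r"
  define j where "j = \<beta>\<^sub>2 \<cdot>\<^sub>v map_vec Im \<Delta>r"
  note bc = bc[folded a_def b_def c_def d_def e_def f_def g_def h_def i_def j_def]
  note dims = carrier_vecD[OF bc(1)] carrier_vecD[OF bc(2)] carrier_vecD[OF bc(3)] carrier_vecD[OF bc(4)]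
    carrier_vecD[OF bc(5)] carrier_vecD[OF bc(6)] carrier_vecD[OF bc(7)] carrier_vecD[OF bc(8)]
    carrier_vecD[OF bc(9)] carrier_vecD[OF bc(10)]
  have ab: "a @\<^sub>v b \<in> carrier_vec (n\<^sup>2)"
    using length_lower_positions_add[of n] by (intro carrier_vecI) (simp add: dims)
  have abcd: "a @\<^sub>v b @\<^sub>v c @\<^sub>v d \<in> carrier_vec (n\<^sup>2 + 2 * m * n)"
    using length_lower_positions_add[of n] by (intro carrier_vecI) (simp add: dims)
  have ef: "e @\<^sub>v f \<in> carrier_vec (2 * m\<^sup>2)"
    by (intro carrier_vecI) (simp add: dims power2_eq_square)
  have cdef: "c @\<^sub>v d @\<^sub>v e @\<^sub>v f \<in> carrier_vec (2 * m * n + 2 * m\<^sup>2)"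
    by (intro carrier_vecI) (simp add: dims power2_eq_square)
  have abcdef: "(a @\<^sub>v b @\<^sub>v c @\<^sub>v d) @\<^sub>v (e @\<^sub>v f) \<in> carrier_vec (n\<^sup>2 + 2 * m * n + 2 * m\<^sup>2)"
    by (rule append_carrier_vec[OF abcd ef])
  have gh: "g @\<^sub>v h \<in> carrier_vec (2 * n)" and ij: "i @\<^sub>v j \<in> carrier_vec (2 * m)"
    by (intro carrier_vecI, simp add: dims)+
  have ghij: "(g @\<^sub>v h) @\<^sub>v (i @\<^sub>v j) \<in> carrier_vec (2 * n + 2 * m)"
    by (rule append_carrier_vec[OF gh ij])
  have coords: "coords \<Delta>E \<Delta>F \<Delta>G \<Delta>q \<Delta>r
      = ((a @\<^sub>v b @\<^sub>v c @\<^sub>v d) @\<^sub>v (e @\<^sub>v f)) @\<^sub>v ((g @\<^sub>v h) @\<^sub>v (i @\<^sub>v j))"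
    unfolding coords_def a_def b_def c_def d_def e_def f_def g_def h_def i_def j_def append_vec_assoc ..
  \<comment> \<open>The two \<open>F\<close> blocks \<open>c\<close> and \<open>d\<close> are
    shared: they end the part seen by \<open>upper_block\<close> and begin the part seen by
    \<open>lower_block\<close>. Hence the two block rows need different bracketings of the same
    vector.\<close>
  have regroup: "(a @\<^sub>v b @\<^sub>v c @\<^sub>v d) @\<^sub>v (e @\<^sub>v f) = (a @\<^sub>v b) @\<^sub>v (c @\<^sub>v d @\<^sub>v e @\<^sub>v f)"
    unfolding append_vec_assoc ..
  define x where "x = (\<Delta>E \<odot>\<^sub>m Theta E) *\<^sub>v u + mat_adjoint (\<Delta>F \<odot>\<^sub>m Theta F) *\<^sub>v p"
  define y where "y = (\<Delta>F \<odot>\<^sub>m Theta F) *\<^sub>v u + (\<Delta>G \<odot>\<^sub>m Theta G) *\<^sub>v p"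
  have x: "dim_vec x = n" unfolding x_def
    using mat_adjoint_carrier[OF hadamard_mat_carrier[OF \<Delta>F, of "Theta F"]] by simp
  have y: "dim_vec y = m" unfolding y_def using hadamard_mat_carrier[OF \<Delta>G, of "Theta G"] by simp
  have upper: "upper_block *\<^sub>v (a @\<^sub>v b @\<^sub>v c @\<^sub>v d) = map_vec Re x @\<^sub>v map_vec Im x"
    unfolding a_def b_def c_def d_def x_def by (rule upper_block_mult_vec[OF \<Delta>E \<Delta>F])
  have lower: "lower_block *\<^sub>v (c @\<^sub>v d @\<^sub>v e @\<^sub>v f) = map_vec Re y @\<^sub>v map_vec Im y"
    unfolding c_def d_def e_def f_def y_def by (rule lower_block_mult_vec[OF \<Delta>F \<Delta>G])
  have z: "((- inverse \<beta>\<^sub>1) \<cdot>\<^sub>m 1\<^sub>m (2 * n)) *\<^sub>v (g @\<^sub>v h) = (- inverse \<beta>\<^sub>1) \<cdot>\<^sub>v (g @\<^sub>v h)"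
    "((- inverse \<beta>\<^sub>2) \<cdot>\<^sub>m 1\<^sub>m (2 * m)) *\<^sub>v (i @\<^sub>v j) = (- inverse \<beta>\<^sub>2) \<cdot>\<^sub>v (i @\<^sub>v j)"
    unfolding smult_mat_mult_vec[OF one_carrier_mat gh] smult_mat_mult_vec[OF one_carrier_mat ij]
      one_mult_mat_vec[OF gh] one_mult_mat_vec[OF ij] by (rule refl)+
  note sc = one_carrier_mat[THEN smult_carrier_mat]
  have top: "(upper_block @\<^sub>c 0\<^sub>m (2 * n) (2 * m\<^sup>2)) *\<^sub>v ((a @\<^sub>v b @\<^sub>v c @\<^sub>v d) @\<^sub>v (e @\<^sub>v f))
    + ((- inverse \<beta>\<^sub>1) \<cdot>\<^sub>m 1\<^sub>m (2 * n) @\<^sub>c 0\<^sub>m (2 * n) (2 * m)) *\<^sub>v ((g @\<^sub>v h) @\<^sub>v (i @\<^sub>v j))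
    = map_vec Re v @\<^sub>v map_vec Im v"
    unfolding append_cols_mult_vec[OF upper_block_carrier zero_carrier_mat abcd ef]
      append_cols_mult_vec[OF sc zero_carrier_mat gh ij] z zero_mat_mult_vec[OF ef] zero_mat_mult_vec[OF ij]
      upper v_def x_def[symmetric]
  proof (rule eq_vecI)
    fix k assume "k < dim_vec (map_vec Re (x - \<Delta>q) @\<^sub>v map_vec Im (x - \<Delta>q))"
    then have "k < n + n" using \<Delta>q by simp
    then show "((map_vec Re x @\<^sub>v map_vec Im x) + 0\<^sub>v (2 * n) + (- inverse \<beta>\<^sub>1 \<cdot>\<^sub>v (g @\<^sub>v h) + 0\<^sub>v (2 * n))) $ k
      = (map_vec Re (x - \<Delta>q) @\<^sub>v map_vec Im (x - \<Delta>q)) $ k"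
      using x \<Delta>q pos by (simp add: g_def h_def)
  qed (use x \<Delta>q in \<open>simp add: g_def h_def\<close>)
  have bot: "(0\<^sub>m (2 * m) (n\<^sup>2) @\<^sub>c lower_block) *\<^sub>v ((a @\<^sub>v b @\<^sub>v c @\<^sub>v d) @\<^sub>v (e @\<^sub>v f))
    + (0\<^sub>m (2 * m) (2 * n) @\<^sub>c (- inverse \<beta>\<^sub>2) \<cdot>\<^sub>m 1\<^sub>m (2 * m)) *\<^sub>v ((g @\<^sub>v h) @\<^sub>v (i @\<^sub>v j))
    = map_vec Re v' @\<^sub>v map_vec Im v'"
    unfolding regroup append_cols_mult_vec[OF zero_carrier_mat lower_block_carrier ab cdef]
      append_cols_mult_vec[OF zero_carrier_mat sc gh ij] z zero_mat_mult_vec[OF ab] zero_mat_mult_vec[OF gh]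
      lower v'_def y_def[symmetric]
  proof (rule eq_vecI)
    fix k assume "k < dim_vec (map_vec Re (y - \<Delta>r) @\<^sub>v map_vec Im (y - \<Delta>r))"
    then have "k < m + m" using \<Delta>r by simp
    then show "(0\<^sub>v (2 * m) + (map_vec Re y @\<^sub>v map_vec Im y) + (0\<^sub>v (2 * m) + - inverse \<beta>\<^sub>2 \<cdot>\<^sub>v (i @\<^sub>v j))) $ k
      = (map_vec Re (y - \<Delta>r) @\<^sub>v map_vec Im (y - \<Delta>r)) $ k"
      using y \<Delta>r pos by (simp add: i_def j_def)
  qed (use y \<Delta>r in \<open>simp add: i_def j_def\<close>)
  show ?thesis
    unfolding coords system_mat_def
      four_block_mat_mult_vec[OF system_mat_blocks_carrier abcdef ghij] top bot
    by (rule append_vec_assoc)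
qed

section \<open>From the constraint set and the norm to the linear system\<close>

lemma admissibleD:
  assumes "(\<Delta>E, \<Delta>F, \<Delta>G, \<Delta>q, \<Delta>r) \<in> admissible"
  shows "\<Delta>E \<in> carrier_mat n n" "mat_adjoint \<Delta>E = \<Delta>E" "\<Delta>F \<in> carrier_mat m n" "\<Delta>G \<in> carrier_mat m m"
    "\<Delta>q \<in> carrier_vec n" "\<Delta>r \<in> carrier_vec m"
  using assms unfolding admissible_def by blast+

lemma admissible_parity_sym:
  assumes "(\<Delta>E, \<Delta>F, \<Delta>G, \<Delta>q, \<Delta>r) \<in> admissible"
  shows "parity_sym 0 n (map_mat Re \<Delta>E)" "parity_sym 1 n (map_mat Im \<Delta>E)"
  using hermitian_iff_parity_sym[OF admissibleD(1)[OF assms]] admissibleD(2)[OF assms] by blast+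

text \<open>The unperturbed products move to the right, where they form the residuals
  \<open>Q\<close> and \<open>R\<close>; what remains on the left is linear in the
  perturbation.\<close>

lemma G1_iff:
  assumes q: "q \<in> carrier_vec n" and r: "r \<in> carrier_vec m"
  shows "(\<Delta>E, \<Delta>F, \<Delta>G, \<Delta>q, \<Delta>r) \<in> G1 E F G q r u p \<longleftrightarrow>
    (\<Delta>E, \<Delta>F, \<Delta>G, \<Delta>q, \<Delta>r) \<in> admissible \<and>
    \<Delta>E *\<^sub>v u + mat_adjoint \<Delta>F *\<^sub>v p - \<Delta>q = q - E *\<^sub>v u - mat_adjoint F *\<^sub>v p \<and>
    \<Delta>F *\<^sub>v u + \<Delta>G *\<^sub>v p - \<Delta>r = r - F *\<^sub>v u - G *\<^sub>v p"
proof -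
  have dims: "dim_row E = n" "dim_row G = m" using E G by auto
  have "(\<Delta>E, \<Delta>F, \<Delta>G, \<Delta>q, \<Delta>r) \<in> G1 E F G q r u p \<longleftrightarrow>
    (\<Delta>E, \<Delta>F, \<Delta>G, \<Delta>q, \<Delta>r) \<in> admissible \<and>
    four_block_mat (E + \<Delta>E) (mat_adjoint (F + \<Delta>F)) (F + \<Delta>F) (G + \<Delta>G) *\<^sub>v (u @\<^sub>v p)
          = (q + \<Delta>q) @\<^sub>v (r + \<Delta>r)"
    unfolding G1_def admissible_def Let_def dims by blast
  also have "\<dots> \<longleftrightarrow> (\<Delta>E, \<Delta>F, \<Delta>G, \<Delta>q, \<Delta>r) \<in> admissible \<and>
    \<Delta>E *\<^sub>v u + mat_adjoint \<Delta>F *\<^sub>v p - \<Delta>q = q - E *\<^sub>v u - mat_adjoint F *\<^sub>v p \<and>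
    \<Delta>F *\<^sub>v u + \<Delta>G *\<^sub>v p - \<Delta>r = r - F *\<^sub>v u - G *\<^sub>v p"
  proof (rule conj_cong[OF refl])
    assume "(\<Delta>E, \<Delta>F, \<Delta>G, \<Delta>q, \<Delta>r) \<in> admissible"
    note D = admissibleD(1,3,4,5,6)[OF this]
    note A = mat_adjoint_carrier[OF F] mat_adjoint_carrier[OF D(2)]
    have s: "E + \<Delta>E \<in> carrier_mat n n" "mat_adjoint F + mat_adjoint \<Delta>F \<in> carrier_mat n m"
      "F + \<Delta>F \<in> carrier_mat m n" "G + \<Delta>G \<in> carrier_mat m m"
      using E(1) F G D A by (simp_all add: add_carrier_mat)
    have qc: "q + \<Delta>q \<in> carrier_vec n" using q D by simp
    have c: "E *\<^sub>v u \<in> carrier_vec n" "\<Delta>E *\<^sub>v u \<in> carrier_vec n" "mat_adjoint F *\<^sub>v p \<in> carrier_vec n"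
      "mat_adjoint \<Delta>F *\<^sub>v p \<in> carrier_vec n" "F *\<^sub>v u \<in> carrier_vec m" "\<Delta>F *\<^sub>v u \<in> carrier_vec m"
      "G *\<^sub>v p \<in> carrier_vec m" "\<Delta>G *\<^sub>v p \<in> carrier_vec m"
      using E(1) F G D A u p by (auto intro!: mult_mat_vec_carrier)
    have cc: "(E *\<^sub>v u + \<Delta>E *\<^sub>v u) + (mat_adjoint F *\<^sub>v p + mat_adjoint \<Delta>F *\<^sub>v p) \<in> carrier_vec n"
      using c by simp
    show "four_block_mat (E + \<Delta>E) (mat_adjoint (F + \<Delta>F)) (F + \<Delta>F) (G + \<Delta>G) *\<^sub>v (u @\<^sub>v p)
          = (q + \<Delta>q) @\<^sub>v (r + \<Delta>r) \<longleftrightarrow>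
      \<Delta>E *\<^sub>v u + mat_adjoint \<Delta>F *\<^sub>v p - \<Delta>q = q - E *\<^sub>v u - mat_adjoint F *\<^sub>v p \<and>
      \<Delta>F *\<^sub>v u + \<Delta>G *\<^sub>v p - \<Delta>r = r - F *\<^sub>v u - G *\<^sub>v p"
      unfolding mat_adjoint_add[OF F D(2)] four_block_mat_mult_vec[OF s u p]
        add_mult_distrib_mat_vec[OF E(1) D(1) u] add_mult_distrib_mat_vec[OF A p]
        add_mult_distrib_mat_vec[OF F D(2) u] add_mult_distrib_mat_vec[OF G D(3) p]
        append_vec_eq[OF cc qc]
        residual_eq_iff[OF c(1,3,2,4) q D(4)] residual_eq_iff[OF c(5,7,6,8) r D(5)] ..
  qed
  finally show ?thesis .
qed

lemma zeta_eq_norm_coords: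
  assumes adm: "(\<Delta>E, \<Delta>F, \<Delta>G, \<Delta>q, \<Delta>r) \<in> admissible"
  shows "zeta (\<alpha>\<^sub>1, \<alpha>\<^sub>2, \<alpha>\<^sub>3, \<beta>\<^sub>1, \<beta>\<^sub>2) (\<Delta>E, \<Delta>F, \<Delta>G, \<Delta>q, \<Delta>r)
    = sqrt (coords \<Delta>E \<Delta>F \<Delta>G \<Delta>q \<Delta>r \<bullet> coords \<Delta>E \<Delta>F \<Delta>G \<Delta>q \<Delta>r)"
proof -
  note D = admissibleD[OF adm] and sym = admissible_parity_sym[OF adm]
  have Fc: "map_mat Re \<Delta>F \<in> carrier_mat m n" "map_mat Im \<Delta>F \<in> carrier_mat m n"
    and Gc: "map_mat Re \<Delta>G \<in> carrier_mat m m" "map_mat Im \<Delta>G \<in> carrier_mat m m"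
    using D by simp_all
  show ?thesis
    unfolding zeta.simps coords_def scalar_prod_self_append sym_coords_def
      norm_weight_lower_vec[OF sym(1) zero_le_one] norm_weight_lower_vec[OF sym(2) le_refl]
      norm_smult_vec_of_mat[OF Fc(1)] norm_smult_vec_of_mat[OF Fc(2)]
      norm_smult_vec_of_mat[OF Gc(1)] norm_smult_vec_of_mat[OF Gc(2)]
      frobenius_norm_sq[OF D(1)] frobenius_norm_sq[OF D(3)] frobenius_norm_sq[OF D(4)]
      two_norm_sq[symmetric] distrib_left
    by (simp only: add.assoc)
qed

section \<open>Bijectivity of the coordinates\<close>

lemma coords_eq_append_iff:
  assumes "\<Delta>E \<in> carrier_mat n n" "\<Delta>F \<in> carrier_mat m n" "\<Delta>G \<in> carrier_mat m m"
    "\<Delta>q \<in> carrier_vec n" "\<Delta>r \<in> carrier_vec m"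
    and "a \<in> carrier_vec len0" "b \<in> carrier_vec len1" "c \<in> carrier_vec (n * m)" "d \<in> carrier_vec (n * m)"
    "e \<in> carrier_vec (m * m)" "f \<in> carrier_vec (m * m)" "g \<in> carrier_vec n" "h \<in> carrier_vec n"
    "i \<in> carrier_vec m"
  shows "coords \<Delta>E \<Delta>F \<Delta>G \<Delta>q \<Delta>r = a @\<^sub>v b @\<^sub>v c @\<^sub>v d @\<^sub>v e @\<^sub>v f @\<^sub>v g @\<^sub>v h @\<^sub>v i @\<^sub>v j \<longleftrightarrow>
    sym_coords 0 (map_mat Re \<Delta>E) = a \<and> sym_coords 1 (map_mat Im \<Delta>E) = b \<and>
    \<alpha>\<^sub>2 \<cdot>\<^sub>v vec_of_mat (map_mat Re \<Delta>F) = c \<and> \<alpha>\<^sub>2 \<cdot>\<^sub>v vec_of_mat (map_mat Im \<Delta>F) = d \<and>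
    \<alpha>\<^sub>3 \<cdot>\<^sub>v vec_of_mat (map_mat Re \<Delta>G) = e \<and> \<alpha>\<^sub>3 \<cdot>\<^sub>v vec_of_mat (map_mat Im \<Delta>G) = f \<and>
    \<beta>\<^sub>1 \<cdot>\<^sub>v map_vec Re \<Delta>q = g \<and> \<beta>\<^sub>1 \<cdot>\<^sub>v map_vec Im \<Delta>q = h \<and>
    \<beta>\<^sub>2 \<cdot>\<^sub>v map_vec Re \<Delta>r = i \<and> \<beta>\<^sub>2 \<cdot>\<^sub>v map_vec Im \<Delta>r = j"
proof -
  note B = coords_blocks_carrier[OF assms(1-5)]
  show ?thesis
    unfolding coords_def append_vec_eq[OF B(1) assms(6)] append_vec_eq[OF B(2) assms(7)]
      append_vec_eq[OF B(3) assms(8)] append_vec_eq[OF B(4) assms(9)] append_vec_eq[OF B(5) assms(10)]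
      append_vec_eq[OF B(6) assms(11)] append_vec_eq[OF B(7) assms(12)] append_vec_eq[OF B(8) assms(13)]
      append_vec_eq[OF B(9) assms(14)] ..
qed

lemma sym_coords_inj:
  assumes Z: "parity_sym d n Z" and Y: "parity_sym d n Y" and d: "d \<le> 1"
    and eq: "sym_coords d Z = sym_coords d Y"
  shows "Z = Y"
proof -
  note c = lower_vec_carrier[OF parity_sym_carrier[OF Z], of d] lower_vec_carrier[OF parity_sym_carrier[OF Y], of d]
    sym_coords_carrier[OF parity_sym_carrier[OF Y], of d]
  have \<alpha>: "\<alpha>\<^sub>1 \<noteq> 0" using pos by simp
  have "lower_vec d Z = inverse \<alpha>\<^sub>1 \<cdot>\<^sub>v (mat_inv (weight_mat d n) *\<^sub>v sym_coords d Y)"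
    unfolding weight_mat_eq_iff[OF c(1,3) \<alpha>] using eq unfolding sym_coords_def .
  moreover have "lower_vec d Y = inverse \<alpha>\<^sub>1 \<cdot>\<^sub>v (mat_inv (weight_mat d n) *\<^sub>v sym_coords d Y)"
    unfolding weight_mat_eq_iff[OF c(2,3) \<alpha>] unfolding sym_coords_def ..
  ultimately show ?thesis using parity_sym_lower_vec_inj[OF Z Y d] by simp
qed

lemma sym_coords_surj:
  assumes a: "a \<in> carrier_vec (length (lower_positions d n))" and d: "d \<le> 1"
  shows "\<exists>Z. parity_sym d n Z \<and> sym_coords d Z = a"
proof -
  have "inverse \<alpha>\<^sub>1 \<cdot>\<^sub>v (mat_inv (weight_mat d n) *\<^sub>v a) \<in> carrier_vec (length (lower_positions d n))"
    using weight_mat_inv(1)[of d n] a by simp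
  from parity_sym_lower_vec_surj[OF this d] obtain Z where Z: "parity_sym d n Z"
    and eq: "lower_vec d Z = inverse \<alpha>\<^sub>1 \<cdot>\<^sub>v (mat_inv (weight_mat d n) *\<^sub>v a)" by blast
  have \<alpha>: "\<alpha>\<^sub>1 \<noteq> 0" using pos by simp
  have "sym_coords d Z = a"
    using eq unfolding weight_mat_eq_iff[OF lower_vec_carrier[OF parity_sym_carrier[OF Z]] a \<alpha>] sym_coords_def .
  with Z show ?thesis by blast
qed

lemma coords_inj:
  assumes adm: "(\<Delta>E, \<Delta>F, \<Delta>G, \<Delta>q, \<Delta>r) \<in> admissible"
    and adm': "(\<Delta>E', \<Delta>F', \<Delta>G', \<Delta>q', \<Delta>r') \<in> admissible"
    and eq: "coords \<Delta>E \<Delta>F \<Delta>G \<Delta>q \<Delta>r = coords \<Delta>E' \<Delta>F' \<Delta>G' \<Delta>q' \<Delta>r'"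
  shows "\<Delta>E = \<Delta>E' \<and> \<Delta>F = \<Delta>F' \<and> \<Delta>G = \<Delta>G' \<and> \<Delta>q = \<Delta>q' \<and> \<Delta>r = \<Delta>r'"
proof -
  note D = admissibleD(1,3,4,5,6)[OF adm] and D' = admissibleD(1,3,4,5,6)[OF adm']
  note sym = admissible_parity_sym[OF adm] and sym' = admissible_parity_sym[OF adm']
  have nz: "\<alpha>\<^sub>2 \<noteq> 0" "\<alpha>\<^sub>3 \<noteq> 0" "\<beta>\<^sub>1 \<noteq> 0" "\<beta>\<^sub>2 \<noteq> 0" using pos by auto
  have e:
    "sym_coords 0 (map_mat Re \<Delta>E) = sym_coords 0 (map_mat Re \<Delta>E')"
    "sym_coords 1 (map_mat Im \<Delta>E) = sym_coords 1 (map_mat Im \<Delta>E')"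
    "\<alpha>\<^sub>2 \<cdot>\<^sub>v vec_of_mat (map_mat Re \<Delta>F) = \<alpha>\<^sub>2 \<cdot>\<^sub>v vec_of_mat (map_mat Re \<Delta>F')"
    "\<alpha>\<^sub>2 \<cdot>\<^sub>v vec_of_mat (map_mat Im \<Delta>F) = \<alpha>\<^sub>2 \<cdot>\<^sub>v vec_of_mat (map_mat Im \<Delta>F')"
    "\<alpha>\<^sub>3 \<cdot>\<^sub>v vec_of_mat (map_mat Re \<Delta>G) = \<alpha>\<^sub>3 \<cdot>\<^sub>v vec_of_mat (map_mat Re \<Delta>G')"
    "\<alpha>\<^sub>3 \<cdot>\<^sub>v vec_of_mat (map_mat Im \<Delta>G) = \<alpha>\<^sub>3 \<cdot>\<^sub>v vec_of_mat (map_mat Im \<Delta>G')"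
    "\<beta>\<^sub>1 \<cdot>\<^sub>v map_vec Re \<Delta>q = \<beta>\<^sub>1 \<cdot>\<^sub>v map_vec Re \<Delta>q'"
    "\<beta>\<^sub>1 \<cdot>\<^sub>v map_vec Im \<Delta>q = \<beta>\<^sub>1 \<cdot>\<^sub>v map_vec Im \<Delta>q'"
    "\<beta>\<^sub>2 \<cdot>\<^sub>v map_vec Re \<Delta>r = \<beta>\<^sub>2 \<cdot>\<^sub>v map_vec Re \<Delta>r'"
    "\<beta>\<^sub>2 \<cdot>\<^sub>v map_vec Im \<Delta>r = \<beta>\<^sub>2 \<cdot>\<^sub>v map_vec Im \<Delta>r'"
    using iffD1[OF coords_eq_append_iff[OF D coords_blocks_carrier(1-9)[OF D']]
        eq[unfolded coords_def[of \<Delta>E' \<Delta>F' \<Delta>G' \<Delta>q' \<Delta>r']]] by blast+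
  have c: "map_mat Re \<Delta>F \<in> carrier_mat m n" "map_mat Im \<Delta>F \<in> carrier_mat m n"
    "map_mat Re \<Delta>F' \<in> carrier_mat m n" "map_mat Im \<Delta>F' \<in> carrier_mat m n"
    "map_mat Re \<Delta>G \<in> carrier_mat m m" "map_mat Im \<Delta>G \<in> carrier_mat m m"
    "map_mat Re \<Delta>G' \<in> carrier_mat m m" "map_mat Im \<Delta>G' \<in> carrier_mat m m"
    using D D' by simp_all
  have "\<Delta>E = \<Delta>E'"
    by (rule complex_mat_eqI[OF sym_coords_inj[OF sym(1) sym'(1) zero_le_one e(1)]
        sym_coords_inj[OF sym(2) sym'(2) le_refl e(2)]])
  moreover have "\<Delta>F = \<Delta>F'"
    by (rule complex_mat_eqI[OF vec_of_mat_inj[OF c(1,3) smult_vec_cancel[OF nz(1) e(3)]]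
        vec_of_mat_inj[OF c(2,4) smult_vec_cancel[OF nz(1) e(4)]]])
  moreover have "\<Delta>G = \<Delta>G'"
    by (rule complex_mat_eqI[OF vec_of_mat_inj[OF c(5,7) smult_vec_cancel[OF nz(2) e(5)]]
        vec_of_mat_inj[OF c(6,8) smult_vec_cancel[OF nz(2) e(6)]]])
  moreover have "\<Delta>q = \<Delta>q'"
    by (rule complex_vec_eqI[OF smult_vec_cancel[OF nz(3) e(7)] smult_vec_cancel[OF nz(3) e(8)]])
  moreover have "\<Delta>r = \<Delta>r'"
    by (rule complex_vec_eqI[OF smult_vec_cancel[OF nz(4) e(9)] smult_vec_cancel[OF nz(4) e(10)]])
  ultimately show ?thesis by blast
qed

text \<open>Each block is lifted separately. The two triangular blocks lift to a symmetric and a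
  skew-symmetric matrix, and the complex matrix with these parts is Hermitian.\<close>

lemma coords_surj:
  assumes "a \<in> carrier_vec len0" "b \<in> carrier_vec len1" "c \<in> carrier_vec (n * m)" "d \<in> carrier_vec (n * m)"
    "e \<in> carrier_vec (m * m)" "f \<in> carrier_vec (m * m)" "g \<in> carrier_vec n" "h \<in> carrier_vec n"
    "i \<in> carrier_vec m" "j \<in> carrier_vec m"
  shows "\<exists>\<Delta>E \<Delta>F \<Delta>G \<Delta>q \<Delta>r. (\<Delta>E, \<Delta>F, \<Delta>G, \<Delta>q, \<Delta>r) \<in> admissible \<and>
    coords \<Delta>E \<Delta>F \<Delta>G \<Delta>q \<Delta>r = a @\<^sub>v b @\<^sub>v c @\<^sub>v d @\<^sub>v e @\<^sub>v f @\<^sub>v g @\<^sub>v h @\<^sub>v i @\<^sub>v j"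
proof -
  have nz: "\<alpha>\<^sub>2 \<noteq> 0" "\<alpha>\<^sub>3 \<noteq> 0" "\<beta>\<^sub>1 \<noteq> 0" "\<beta>\<^sub>2 \<noteq> 0" using pos by auto
  obtain ER where ER: "parity_sym 0 n ER" "sym_coords 0 ER = a"
    using sym_coords_surj[OF assms(1) zero_le_one] by blast
  obtain EI where EI: "parity_sym 1 n EI" "sym_coords 1 EI = b"
    using sym_coords_surj[OF assms(2) le_refl] by blast
  obtain \<Delta>E where \<Delta>E: "\<Delta>E \<in> carrier_mat n n" "map_mat Re \<Delta>E = ER" "map_mat Im \<Delta>E = EI"
    using complex_mat_of_parts[OF parity_sym_carrier[OF ER(1)] parity_sym_carrier[OF EI(1)]] by blast
  have herm: "mat_adjoint \<Delta>E = \<Delta>E" unfolding hermitian_iff_parity_sym[OF \<Delta>E(1)] \<Delta>E using ER EI by blast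
  obtain FR where FR: "FR \<in> carrier_mat m n" "\<alpha>\<^sub>2 \<cdot>\<^sub>v vec_of_mat FR = c"
    using scaled_vec_of_mat_surj[OF assms(3) nz(1)] by blast
  obtain FI where FI: "FI \<in> carrier_mat m n" "\<alpha>\<^sub>2 \<cdot>\<^sub>v vec_of_mat FI = d"
    using scaled_vec_of_mat_surj[OF assms(4) nz(1)] by blast
  obtain \<Delta>F where \<Delta>F: "\<Delta>F \<in> carrier_mat m n" "map_mat Re \<Delta>F = FR" "map_mat Im \<Delta>F = FI"
    using complex_mat_of_parts[OF FR(1) FI(1)] by blast
  obtain GR where GR: "GR \<in> carrier_mat m m" "\<alpha>\<^sub>3 \<cdot>\<^sub>v vec_of_mat GR = e"
    using scaled_vec_of_mat_surj[OF assms(5) nz(2)] by blast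
  obtain GI where GI: "GI \<in> carrier_mat m m" "\<alpha>\<^sub>3 \<cdot>\<^sub>v vec_of_mat GI = f"
    using scaled_vec_of_mat_surj[OF assms(6) nz(2)] by blast
  obtain \<Delta>G where \<Delta>G: "\<Delta>G \<in> carrier_mat m m" "map_mat Re \<Delta>G = GR" "map_mat Im \<Delta>G = GI"
    using complex_mat_of_parts[OF GR(1) GI(1)] by blast
  obtain \<Delta>q where \<Delta>q: "\<Delta>q \<in> carrier_vec n" "\<beta>\<^sub>1 \<cdot>\<^sub>v map_vec Re \<Delta>q = g" "\<beta>\<^sub>1 \<cdot>\<^sub>v map_vec Im \<Delta>q = h"
    using complex_vec_of_scaled_parts[OF assms(7,8) nz(3)] by blast
  obtain \<Delta>r where \<Delta>r: "\<Delta>r \<in> carrier_vec m" "\<beta>\<^sub>2 \<cdot>\<^sub>v map_vec Re \<Delta>r = i" "\<beta>\<^sub>2 \<cdot>\<^sub>v map_vec Im \<Delta>r = j"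
    using complex_vec_of_scaled_parts[OF assms(9,10) nz(4)] by blast
  have "(\<Delta>E, \<Delta>F, \<Delta>G, \<Delta>q, \<Delta>r) \<in> admissible"
    unfolding admissible_def using \<Delta>E(1) herm \<Delta>F(1) \<Delta>G(1) \<Delta>q(1) \<Delta>r(1) by blast
  moreover have "coords \<Delta>E \<Delta>F \<Delta>G \<Delta>q \<Delta>r = a @\<^sub>v b @\<^sub>v c @\<^sub>v d @\<^sub>v e @\<^sub>v f @\<^sub>v g @\<^sub>v h @\<^sub>v i @\<^sub>v j"
    unfolding coords_def \<Delta>E(2,3) \<Delta>F(2,3) \<Delta>G(2,3) ER(2) EI(2) FR(2) FI(2) GR(2) GI(2) \<Delta>q(2,3) \<Delta>r(2,3) ..
  ultimately show ?thesis by blast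
qed

section \<open>Solvability and optimality\<close>

lemma sparsify_admissible:
  assumes adm: "(\<Delta>E, \<Delta>F, \<Delta>G, \<Delta>q, \<Delta>r) \<in> admissible"
  shows "(\<Delta>E \<odot>\<^sub>m Theta E, \<Delta>F \<odot>\<^sub>m Theta F, \<Delta>G \<odot>\<^sub>m Theta G, \<Delta>q, \<Delta>r) \<in> admissible"
proof -
  note D = admissibleD[OF adm] and sym = admissible_parity_sym[OF adm]
  note c = hadamard_mat_carrier[OF D(1), of "Theta E"] hadamard_mat_carrier[OF D(3), of "Theta F"]
    hadamard_mat_carrier[OF D(4), of "Theta G"]
  have "mat_adjoint (\<Delta>E \<odot>\<^sub>m Theta E) = \<Delta>E \<odot>\<^sub>m Theta E"
    unfolding hermitian_iff_parity_sym[OF c(1)] map_mat_hadamard_Theta[OF D(1) E(1)]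
    using parity_sym_hadamard[OF sym(1) Theta_symmetric[OF E]] parity_sym_hadamard[OF sym(2) Theta_symmetric[OF E]]
    by blast
  then show ?thesis using c D unfolding admissible_def by blast
qed

text \<open>Perturbing the right-hand side alone reaches every target: with zero matrix
  perturbations the image consists of the parts of \<open>- \<Delta>q\<close> and
  \<open>- \<Delta>r\<close>, hence the scaling by -1 in the choice of the witnesses.\<close>

lemma system_mat_surj:
  assumes z: "z \<in> carrier_vec (2 * n + 2 * m)"
  shows "\<exists>x \<in> carrier_vec coords_dim. system_mat *\<^sub>v x = z"
proof -
  have "z \<in> carrier_vec (n + (n + (m + m)))" using z by (simp add: mult_2 add.assoc)
  then obtain z1 z' where z1: "z1 \<in> carrier_vec n" and z': "z' \<in> carrier_vec (n + (m + m))" "z = z1 @\<^sub>v z'"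
    by (rule append_vec_split)
  from z'(1) obtain z2 z'' where z2: "z2 \<in> carrier_vec n" and z'': "z'' \<in> carrier_vec (m + m)" "z' = z2 @\<^sub>v z''"
    by (rule append_vec_split)
  from z''(1) obtain z3 z4 where z34: "z3 \<in> carrier_vec m" "z4 \<in> carrier_vec m" "z'' = z3 @\<^sub>v z4"
    by (rule append_vec_split)
  have m1: "(-1 :: real) \<noteq> 0" by simp
  obtain \<Delta>q where \<Delta>q: "\<Delta>q \<in> carrier_vec n" "(-1) \<cdot>\<^sub>v map_vec Re \<Delta>q = z1" "(-1) \<cdot>\<^sub>v map_vec Im \<Delta>q = z2"
    using complex_vec_of_scaled_parts[OF z1 z2 m1] by blast
  obtain \<Delta>r where \<Delta>r: "\<Delta>r \<in> carrier_vec m" "(-1) \<cdot>\<^sub>v map_vec Re \<Delta>r = z3" "(-1) \<cdot>\<^sub>v map_vec Im \<Delta>r = z4"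
    using complex_vec_of_scaled_parts[OF z34(1,2) m1] by blast
  let ?E = "0\<^sub>m n n :: complex mat" and ?F = "0\<^sub>m m n :: complex mat" and ?G = "0\<^sub>m m m :: complex mat"
  have adj: "mat_adjoint (0\<^sub>m j k :: complex mat) = 0\<^sub>m k j" for j k
    using mat_adjoint_carrier[of "0\<^sub>m j k :: complex mat" j k]
    by (intro eq_matI) (auto simp: mat_adjoint_index[of _ j k])
  have had: "0\<^sub>m j k \<odot>\<^sub>m B = (0\<^sub>m j k :: complex mat)" for j k B
    by (rule eq_matI) (auto simp: hadamard_mat_def)
  have "system_mat *\<^sub>v coords ?E ?F ?G \<Delta>q \<Delta>r
    = map_vec Re ((?E \<odot>\<^sub>m Theta E) *\<^sub>v u + mat_adjoint (?F \<odot>\<^sub>m Theta F) *\<^sub>v p - \<Delta>q) @\<^sub>v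
      map_vec Im ((?E \<odot>\<^sub>m Theta E) *\<^sub>v u + mat_adjoint (?F \<odot>\<^sub>m Theta F) *\<^sub>v p - \<Delta>q) @\<^sub>v
      map_vec Re ((?F \<odot>\<^sub>m Theta F) *\<^sub>v u + (?G \<odot>\<^sub>m Theta G) *\<^sub>v p - \<Delta>r) @\<^sub>v
      map_vec Im ((?F \<odot>\<^sub>m Theta F) *\<^sub>v u + (?G \<odot>\<^sub>m Theta G) *\<^sub>v p - \<Delta>r)"
    by (rule system_mat_mult_vec[OF zero_carrier_mat adj zero_carrier_mat zero_carrier_mat \<Delta>q(1) \<Delta>r(1)])
  also have "\<dots> = z"
    unfolding had adj zero_mat_mult_vec[OF u] zero_mat_mult_vec[OF p] z'(2) z''(2) z34(3)
      \<Delta>q(2,3)[symmetric] \<Delta>r(2,3)[symmetric]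
    using \<Delta>q(1) \<Delta>r(1) by (intro arg_cong2[where f = append_vec] eq_vecI) auto
  finally have "system_mat *\<^sub>v coords ?E ?F ?G \<Delta>q \<Delta>r = z" .
  moreover have "coords ?E ?F ?G \<Delta>q \<Delta>r \<in> carrier_vec coords_dim"
    by (rule coords_carrier[OF zero_carrier_mat zero_carrier_mat zero_carrier_mat \<Delta>q(1) \<Delta>r(1)])
  ultimately show ?thesis by blast
qed

lemma optimal_sps_if_least_norm:
  assumes q: "q \<in> carrier_vec n" and r: "r \<in> carrier_vec m"
  defines "Q \<equiv> q - E *\<^sub>v u - mat_adjoint F *\<^sub>v p" and "R \<equiv> r - F *\<^sub>v u - G *\<^sub>v p"
  assumes w: "w = (transpose_mat system_mat * mat_inv (system_mat * transpose_mat system_mat)) *\<^sub>v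
      (map_vec Re Q @\<^sub>v map_vec Im Q @\<^sub>v map_vec Re R @\<^sub>v map_vec Im R)"
    and adm: "(\<Delta>E, \<Delta>F, \<Delta>G, \<Delta>q, \<Delta>r) \<in> admissible"
    and coords_w: "coords \<Delta>E \<Delta>F \<Delta>G \<Delta>q \<Delta>r = w"
  shows "optimal_sps (\<alpha>\<^sub>1, \<alpha>\<^sub>2, \<alpha>\<^sub>3, \<beta>\<^sub>1, \<beta>\<^sub>2) E F G q r u p (\<Delta>E, \<Delta>F, \<Delta>G, \<Delta>q, \<Delta>r)"
proof -
  let ?\<sigma> = "(\<alpha>\<^sub>1, \<alpha>\<^sub>2, \<alpha>\<^sub>3, \<beta>\<^sub>1, \<beta>\<^sub>2)"
  let ?b = "map_vec Re Q @\<^sub>v map_vec Im Q @\<^sub>v map_vec Re R @\<^sub>v map_vec Im R"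
  have dQ: "dim_vec Q = n" and dR: "dim_vec R = m"
    unfolding Q_def R_def using mat_adjoint_carrier[OF F] G by simp_all
  have b: "?b \<in> carrier_vec (2 * n + 2 * m)" by (rule carrier_vecI) (simp add: dQ dR)
  have surj: "\<forall>z \<in> carrier_vec (2 * n + 2 * m). \<exists>x \<in> carrier_vec coords_dim. system_mat *\<^sub>v x = z"
    using system_mat_surj by blast
  note least = least_norm_solution[OF system_mat_carrier b surj w]
  have norm_le: "w \<bullet> w \<le> x \<bullet> x" if "x \<in> carrier_vec coords_dim" "system_mat *\<^sub>v x = ?b" for x
    using least(3)[OF that] scalar_prod_self_ge_0[of "x - w"] by linarith
  \<comment> \<open>\<open>system_mat\<close> sees only the sparsified tuple, so the constraint
    falls on \<open>sparsify\<close> of the tuple, just as in the definition of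
    \<open>xi_sps\<close>.\<close>
  have solves: "system_mat *\<^sub>v coords XE XF XG xq xr = ?b
      \<longleftrightarrow> sparsify E F G (XE, XF, XG, xq, xr) \<in> G1 E F G q r u p"
    if a: "(XE, XF, XG, xq, xr) \<in> admissible" for XE XF XG xq xr
  proof -
    note D = admissibleD[OF a]
    let ?v = "(XE \<odot>\<^sub>m Theta E) *\<^sub>v u + mat_adjoint (XF \<odot>\<^sub>m Theta F) *\<^sub>v p - xq"
    let ?v' = "(XF \<odot>\<^sub>m Theta F) *\<^sub>v u + (XG \<odot>\<^sub>m Theta G) *\<^sub>v p - xr"
    have d: "dim_vec ?v = dim_vec Q" "dim_vec ?v' = dim_vec R" using D dQ dR by simp_all
    have "system_mat *\<^sub>v coords XE XF XG xq xr = ?b \<longleftrightarrow> ?v = Q \<and> ?v' = R"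
      unfolding system_mat_mult_vec[OF D]
      using map_vec_Re_Im_append_inj[OF d] by blast
    also have "\<dots> \<longleftrightarrow> sparsify E F G (XE, XF, XG, xq, xr) \<in> G1 E F G q r u p"
      unfolding sparsify.simps G1_iff[OF q r] Q_def R_def using sparsify_admissible[OF a] by blast
    finally show ?thesis .
  qed
  note D = admissibleD[OF adm]
  let ?E = "\<Delta>E \<odot>\<^sub>m Theta E" and ?F = "\<Delta>F \<odot>\<^sub>m Theta F" and ?G = "\<Delta>G \<odot>\<^sub>m Theta G"
  note sadm = sparsify_admissible[OF adm]
  note SD = admissibleD[OF sadm]
  have G1: "(?E, ?F, ?G, \<Delta>q, \<Delta>r) \<in> G1 E F G q r u p"
    using solves[OF adm] least(2) unfolding coords_w sparsify.simps by blast
  have sc: "coords ?E ?F ?G \<Delta>q \<Delta>r \<in> carrier_vec coords_dim" by (rule coords_carrier[OF SD(1,3-6)])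
  \<comment> \<open>Masking is idempotent, so the sparsified tuple satisfies the same system as the
    original one.\<close>
  have ssolves: "system_mat *\<^sub>v coords ?E ?F ?G \<Delta>q \<Delta>r = ?b"
    unfolding solves[OF sadm] sparsify.simps hadamard_Theta_idem[OF D(1) E(1)] hadamard_Theta_idem[OF D(3) F]
      hadamard_Theta_idem[OF D(4) G] by (rule G1)
  have "zeta ?\<sigma> (?E, ?F, ?G, \<Delta>q, \<Delta>r) \<le> zeta ?\<sigma> (\<Delta>E, \<Delta>F, \<Delta>G, \<Delta>q, \<Delta>r)"
    unfolding zeta.simps
    by (intro real_sqrt_le_mono add_mono mult_left_mono norm_hadamard_Theta_le[OF D(1) E(1)]
        norm_hadamard_Theta_le[OF D(3) F] norm_hadamard_Theta_le[OF D(4) G]) simp_all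
  then have "coords ?E ?F ?G \<Delta>q \<Delta>r \<bullet> coords ?E ?F ?G \<Delta>q \<Delta>r \<le> w \<bullet> w"
    unfolding zeta_eq_norm_coords[OF adm] zeta_eq_norm_coords[OF sadm] coords_w by simp
  \<comment> \<open>The identity in \<open>least_norm_solution\<close> leaves no room for a
    difference, since masking did not raise the norm above that of \<open>w\<close>.\<close>
  with least(3)[OF sc ssolves] scalar_prod_self_ge_0[of "coords ?E ?F ?G \<Delta>q \<Delta>r - w"]
  have "(coords ?E ?F ?G \<Delta>q \<Delta>r - w) \<bullet> (coords ?E ?F ?G \<Delta>q \<Delta>r - w) = 0" by linarith
  then have diff: "coords ?E ?F ?G \<Delta>q \<Delta>r - w = 0\<^sub>v coords_dim"
    using sc least(1) by (intro scalar_prod_self_eq_0) simp_all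
  have "coords ?E ?F ?G \<Delta>q \<Delta>r = w"
  proof (rule eq_vecI)
    show "dim_vec (coords ?E ?F ?G \<Delta>q \<Delta>r) = dim_vec w" using sc least(1) by simp
    fix i assume "i < dim_vec w"
    then show "coords ?E ?F ?G \<Delta>q \<Delta>r $ i = w $ i"
      using arg_cong[OF diff, of "\<lambda>v. v $ i"] sc least(1) by simp
  qed
  then have sparse: "?E = \<Delta>E \<and> ?F = \<Delta>F \<and> ?G = \<Delta>G \<and> \<Delta>q = \<Delta>q \<and> \<Delta>r = \<Delta>r"
    by (intro coords_inj[OF sadm adm]) (simp add: coords_w)
  then have t_sparse: "(\<Delta>E, \<Delta>F, \<Delta>G, \<Delta>q, \<Delta>r) = sparsify E F G (\<Delta>E, \<Delta>F, \<Delta>G, \<Delta>q, \<Delta>r)"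
    unfolding sparsify.simps by simp
  have t_G1: "(\<Delta>E, \<Delta>F, \<Delta>G, \<Delta>q, \<Delta>r) \<in> G1 E F G q r u p" using G1 sparse by simp
  have "xi_sps ?\<sigma> E F G q r u p = zeta ?\<sigma> (\<Delta>E, \<Delta>F, \<Delta>G, \<Delta>q, \<Delta>r)"
    unfolding xi_sps_def
  proof (rule cInf_eq_minimum)
    show "zeta ?\<sigma> (\<Delta>E, \<Delta>F, \<Delta>G, \<Delta>q, \<Delta>r)
      \<in> {zeta ?\<sigma> (sparsify E F G t) |t. sparsify E F G t \<in> G1 E F G q r u p}"
      using t_sparse t_G1 by (metis (mono_tags, lifting) mem_Collect_eq)
    \<comment> \<open>For a competitor only the sparsified form is known to be admissible, so the
      norm comparison is made for the coordinates of that form.\<close>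
    fix y assume "y \<in> {zeta ?\<sigma> (sparsify E F G t) |t. sparsify E F G t \<in> G1 E F G q r u p}"
    then obtain XE XF XG xq xr where y: "y = zeta ?\<sigma> (sparsify E F G (XE, XF, XG, xq, xr))"
      and mem: "sparsify E F G (XE, XF, XG, xq, xr) \<in> G1 E F G q r u p" by auto
    let ?XE = "XE \<odot>\<^sub>m Theta E" and ?XF = "XF \<odot>\<^sub>m Theta F" and ?XG = "XG \<odot>\<^sub>m Theta G"
    have xadm: "(?XE, ?XF, ?XG, xq, xr) \<in> admissible"
      using mem unfolding sparsify.simps G1_iff[OF q r] by blast
    note XD = admissibleD[OF xadm]
    \<comment> \<open>The entrywise product inherits the shape of its first factor, so shapes carry
      back to the original matrices, as the idempotence facts require.\<close>
    have Xc: "XE \<in> carrier_mat n n" "XF \<in> carrier_mat m n" "XG \<in> carrier_mat m m"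
      using XD(1,3,4) by (auto simp: hadamard_mat_def intro!: carrier_matI)
    have "system_mat *\<^sub>v coords ?XE ?XF ?XG xq xr = ?b"
      using mem unfolding solves[OF xadm] sparsify.simps hadamard_Theta_idem[OF Xc(1) E(1)]
        hadamard_Theta_idem[OF Xc(2) F] hadamard_Theta_idem[OF Xc(3) G] .
    then show "zeta ?\<sigma> (\<Delta>E, \<Delta>F, \<Delta>G, \<Delta>q, \<Delta>r) \<le> y"
      unfolding y sparsify.simps zeta_eq_norm_coords[OF adm] zeta_eq_norm_coords[OF xadm] coords_w
      by (intro real_sqrt_le_mono norm_le coords_carrier[OF XD(1,3-6)])
  qed
  with t_sparse t_G1 show ?thesis unfolding optimal_sps_def by simp
qed

section \<open>The explicit formulas\<close>

lemma split_coords_blocks: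
  assumes "w \<in> carrier_vec coords_dim"
  obtains a b c d e f g h i j where
    "a \<in> carrier_vec len0" "b \<in> carrier_vec len1" "c \<in> carrier_vec (n * m)" "d \<in> carrier_vec (n * m)"
    "e \<in> carrier_vec (m * m)" "f \<in> carrier_vec (m * m)" "g \<in> carrier_vec n" "h \<in> carrier_vec n"
    "i \<in> carrier_vec m" "j \<in> carrier_vec m" "w = a @\<^sub>v b @\<^sub>v c @\<^sub>v d @\<^sub>v e @\<^sub>v f @\<^sub>v g @\<^sub>v h @\<^sub>v i @\<^sub>v j"
  using assms[folded coords_dim_eq] by (elim append_vec_split) blast

text \<open>Each selection matrix cuts out of \<open>w\<close> the blocks of one unknown, and the
  resulting equation can be solved for the coordinates of that unknown and back. An equivalence is
  proved because the theorem needs the exact set of tuples that satisfy the formulas.\<close>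

lemma explicit_formulas_iff:
  fixes l n\<^sub>1 n\<^sub>2 :: nat and w :: "real vec" and wc :: "complex vec"
  assumes carriers: "a \<in> carrier_vec len0" "b \<in> carrier_vec len1" "c \<in> carrier_vec (n * m)"
    "d \<in> carrier_vec (n * m)" "e \<in> carrier_vec (m * m)" "f \<in> carrier_vec (m * m)" "g \<in> carrier_vec n"
    "h \<in> carrier_vec n" "i \<in> carrier_vec m" "j \<in> carrier_vec m"
    and w: "w = a @\<^sub>v b @\<^sub>v c @\<^sub>v d @\<^sub>v e @\<^sub>v f @\<^sub>v g @\<^sub>v h @\<^sub>v i @\<^sub>v j"
    and wc: "wc = map_vec complex_of_real w"
    and l: "l = coords_dim" and n\<^sub>1: "n\<^sub>1 = len0" and n\<^sub>2: "n\<^sub>2 = len1"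
  shows "(
       \<Delta>E \<in> carrier_mat n n \<and> \<Delta>F \<in> carrier_mat m n \<and> \<Delta>G \<in> carrier_mat m m \<and>
       \<Delta>q \<in> carrier_vec n \<and> \<Delta>r \<in> carrier_vec m \<and>
       transpose_mat (map_mat Re \<Delta>E) = map_mat Re \<Delta>E \<and>
       transpose_mat (map_mat Im \<Delta>E) = - map_mat Im \<Delta>E \<and>
       vec_S (map_mat Re \<Delta>E) =
         inverse \<alpha>\<^sub>1 \<cdot>\<^sub>v ((mat_inv (D_S n) * (1\<^sub>m n\<^sub>1 @\<^sub>c 0\<^sub>m n\<^sub>1 (l - n\<^sub>1))) *\<^sub>v w) \<and>
       vec_SK (map_mat Im \<Delta>E) =
         inverse \<alpha>\<^sub>1 \<cdot>\<^sub>v ((mat_inv (D_SK n) * (0\<^sub>m n\<^sub>2 n\<^sub>1 @\<^sub>c 1\<^sub>m n\<^sub>2 @\<^sub>c 0\<^sub>m n\<^sub>2 (l - n\<^sup>2))) *\<^sub>v w) \<and>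
       vec_of_mat \<Delta>F = complex_of_real (inverse \<alpha>\<^sub>2) \<cdot>\<^sub>v
         ((0\<^sub>m (n * m) (n\<^sup>2) @\<^sub>c 1\<^sub>m (n * m) @\<^sub>c \<i> \<cdot>\<^sub>m 1\<^sub>m (n * m) @\<^sub>c
           0\<^sub>m (n * m) (l - n\<^sup>2 - 2 * n * m)) *\<^sub>v wc) \<and>
       vec_of_mat \<Delta>G = complex_of_real (inverse \<alpha>\<^sub>3) \<cdot>\<^sub>v
         ((0\<^sub>m (m\<^sup>2) (n\<^sup>2 + 2 * n * m) @\<^sub>c 1\<^sub>m (m\<^sup>2) @\<^sub>c \<i> \<cdot>\<^sub>m 1\<^sub>m (m\<^sup>2) @\<^sub>c
           0\<^sub>m (m\<^sup>2) (2 * (m + n))) *\<^sub>v wc) \<and>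
       \<Delta>q = complex_of_real (inverse \<beta>\<^sub>1) \<cdot>\<^sub>v
         ((0\<^sub>m n (l - 2 * (n + m)) @\<^sub>c 1\<^sub>m n @\<^sub>c \<i> \<cdot>\<^sub>m 1\<^sub>m n @\<^sub>c 0\<^sub>m n (2 * m)) *\<^sub>v wc) \<and>
       \<Delta>r = complex_of_real (inverse \<beta>\<^sub>2) \<cdot>\<^sub>v
         ((0\<^sub>m m (l - 2 * m) @\<^sub>c 1\<^sub>m m @\<^sub>c \<i> \<cdot>\<^sub>m 1\<^sub>m m) *\<^sub>v wc)) \<longleftrightarrow> (\<Delta>E, \<Delta>F, \<Delta>G, \<Delta>q, \<Delta>r) \<in> admissible \<and> coords \<Delta>E \<Delta>F \<Delta>G \<Delta>q \<Delta>r = w"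
  (is "?formulas \<longleftrightarrow> ?adm \<and> ?coords")
proof -
  let ?C = "map_vec complex_of_real"
  let ?carriers = "\<Delta>E \<in> carrier_mat n n \<and> \<Delta>F \<in> carrier_mat m n \<and> \<Delta>G \<in> carrier_mat m m \<and>
    \<Delta>q \<in> carrier_vec n \<and> \<Delta>r \<in> carrier_vec m"
  note dims = carriers[THEN carrier_vecD]
  note ls = length_lower_positions_add[of n] power2_eq_square[of m]
  have nz: "\<alpha>\<^sub>1 \<noteq> 0" "\<alpha>\<^sub>2 \<noteq> 0" "\<alpha>\<^sub>3 \<noteq> 0" "\<beta>\<^sub>1 \<noteq> 0" "\<beta>\<^sub>2 \<noteq> 0" using pos by auto
  have wl: "w \<in> carrier_vec l" unfolding l w coords_dim_eq[symmetric] by (intro append_carrier_vec carriers)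
  \<comment> \<open>Keeps the truncated subtraction \<open>l - len0\<close> exact.\<close>
  have len0_le: "len0 \<le> l" unfolding l coords_dim_eq[symmetric] by simp
  have sel1: "(mat_inv (D_S n) * (1\<^sub>m n\<^sub>1 @\<^sub>c 0\<^sub>m n\<^sub>1 (l - n\<^sub>1))) *\<^sub>v w = mat_inv (weight_mat 0 n) *\<^sub>v a"
  proof -
    have rest: "b @\<^sub>v c @\<^sub>v d @\<^sub>v e @\<^sub>v f @\<^sub>v g @\<^sub>v h @\<^sub>v i @\<^sub>v j \<in> carrier_vec (l - len0)"
      by (rule carrier_vecI) (simp add: dims l coords_dim_eq[symmetric])
    have S: "1\<^sub>m len0 @\<^sub>c 0\<^sub>m len0 (l - len0) \<in> carrier_mat len0 l"
      using append_cols_carrier[OF one_carrier_mat zero_carrier_mat, of len0 "l - len0"] len0_le by simp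
    show ?thesis
      unfolding D_S_eq n\<^sub>1 assoc_mult_mat_vec[OF weight_mat_inv(1) S wl]
      unfolding w selection_first_mult_vec[OF carriers(1) rest] ..
  qed
  have sel2: "(mat_inv (D_SK n) * (0\<^sub>m n\<^sub>2 n\<^sub>1 @\<^sub>c 1\<^sub>m n\<^sub>2 @\<^sub>c 0\<^sub>m n\<^sub>2 (l - n\<^sup>2))) *\<^sub>v w = mat_inv (weight_mat 1 n) *\<^sub>v b"
  proof -
    have rest: "c @\<^sub>v d @\<^sub>v e @\<^sub>v f @\<^sub>v g @\<^sub>v h @\<^sub>v i @\<^sub>v j \<in> carrier_vec (l - n\<^sup>2)"
      by (rule carrier_vecI) (simp add: dims l power2_eq_square[of m])
    have "0\<^sub>m len1 len0 @\<^sub>c 1\<^sub>m len1 @\<^sub>c 0\<^sub>m len1 (l - n\<^sup>2) \<in> carrier_mat len1 (len0 + (len1 + (l - n\<^sup>2)))"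
      by (intro append_cols_carrier one_carrier_mat zero_carrier_mat)
    \<comment> \<open>The two triangles together have \<open>n\<^sup>2\<close> positions, so the
      three column blocks add up to the full width \<open>l\<close>.\<close>
    moreover have "len0 + (len1 + (l - n\<^sup>2)) = l" using ls(1) by (simp add: l)
    ultimately have S: "0\<^sub>m len1 len0 @\<^sub>c 1\<^sub>m len1 @\<^sub>c 0\<^sub>m len1 (l - n\<^sup>2) \<in> carrier_mat len1 l" by (simp only:)
    show ?thesis
      unfolding D_SK_eq n\<^sub>1 n\<^sub>2 assoc_mult_mat_vec[OF weight_mat_inv(1) S wl]
      unfolding w selection_middle_mult_vec[OF carriers(1,2) rest] ..
  qed
  have selF: "(0\<^sub>m (n * m) (n\<^sup>2) @\<^sub>c 1\<^sub>m (n * m) @\<^sub>c \<i> \<cdot>\<^sub>m 1\<^sub>m (n * m) @\<^sub>c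
      0\<^sub>m (n * m) (l - n\<^sup>2 - 2 * n * m)) *\<^sub>v wc = ?C c + \<i> \<cdot>\<^sub>v ?C d"
  proof -
    have x: "?C (a @\<^sub>v b) \<in> carrier_vec (n\<^sup>2)" by (rule carrier_vecI) (use ls(1) in \<open>simp add: dims\<close>)
    have y: "?C (e @\<^sub>v f @\<^sub>v g @\<^sub>v h @\<^sub>v i @\<^sub>v j) \<in> carrier_vec (l - n\<^sup>2 - 2 * n * m)"
      by (rule carrier_vecI) (simp add: dims l power2_eq_square[of m] mult.commute)
    have "wc = ?C (a @\<^sub>v b) @\<^sub>v ?C c @\<^sub>v ?C d @\<^sub>v ?C (e @\<^sub>v f @\<^sub>v g @\<^sub>v h @\<^sub>v i @\<^sub>v j)"
      unfolding wc w map_vec_append append_vec_assoc ..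
    then show ?thesis
      using selection_complex_mult_vec[OF x map_carrier_vec[THEN iffD2, OF carriers(3)]
        map_carrier_vec[THEN iffD2, OF carriers(4)] y] by simp
  qed
  have selG: "(0\<^sub>m (m\<^sup>2) (n\<^sup>2 + 2 * n * m) @\<^sub>c 1\<^sub>m (m\<^sup>2) @\<^sub>c \<i> \<cdot>\<^sub>m 1\<^sub>m (m\<^sup>2) @\<^sub>c
      0\<^sub>m (m\<^sup>2) (2 * (m + n))) *\<^sub>v wc = ?C e + \<i> \<cdot>\<^sub>v ?C f"
  proof -
    have x: "?C (a @\<^sub>v b @\<^sub>v c @\<^sub>v d) \<in> carrier_vec (n\<^sup>2 + 2 * n * m)"
      by (rule carrier_vecI) (use ls(1) in \<open>simp add: dims\<close>)
    have y: "?C (g @\<^sub>v h @\<^sub>v i @\<^sub>v j) \<in> carrier_vec (2 * (m + n))"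
      by (rule carrier_vecI) (simp add: dims)
    have ef: "?C e \<in> carrier_vec (m\<^sup>2)" "?C f \<in> carrier_vec (m\<^sup>2)"
      by (rule carrier_vecI, simp add: dims power2_eq_square)+
    have "wc = ?C (a @\<^sub>v b @\<^sub>v c @\<^sub>v d) @\<^sub>v ?C e @\<^sub>v ?C f @\<^sub>v ?C (g @\<^sub>v h @\<^sub>v i @\<^sub>v j)"
      unfolding wc w map_vec_append append_vec_assoc ..
    then show ?thesis using selection_complex_mult_vec[OF x ef y] by simp
  qed
  have selq: "(0\<^sub>m n (l - 2 * (n + m)) @\<^sub>c 1\<^sub>m n @\<^sub>c \<i> \<cdot>\<^sub>m 1\<^sub>m n @\<^sub>c 0\<^sub>m n (2 * m)) *\<^sub>v wc = ?C g + \<i> \<cdot>\<^sub>v ?C h"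
  proof -
    have x: "?C (a @\<^sub>v b @\<^sub>v c @\<^sub>v d @\<^sub>v e @\<^sub>v f) \<in> carrier_vec (l - 2 * (n + m))"
      by (rule carrier_vecI) (use ls(1) in \<open>simp add: dims l power2_eq_square[of m]\<close>)
    have y: "?C (i @\<^sub>v j) \<in> carrier_vec (2 * m)" by (rule carrier_vecI) (simp add: dims)
    have "wc = ?C (a @\<^sub>v b @\<^sub>v c @\<^sub>v d @\<^sub>v e @\<^sub>v f) @\<^sub>v ?C g @\<^sub>v ?C h @\<^sub>v ?C (i @\<^sub>v j)"
      unfolding wc w map_vec_append append_vec_assoc ..
    then show ?thesis
      using selection_complex_mult_vec[OF x map_carrier_vec[THEN iffD2, OF carriers(7)]
        map_carrier_vec[THEN iffD2, OF carriers(8)] y] by simp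
  qed
  have selr: "(0\<^sub>m m (l - 2 * m) @\<^sub>c 1\<^sub>m m @\<^sub>c \<i> \<cdot>\<^sub>m 1\<^sub>m m) *\<^sub>v wc = ?C i + \<i> \<cdot>\<^sub>v ?C j"
  proof -
    have x: "?C (a @\<^sub>v b @\<^sub>v c @\<^sub>v d @\<^sub>v e @\<^sub>v f @\<^sub>v g @\<^sub>v h) \<in> carrier_vec (l - 2 * m)"
      by (rule carrier_vecI) (use ls(1) in \<open>simp add: dims l power2_eq_square[of m]\<close>)
    have "wc = ?C (a @\<^sub>v b @\<^sub>v c @\<^sub>v d @\<^sub>v e @\<^sub>v f @\<^sub>v g @\<^sub>v h) @\<^sub>v ?C i @\<^sub>v ?C j"
      unfolding wc w map_vec_append append_vec_assoc ..
    then show ?thesis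
      using selection_complex_last_mult_vec[OF x map_carrier_vec[THEN iffD2, OF carriers(9)]
        map_carrier_vec[THEN iffD2, OF carriers(10)]] by simp
  qed
  \<comment> \<open>Vectorizations translate into coordinates only for arguments of the right shape.
    Both sides of the equivalence contain the shape conditions, so otherwise both are false.\<close>
  have main: "?formulas \<longleftrightarrow> ?adm \<and> ?coords" if car: ?carriers
  proof -
    from car have D: "\<Delta>E \<in> carrier_mat n n" "\<Delta>F \<in> carrier_mat m n" "\<Delta>G \<in> carrier_mat m m"
      "\<Delta>q \<in> carrier_vec n" "\<Delta>r \<in> carrier_vec m" by blast+
    have Ec: "map_mat Re \<Delta>E \<in> carrier_mat n n" "map_mat Im \<Delta>E \<in> carrier_mat n n" using D by simp_all
    have adm: "?adm \<longleftrightarrow> transpose_mat (map_mat Re \<Delta>E) = map_mat Re \<Delta>E \<and>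
        transpose_mat (map_mat Im \<Delta>E) = - map_mat Im \<Delta>E"
      using D Ec hermitian_iff_parity_sym[OF D(1)] parity_sym_0_iff[of n] parity_sym_1_iff[of n]
      unfolding admissible_def by blast
    have coords: "?coords \<longleftrightarrow>
      vec_S (map_mat Re \<Delta>E) = inverse \<alpha>\<^sub>1 \<cdot>\<^sub>v (mat_inv (weight_mat 0 n) *\<^sub>v a) \<and>
      vec_SK (map_mat Im \<Delta>E) = inverse \<alpha>\<^sub>1 \<cdot>\<^sub>v (mat_inv (weight_mat 1 n) *\<^sub>v b) \<and>
      vec_of_mat \<Delta>F = complex_of_real (inverse \<alpha>\<^sub>2) \<cdot>\<^sub>v (?C c + \<i> \<cdot>\<^sub>v ?C d) \<and>
      vec_of_mat \<Delta>G = complex_of_real (inverse \<alpha>\<^sub>3) \<cdot>\<^sub>v (?C e + \<i> \<cdot>\<^sub>v ?C f) \<and>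
      \<Delta>q = complex_of_real (inverse \<beta>\<^sub>1) \<cdot>\<^sub>v (?C g + \<i> \<cdot>\<^sub>v ?C h) \<and>
      \<Delta>r = complex_of_real (inverse \<beta>\<^sub>2) \<cdot>\<^sub>v (?C i + \<i> \<cdot>\<^sub>v ?C j)"
      unfolding w coords_eq_append_iff[OF D carriers(1-9)]
        vec_S_eq_lower_vec[OF Ec(1)] vec_SK_eq_lower_vec[OF Ec(2)]
        weight_mat_eq_iff[OF lower_vec_carrier[OF Ec(1)] carriers(1) nz(1)]
        weight_mat_eq_iff[OF lower_vec_carrier[OF Ec(2)] carriers(2) nz(1)] sym_coords_def
        complex_vec_eq_iff[OF vec_of_mat_carrier[OF D(2)] carriers(3,4) nz(2)]
        complex_vec_eq_iff[OF vec_of_mat_carrier[OF D(3)] carriers(5,6) nz(3)]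
        complex_vec_eq_iff[OF D(4) carriers(7,8) nz(4)]
        complex_vec_eq_iff[OF D(5) carriers(9,10) nz(5)] map_vec_vec_of_mat
      by blast
    show ?thesis unfolding sel1 sel2 selF selG selq selr adm coords using D by blast
  qed
  show ?thesis
  proof (cases ?carriers)
    case False
    then show ?thesis unfolding admissible_def by blast
  qed (rule main)
qed

end

text \<open>The formulas are shown to have exactly one solution, and this solution to be optimal, so
  that the tuple being determined by the formulas is part of the claim.\<close>

theorem mainTheorem2:
  fixes n m n\<^sub>1 n\<^sub>2 s l :: nat
    and E F G :: "complex mat" and q r u p Q R :: "complex vec"
    and \<alpha>\<^sub>1 \<alpha>\<^sub>2 \<alpha>\<^sub>3 \<beta>\<^sub>1 \<beta>\<^sub>2 :: real
    and N\<^sub>1 N\<^sub>2 I\<^sub>1 I\<^sub>2 Xh\<^sub>1 Xh\<^sub>2 X\<^sub>1 X\<^sub>2 W ru iu rp ip :: "real mat"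
    and w :: "real vec" and wc :: "complex vec"
  assumes E: "E \<in> carrier_mat n n" "mat_adjoint E = E"
    and F: "F \<in> carrier_mat m n"
    and G: "G \<in> carrier_mat m m"
    and q: "q \<in> carrier_vec n" and r: "r \<in> carrier_vec m"
    and nonsing: "invertible_mat (four_block_mat E (mat_adjoint F) F G)"
    and pos: "\<alpha>\<^sub>1 > 0" "\<alpha>\<^sub>2 > 0" "\<alpha>\<^sub>3 > 0" "\<beta>\<^sub>1 > 0" "\<beta>\<^sub>2 > 0"
    and u: "u \<in> carrier_vec n" and p: "p \<in> carrier_vec m"
    and Q: "Q = q - E *\<^sub>v u - mat_adjoint F *\<^sub>v p"
    and R: "R = r - F *\<^sub>v u - G *\<^sub>v p"
    and N\<^sub>1: "N\<^sub>1 = J_S n * Phi_mat E * mat_inv (D_S n)"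
    and N\<^sub>2: "N\<^sub>2 = J_SK n * Psi_mat E * mat_inv (D_SK n)"
    and ru: "ru = mat_of_row (map_vec Re u)" and iu: "iu = mat_of_row (map_vec Im u)"
    and rp: "rp = mat_of_row (map_vec Re p)" and ip: "ip = mat_of_row (map_vec Im p)"
    and I\<^sub>1: "I\<^sub>1 = (- inverse \<beta>\<^sub>1) \<cdot>\<^sub>m 1\<^sub>m (2 * n) @\<^sub>c 0\<^sub>m (2 * n) (2 * m)"
    and I\<^sub>2: "I\<^sub>2 = 0\<^sub>m (2 * m) (2 * n) @\<^sub>c (- inverse \<beta>\<^sub>2) \<cdot>\<^sub>m 1\<^sub>m (2 * m)"
    and Xh\<^sub>1: "Xh\<^sub>1 =
        (inverse \<alpha>\<^sub>1 \<cdot>\<^sub>m ((ru \<otimes>\<^sub>K 1\<^sub>m n) * N\<^sub>1) @\<^sub>c (- inverse \<alpha>\<^sub>1) \<cdot>\<^sub>m ((iu \<otimes>\<^sub>K 1\<^sub>m n) * N\<^sub>2) @\<^sub>c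
         inverse \<alpha>\<^sub>2 \<cdot>\<^sub>m ((1\<^sub>m n \<otimes>\<^sub>K rp) * Sigma_mat F) @\<^sub>c inverse \<alpha>\<^sub>2 \<cdot>\<^sub>m ((1\<^sub>m n \<otimes>\<^sub>K ip) * Sigma_mat F))
        @\<^sub>r
        (inverse \<alpha>\<^sub>1 \<cdot>\<^sub>m ((iu \<otimes>\<^sub>K 1\<^sub>m n) * N\<^sub>1) @\<^sub>c inverse \<alpha>\<^sub>1 \<cdot>\<^sub>m ((ru \<otimes>\<^sub>K 1\<^sub>m n) * N\<^sub>2) @\<^sub>c
         inverse \<alpha>\<^sub>2 \<cdot>\<^sub>m ((1\<^sub>m n \<otimes>\<^sub>K ip) * Sigma_mat F) @\<^sub>c (- inverse \<alpha>\<^sub>2) \<cdot>\<^sub>m ((1\<^sub>m n \<otimes>\<^sub>K rp) * Sigma_mat F))"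
    and Xh\<^sub>2: "Xh\<^sub>2 =
        (inverse \<alpha>\<^sub>2 \<cdot>\<^sub>m ((ru \<otimes>\<^sub>K 1\<^sub>m m) * Sigma_mat F) @\<^sub>c (- inverse \<alpha>\<^sub>2) \<cdot>\<^sub>m ((iu \<otimes>\<^sub>K 1\<^sub>m m) * Sigma_mat F) @\<^sub>c
         inverse \<alpha>\<^sub>3 \<cdot>\<^sub>m ((rp \<otimes>\<^sub>K 1\<^sub>m m) * Sigma_mat G) @\<^sub>c (- inverse \<alpha>\<^sub>3) \<cdot>\<^sub>m ((ip \<otimes>\<^sub>K 1\<^sub>m m) * Sigma_mat G))
        @\<^sub>r
        (inverse \<alpha>\<^sub>2 \<cdot>\<^sub>m ((iu \<otimes>\<^sub>K 1\<^sub>m m) * Sigma_mat F) @\<^sub>c inverse \<alpha>\<^sub>2 \<cdot>\<^sub>m ((ru \<otimes>\<^sub>K 1\<^sub>m m) * Sigma_mat F) @\<^sub>c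
         inverse \<alpha>\<^sub>3 \<cdot>\<^sub>m ((ip \<otimes>\<^sub>K 1\<^sub>m m) * Sigma_mat G) @\<^sub>c inverse \<alpha>\<^sub>3 \<cdot>\<^sub>m ((rp \<otimes>\<^sub>K 1\<^sub>m m) * Sigma_mat G))"
    and X\<^sub>1: "X\<^sub>1 = Xh\<^sub>1 @\<^sub>c 0\<^sub>m (2 * n) (2 * m\<^sup>2)"
    and X\<^sub>2: "X\<^sub>2 = 0\<^sub>m (2 * m) (n\<^sup>2) @\<^sub>c Xh\<^sub>2"
    and W: "W = four_block_mat X\<^sub>1 I\<^sub>1 X\<^sub>2 I\<^sub>2"
    and s: "s = n\<^sup>2 + 2 * m * n + 2 * m\<^sup>2"
    and l: "l = s + 2 * (m + n)"
    and n\<^sub>1: "n\<^sub>1 = n * (n + 1) div 2"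
    and n\<^sub>2: "n\<^sub>2 = n * (n - 1) div 2"
    and w: "w = (transpose_mat W * mat_inv (W * transpose_mat W)) *\<^sub>v
              (map_vec Re Q @\<^sub>v map_vec Im Q @\<^sub>v map_vec Re R @\<^sub>v map_vec Im R)"
    and wc: "wc = map_vec complex_of_real w"
  shows "\<exists>t.
    {(\<Delta>E, \<Delta>F, \<Delta>G, \<Delta>q, \<Delta>r).
       \<Delta>E \<in> carrier_mat n n \<and> \<Delta>F \<in> carrier_mat m n \<and> \<Delta>G \<in> carrier_mat m m \<and>
       \<Delta>q \<in> carrier_vec n \<and> \<Delta>r \<in> carrier_vec m \<and>
       transpose_mat (map_mat Re \<Delta>E) = map_mat Re \<Delta>E \<and>
       transpose_mat (map_mat Im \<Delta>E) = - map_mat Im \<Delta>E \<and>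
       vec_S (map_mat Re \<Delta>E) =
         inverse \<alpha>\<^sub>1 \<cdot>\<^sub>v ((mat_inv (D_S n) * (1\<^sub>m n\<^sub>1 @\<^sub>c 0\<^sub>m n\<^sub>1 (l - n\<^sub>1))) *\<^sub>v w) \<and>
       vec_SK (map_mat Im \<Delta>E) =
         inverse \<alpha>\<^sub>1 \<cdot>\<^sub>v ((mat_inv (D_SK n) * (0\<^sub>m n\<^sub>2 n\<^sub>1 @\<^sub>c 1\<^sub>m n\<^sub>2 @\<^sub>c 0\<^sub>m n\<^sub>2 (l - n\<^sup>2))) *\<^sub>v w) \<and>
       vec_of_mat \<Delta>F = complex_of_real (inverse \<alpha>\<^sub>2) \<cdot>\<^sub>v
         ((0\<^sub>m (n * m) (n\<^sup>2) @\<^sub>c 1\<^sub>m (n * m) @\<^sub>c \<i> \<cdot>\<^sub>m 1\<^sub>m (n * m) @\<^sub>c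
           0\<^sub>m (n * m) (l - n\<^sup>2 - 2 * n * m)) *\<^sub>v wc) \<and>
       vec_of_mat \<Delta>G = complex_of_real (inverse \<alpha>\<^sub>3) \<cdot>\<^sub>v
         ((0\<^sub>m (m\<^sup>2) (n\<^sup>2 + 2 * n * m) @\<^sub>c 1\<^sub>m (m\<^sup>2) @\<^sub>c \<i> \<cdot>\<^sub>m 1\<^sub>m (m\<^sup>2) @\<^sub>c
           0\<^sub>m (m\<^sup>2) (2 * (m + n))) *\<^sub>v wc) \<and>
       \<Delta>q = complex_of_real (inverse \<beta>\<^sub>1) \<cdot>\<^sub>v
         ((0\<^sub>m n (l - 2 * (n + m)) @\<^sub>c 1\<^sub>m n @\<^sub>c \<i> \<cdot>\<^sub>m 1\<^sub>m n @\<^sub>c 0\<^sub>m n (2 * m)) *\<^sub>v wc) \<and>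
       \<Delta>r = complex_of_real (inverse \<beta>\<^sub>2) \<cdot>\<^sub>v
         ((0\<^sub>m m (l - 2 * m) @\<^sub>c 1\<^sub>m m @\<^sub>c \<i> \<cdot>\<^sub>m 1\<^sub>m m) *\<^sub>v wc)} = {t} \<and>
    optimal_sps (\<alpha>\<^sub>1, \<alpha>\<^sub>2, \<alpha>\<^sub>3, \<beta>\<^sub>1, \<beta>\<^sub>2) E F G q r u p t"
proof -
  interpret sp: saddle_point n m E F G u p \<alpha>\<^sub>1 \<alpha>\<^sub>2 \<alpha>\<^sub>3 \<beta>\<^sub>1 \<beta>\<^sub>2
    by unfold_locales (fact E F G u p pos)+
  \<comment> \<open>\<open>Psi_mat\<close> reads the upper triangle, so this identification rests on
    \<open>E\<close> being Hermitian.\<close>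
  have Psi: "Psi_mat E = pattern_mat 1 E"
    by (rule Psi_mat_eq[OF E(1)]) (rule Theta_symmetric[OF E])
  have N: "N\<^sub>1 = sp.sym_factor 0" "N\<^sub>2 = sp.sym_factor 1"
    unfolding N\<^sub>1 N\<^sub>2 sp.sym_factor_def J_S_eq J_SK_eq D_S_eq D_SK_eq Phi_mat_eq[OF E(1)]
      Psi by (rule refl)+
  have W_eq: "W = sp.system_mat"
    unfolding W X\<^sub>1 X\<^sub>2 Xh\<^sub>1 Xh\<^sub>2 I\<^sub>1 I\<^sub>2 N ru iu rp ip
      sp.system_mat_def sp.upper_block_def sp.lower_block_def ..
  have l': "l = sp.coords_dim" unfolding l s by (simp add: algebra_simps)
  have len: "n\<^sub>1 = length (lower_positions 0 n)" "n\<^sub>2 = length (lower_positions 1 n)"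
    unfolding n\<^sub>1 n\<^sub>2 length_lower_positions_0 length_lower_positions_1 by (rule refl)+
  note w' = w[unfolded W_eq Q R]
  have w_carrier: "w \<in> carrier_vec sp.coords_dim"
    unfolding w' using carrier_matD(2)[OF sp.system_mat_carrier] by (intro carrier_vecI) simp
  obtain a b c d e f g h i j where blocks:
    "a \<in> carrier_vec (length (lower_positions 0 n))" "b \<in> carrier_vec (length (lower_positions 1 n))"
    "c \<in> carrier_vec (n * m)" "d \<in> carrier_vec (n * m)"
    "e \<in> carrier_vec (m * m)" "f \<in> carrier_vec (m * m)" "g \<in> carrier_vec n" "h \<in> carrier_vec n"
    "i \<in> carrier_vec m" "j \<in> carrier_vec m" and
    w_blocks: "w = a @\<^sub>v b @\<^sub>v c @\<^sub>v d @\<^sub>v e @\<^sub>v f @\<^sub>v g @\<^sub>v h @\<^sub>v i @\<^sub>v j"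
    by (rule sp.split_coords_blocks[OF w_carrier])
  obtain \<Delta>E \<Delta>F \<Delta>G \<Delta>q \<Delta>r where adm: "(\<Delta>E, \<Delta>F, \<Delta>G, \<Delta>q, \<Delta>r) \<in> sp.admissible"
    and coords: "sp.coords \<Delta>E \<Delta>F \<Delta>G \<Delta>q \<Delta>r = w"
    using sp.coords_surj[OF blocks] unfolding w_blocks by blast
  \<comment> \<open>The left side is what \<open>explicit_formulas_iff\<close> makes of the
    formulas; injectivity of \<open>coords\<close> then reduces the set to a singleton.\<close>
  have unique: "(XE, XF, XG, xq, xr) \<in> sp.admissible \<and> sp.coords XE XF XG xq xr = w \<longleftrightarrow>
      (XE, XF, XG, xq, xr) = (\<Delta>E, \<Delta>F, \<Delta>G, \<Delta>q, \<Delta>r)" for XE XF XG xq xr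
  proof
    assume "(XE, XF, XG, xq, xr) \<in> sp.admissible \<and> sp.coords XE XF XG xq xr = w"
    then show "(XE, XF, XG, xq, xr) = (\<Delta>E, \<Delta>F, \<Delta>G, \<Delta>q, \<Delta>r)"
      using sp.coords_inj[OF _ adm] unfolding coords prod.inject by blast
  next
    assume "(XE, XF, XG, xq, xr) = (\<Delta>E, \<Delta>F, \<Delta>G, \<Delta>q, \<Delta>r)"
    then show "(XE, XF, XG, xq, xr) \<in> sp.admissible \<and> sp.coords XE XF XG xq xr = w"
      unfolding prod.inject using adm coords by blast
  qed
  show ?thesis
    unfolding sp.explicit_formulas_iff[OF blocks w_blocks wc l' len] unique
    by (intro exI[of _ "(\<Delta>E, \<Delta>F, \<Delta>G, \<Delta>q, \<Delta>r)"] conjI, force)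
      (rule sp.optimal_sps_if_least_norm[OF q r w' adm coords])
qed

end
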